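(* Let $(A,\sigma,f)$ be a central simple $F$-algebra of degree $2n$ with quadratic pair, let $(Y,\varphi)$ be a $\Gamma$-set of $2n$ elements with an involution $\varphi$, and let $\varepsilon\colon(Y,\varphi)\hookrightarrow\mathbf{Q}(\sigma,f)$ be an embedding of quadrics. Let $$L_s=\{x\in A_s\mid x\cdot \varepsilon(y)\subset \varepsilon(y)\ \text{ for all } y\in Y\},\qquad L=L_s^\Gamma\subset A,$$ identify $Y$ with $\mathbf{X}(L)$ so that $\varepsilon$ becomes the general embedding $\mathbf{X}(L)\hookrightarrow\mathcal{SB}(A)$ induced by the inclusion $L\hookrightarrow A$, and let $\sigma_L$ be the involution on the étale algebra $L$ that induces $\varphi$ on $\mathbf{X}(L)=Y$. Then the inclusion $L\hookrightarrow A$ is an embedding of algebras with involution $(L,\sigma_L)\hookrightarrow(A,\sigma,f)$.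
   Context: $F$ is an arbitrary field, $F_s$ a separable closure, $\Gamma=\operatorname{Gal}(F_s/F)$, $n\ge1$, and the subscript $s$ on $A,\sigma,f$ denotes scalar extension to $F_s$. Étale algebras with involution. An étale $F$-algebra of dimension $m$ is a commutative $F$-algebra $L$ with $L\otimes_FF_s\cong F_s^m$; $\mathbf{X}(L)=\operatorname{Hom}_{F\text{-alg}}(L,F_s)$ with $\Gamma$-action $({}^\gamma\xi)(\ell)=\gamma(\xi(\ell))$. The functor $\mathbf{X}$ is an anti-equivalence between étale $F$-algebras and finite $\Gamma$-sets (finite sets with continuous $\Gamma$-action). An involution on a $\Gamma$-set is a $\Gamma$-equivariant permutation of order 2 without fixed points; an involution on an étale algebra $L$ is an $F$-algebra automorphism $\sigma_L$ of order 2 such that $\mathbf{X}(\sigma_L)\colon\xi\mapsto\xi\circ\sigma_L$ is an involution of $\mathbf{X}(L)$. Quadratic pairs. For an $F$-algebra $B$ with $F$-linear involution $\sigma$: $\operatorname{Sym}(B,\sigma)=\{x\mid\sigma(x)=x\}$, $\operatorname{Skew}(B,\sigma)=\{x\mid\sigma(x)=-x\}$. A quadratic pair on a central simple $F$-algebra $A$ of degree $2n$ is a pair $(\sigma,f)$ with $\sigma$ an $F$-linear involution on $A$ and $f\colon\operatorname{Sym}(A,\sigma)\to F$ linear such that $\dim_F\operatorname{Sym}(A,\sigma)=n(2n+1)$, $\operatorname{Trd}_A(\operatorname{Skew}(A,\sigma))=\{0\}$, and $f(x+\sigma(x))=\operatorname{Trd}_A(x)$ for all $x\in A$. Embeddings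 of algebras with involution. $\varepsilon\colon(L,\sigma_L)\hookrightarrow(A,\sigma,f)$ (with $\dim L=\deg A=2n$) is an $F$-algebra embedding $\varepsilon\colon L\hookrightarrow A$ such that (a) $\varepsilon\circ\sigma_L=\sigma\circ\varepsilon$, and (b) $f(x)=\operatorname{Trd}_A(\varepsilon(\ell)x)$ for all $x\in\operatorname{Sym}(A,\sigma)$ and all $\ell\in L$ with $\ell+\sigma_L(\ell)=1$. Quadrics. $\mathcal{SB}(A)$ is the $(2n-1)$-dimensional projective space over $F_s$ whose $(k-1)$-dimensional linear varieties are the right ideals of $A_s$ of dimension $2nk$, with the natural $\Gamma$-action. A right ideal $I\subset A_s$ is isotropic if $\sigma_s(I)\cdot I=\{0\}$ and $f_s(I\cap\operatorname{Sym}(A_s,\sigma_s))=\{0\}$. $\mathbf{Q}(\sigma,f)\subset\mathcal{SB}(A)$ is the quadric whose points are the isotropic right ideals of dimension $2n$; the linear varieties lying in it are the isotropic right ideals. An isotropic linear subvariety of $(Y,\varphi)$ is a subset of $Y$ containing no pair $\{y,y^\varphi\}$. A general embedding of a $2n$-element $\Gamma$-set in $\mathcal{SB}(A)$ is an injective $\Gamma$-equivariant map to the set of points of $\mathcal{SB}(A)$ whose image is not contained in a proper linear subspace. An embedding of quadrics $\varepsilon\colon(Y,\varphi)\hookrightarrow\mathbf{Q}(\sigma,f)$ is a general embedding $Y\hookrightarrow\mathcal{SB}(A)$ such that the linear variety spanned by the image of any isotropic subset of $Y$ lies in $\mathbf{Q}(\sigma,f)$. The identification $Y=\mathbf{X}(L)$.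 The general embedding induced by the inclusion $L\hookrightarrow A$ of an étale subalgebra of dimension $2n$ sends $\xi\in\mathbf{X}(L)$ to $\{x\in A_s\mid (1\otimes\xi(\ell))x=(\ell\otimes1)x\ \text{ for all }\ell\in L\}$. For $L$ as in the statement, $L$ is étale of dimension $2n$ and this map has image $\varepsilon(Y)$, so there is a unique isomorphism of $\Gamma$-sets $Y\cong\mathbf{X}(L)$ compatible with the two maps to $\mathcal{SB}(A)$. *)

theory Defs
  imports
    "Jordan_Normal_Form.VS_Connect"
    "HOL-Algebra.Group_Action"
    "HOL-Algebra.QuotRing"
    "HOL-Library.Poly_Mapping"
begin

section \<open>The base field, its separable closure and the Galois group\<close>

text \<open>The field \<open>F\<close> is a type \<open>'f\<close>, the field \<open>F\<^sub>s\<close> is a type \<open>'s\<close>, and the inclusion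
  of \<open>F\<close> in \<open>F\<^sub>s\<close> is a field homomorphism \<open>\<iota>\<close>.\<close>

definition separable_closure :: "('f::field \<Rightarrow> 's::field) \<Rightarrow> bool" where
  "separable_closure \<iota> \<longleftrightarrow>
     field_hom \<iota> \<and>
     (\<forall>x. \<exists>p. irreducible p \<and> coprime p (pderiv p) \<and> poly (map_poly \<iota> p) x = 0) \<and>
     (\<forall>q :: 's poly. degree q > 0 \<and> coprime q (pderiv q) \<longrightarrow> (\<exists>x. poly q x = 0))"

definition Gal :: "('f::field \<Rightarrow> 's::field) \<Rightarrow> ('s \<Rightarrow> 's) monoid" where
  "Gal \<iota> = \<lparr>carrier = {\<gamma>. field_hom \<gamma> \<and> bij \<gamma> \<and> (\<forall>c. \<gamma> (\<iota> c) = \<iota> c)}, mult = (\<circ>), one = id\<rparr>"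

text \<open>The last clause is continuity for the Krull topology: the pointwise stabilizers of finite
  subsets of the algebraic extension \<open>F\<^sub>s\<close> form a base of neighbourhoods of the identity.\<close>

definition gamma_set ::
  "('f::field \<Rightarrow> 's::field) \<Rightarrow> 'y set \<Rightarrow> (('s \<Rightarrow> 's) \<Rightarrow> 'y \<Rightarrow> 'y) \<Rightarrow> bool" where
  "gamma_set \<iota> Y act \<longleftrightarrow>
     finite Y \<and> group_action (Gal \<iota>) Y act \<and>
     (\<forall>y\<in>Y. \<exists>E. finite E \<and> (\<forall>\<gamma>\<in>carrier (Gal \<iota>). (\<forall>e\<in>E. \<gamma> e = e) \<longrightarrow> act \<gamma> y = y))"

definition gamma_involution ::
  "('f::field \<Rightarrow> 's::field) \<Rightarrow> 'y set \<Rightarrow> (('s \<Rightarrow> 's) \<Rightarrow> 'y \<Rightarrow> 'y) \<Rightarrow> ('y \<Rightarrow> 'y) \<Rightarrow> bool" where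
  "gamma_involution \<iota> Y act \<phi> \<longleftrightarrow>
     (\<forall>y\<in>Y. \<phi> y \<in> Y \<and> \<phi> (\<phi> y) = y \<and> \<phi> y \<noteq> y) \<and>
     (\<forall>\<gamma>\<in>carrier (Gal \<iota>). \<forall>y\<in>Y. \<phi> (act \<gamma> y) = act \<gamma> (\<phi> y))"

definition gamma_iso ::
  "('f::field \<Rightarrow> 's::field) \<Rightarrow> 'y set \<Rightarrow> (('s \<Rightarrow> 's) \<Rightarrow> 'y \<Rightarrow> 'y) \<Rightarrow>
   'z set \<Rightarrow> (('s \<Rightarrow> 's) \<Rightarrow> 'z \<Rightarrow> 'z) \<Rightarrow> ('y \<Rightarrow> 'z) \<Rightarrow> bool" where
  "gamma_iso \<iota> Y act Z act' \<psi> \<longleftrightarrow>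
     bij_betw \<psi> Y Z \<and> (\<forall>\<gamma>\<in>carrier (Gal \<iota>). \<forall>y\<in>Y. \<psi> (act \<gamma> y) = act' \<gamma> (\<psi> y))"

section \<open>Algebras over a field\<close>

text \<open>The library locale \<open>algebra\<close> is restricted to commutative algebras. Here algebras are
  associative and unital, not necessarily commutative, with scalars in a type.\<close>

definition assoc_algebra :: "('k::field, 'a, 'm) module_scheme \<Rightarrow> bool" where
  "assoc_algebra A \<longleftrightarrow>
     vectorspace class_ring A \<and> ring A \<and>
     (\<forall>c. \<forall>x\<in>carrier A. \<forall>y\<in>carrier A.
        (c \<odot>\<^bsub>A\<^esub> x) \<otimes>\<^bsub>A\<^esub> y = c \<odot>\<^bsub>A\<^esub> (x \<otimes>\<^bsub>A\<^esub> y) \<and>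
        x \<otimes>\<^bsub>A\<^esub> (c \<odot>\<^bsub>A\<^esub> y) = c \<odot>\<^bsub>A\<^esub> (x \<otimes>\<^bsub>A\<^esub> y))"

definition alg_hom ::
  "('k::field, 'a, 'm) module_scheme \<Rightarrow> ('k, 'b, 'l) module_scheme \<Rightarrow> ('a \<Rightarrow> 'b) set" where
  "alg_hom A B = {h \<in> Ring.ring_hom A B. \<forall>c. \<forall>x\<in>carrier A. h (c \<odot>\<^bsub>A\<^esub> x) = c \<odot>\<^bsub>B\<^esub> h x}"

definition alg_iso ::
  "('k::field, 'a, 'm) module_scheme \<Rightarrow> ('k, 'b, 'l) module_scheme \<Rightarrow> ('a \<Rightarrow> 'b) set" where
  "alg_iso A B = {h \<in> alg_hom A B. bij_betw h (carrier A) (carrier B)}"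

definition linear_form_on ::
  "('k::field, 'a, 'm) module_scheme \<Rightarrow> 'a set \<Rightarrow> ('a \<Rightarrow> 'k) \<Rightarrow> bool" where
  "linear_form_on A S f \<longleftrightarrow>
     (\<forall>x\<in>S. \<forall>y\<in>S. f (x \<oplus>\<^bsub>A\<^esub> y) = f x + f y) \<and>
     (\<forall>c. \<forall>x\<in>S. f (c \<odot>\<^bsub>A\<^esub> x) = c * f x)"

definition subspace_dim :: "('k::field, 'a, 'm) module_scheme \<Rightarrow> 'a set \<Rightarrow> nat" where
  "subspace_dim A S = vectorspace.dim class_ring (A\<lparr>carrier := S\<rparr>)"

text \<open>\<open>F\<^sub>s\<close> as an \<open>F\<close>-algebra, and the split \<open>F\<^sub>s\<close>-algebra \<open>F\<^sub>s\<^sup>m\<close>.\<close>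

definition ext_field_alg :: "('f::field \<Rightarrow> 's::field) \<Rightarrow> ('f, 's) module" where
  "ext_field_alg \<iota> =
     \<lparr>carrier = UNIV, mult = (*), one = 1, zero = 0, add = (+), smult = (\<lambda>c x. \<iota> c * x)\<rparr>"

definition split_alg :: "nat \<Rightarrow> ('s::field, nat \<Rightarrow> 's) module" where
  "split_alg m =
     \<lparr>carrier = extensional {..<m},
      mult = (\<lambda>u v. \<lambda>k\<in>{..<m}. u k * v k), one = (\<lambda>k\<in>{..<m}. 1),
      zero = (\<lambda>k\<in>{..<m}. 0), add = (\<lambda>u v. \<lambda>k\<in>{..<m}. u k + v k),
      smult = (\<lambda>c u. \<lambda>k\<in>{..<m}. c * u k)\<rparr>"

section \<open>Scalar extension\<close>

text \<open>\<open>A \<otimes>\<^sub>F F\<^sub>s\<close> is the quotient of the integral monoid ring of the multiplicative monoid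
  \<open>A \<times> F\<^sub>s\<close> (whose additive group is the free abelian group on \<open>A \<times> F\<^sub>s\<close>) by the ideal
  generated by the relations of \<open>F\<close>-bilinearity. As these relations are stable under multiplication
  by elements of \<open>A \<times> F\<^sub>s\<close>, this ideal is also the additive subgroup which they generate, so that
  the underlying group is the usual tensor product.\<close>

definition pair_ring :: "('f::field, 'a, 'm) module_scheme \<Rightarrow> ('a \<times> 's::field \<Rightarrow>\<^sub>0 int) ring" where
  "pair_ring A =
     \<lparr>carrier = {p. Poly_Mapping.keys p \<subseteq> carrier A \<times> UNIV},
      mult = (\<lambda>p q. frag_extend (\<lambda>(a, c).
                      frag_extend (\<lambda>(b, d). frag_of (a \<otimes>\<^bsub>A\<^esub> b, c * d)) q) p),
      one = frag_of (\<one>\<^bsub>A\<^esub>, 1), zero = 0, add = (+)\<rparr>"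

definition tensor_relations ::
  "('f::field \<Rightarrow> 's::field) \<Rightarrow> ('f, 'a, 'm) module_scheme \<Rightarrow> ('a \<times> 's \<Rightarrow>\<^sub>0 int) set" where
  "tensor_relations \<iota> A =
     {frag_of (a \<oplus>\<^bsub>A\<^esub> b, c) - frag_of (a, c) - frag_of (b, c) | a b c.
        a \<in> carrier A \<and> b \<in> carrier A} \<union>
     {frag_of (a, c + d) - frag_of (a, c) - frag_of (a, d) | a c d. a \<in> carrier A} \<union>
     {frag_of (l \<odot>\<^bsub>A\<^esub> a, c) - frag_of (a, \<iota> l * c) | l a c. a \<in> carrier A}"

definition tensor_ideal ::
  "('f::field \<Rightarrow> 's::field) \<Rightarrow> ('f, 'a, 'm) module_scheme \<Rightarrow> ('a \<times> 's \<Rightarrow>\<^sub>0 int) set" where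
  "tensor_ideal \<iota> A = Idl\<^bsub>pair_ring A\<^esub> (tensor_relations \<iota> A)"

definition tensor ::
  "('f::field \<Rightarrow> 's::field) \<Rightarrow> ('f, 'a, 'm) module_scheme \<Rightarrow> 'a \<Rightarrow> 's \<Rightarrow> ('a \<times> 's \<Rightarrow>\<^sub>0 int) set" where
  "tensor \<iota> A a c = tensor_ideal \<iota> A +>\<^bsub>pair_ring A\<^esub> frag_of (a, c)"

definition scalar_ext ::
  "('f::field \<Rightarrow> 's::field) \<Rightarrow> ('f, 'a, 'm) module_scheme \<Rightarrow>
   ('s, ('a \<times> 's \<Rightarrow>\<^sub>0 int) set) module" where
  "scalar_ext \<iota> A = (let Q = pair_ring A Quot tensor_ideal \<iota> A in
     \<lparr>carrier = carrier Q, mult = mult Q, one = one Q, zero = zero Q, add = add Q,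
      smult = (\<lambda>c X. tensor \<iota> A \<one>\<^bsub>A\<^esub> c \<otimes>\<^bsub>Q\<^esub> X)\<rparr>)"

text \<open>The map \<open>g \<otimes> h\<close> induced by \<open>g : A \<rightarrow> A\<close> and \<open>h : F\<^sub>s \<rightarrow> F\<^sub>s\<close>.\<close>

definition tensor_map ::
  "('f::field \<Rightarrow> 's::field) \<Rightarrow> ('f, 'a, 'm) module_scheme \<Rightarrow> ('a \<Rightarrow> 'a) \<Rightarrow> ('s \<Rightarrow> 's) \<Rightarrow>
   ('a \<times> 's \<Rightarrow>\<^sub>0 int) set \<Rightarrow> ('a \<times> 's \<Rightarrow>\<^sub>0 int) set" where
  "tensor_map \<iota> A g h X =
     the_elem ((\<lambda>p. tensor_ideal \<iota> A +>\<^bsub>pair_ring A\<^esub>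
                       frag_extend (\<lambda>(a, c). frag_of (g a, h c)) p) ` X)"

definition galois_ext ::
  "('f::field \<Rightarrow> 's::field) \<Rightarrow> ('f, 'a, 'm) module_scheme \<Rightarrow> ('s \<Rightarrow> 's) \<Rightarrow>
   ('a \<times> 's \<Rightarrow>\<^sub>0 int) set \<Rightarrow> ('a \<times> 's \<Rightarrow>\<^sub>0 int) set" where
  "galois_ext \<iota> A \<gamma> = tensor_map \<iota> A (\<lambda>a. a) \<gamma>"

definition map_ext ::
  "('f::field \<Rightarrow> 's::field) \<Rightarrow> ('f, 'a, 'm) module_scheme \<Rightarrow> ('a \<Rightarrow> 'a) \<Rightarrow>
   ('a \<times> 's \<Rightarrow>\<^sub>0 int) set \<Rightarrow> ('a \<times> 's \<Rightarrow>\<^sub>0 int) set" where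
  "map_ext \<iota> A \<sigma> = tensor_map \<iota> A \<sigma> (\<lambda>c. c)"

section \<open>Etale algebras with involution\<close>

definition etale :: "('f::field \<Rightarrow> 's::field) \<Rightarrow> nat \<Rightarrow> ('f, 'a, 'm) module_scheme \<Rightarrow> bool" where
  "etale \<iota> m L \<longleftrightarrow>
     assoc_algebra L \<and> (\<forall>x\<in>carrier L. \<forall>y\<in>carrier L. x \<otimes>\<^bsub>L\<^esub> y = y \<otimes>\<^bsub>L\<^esub> x) \<and>
     alg_iso (scalar_ext \<iota> L) (split_alg m) \<noteq> {}"

definition XX ::
  "('f::field \<Rightarrow> 's::field) \<Rightarrow> ('f, 'a, 'm) module_scheme \<Rightarrow> ('a \<Rightarrow> 's) set" where
  "XX \<iota> L = alg_hom L (ext_field_alg \<iota>) \<inter> extensional (carrier L)"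

definition XX_act ::
  "('f::field \<Rightarrow> 's::field) \<Rightarrow> ('f, 'a, 'm) module_scheme \<Rightarrow> ('s \<Rightarrow> 's) \<Rightarrow> ('a \<Rightarrow> 's) \<Rightarrow> ('a \<Rightarrow> 's)" where
  "XX_act \<iota> L \<gamma> = (\<lambda>\<xi>\<in>XX \<iota> L. \<lambda>l\<in>carrier L. \<gamma> (\<xi> l))"

definition XX_map ::
  "('f::field, 'a, 'm) module_scheme \<Rightarrow> ('a \<Rightarrow> 'a) \<Rightarrow> ('a \<Rightarrow> 's) \<Rightarrow> ('a \<Rightarrow> 's)" where
  "XX_map L \<tau> \<xi> = compose (carrier L) \<xi> \<tau>"

definition etale_involution ::
  "('f::field \<Rightarrow> 's::field) \<Rightarrow> ('f, 'a, 'm) module_scheme \<Rightarrow> ('a \<Rightarrow> 'a) \<Rightarrow> bool" where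
  "etale_involution \<iota> L \<tau> \<longleftrightarrow>
     \<tau> \<in> alg_iso L L \<and> (\<forall>l\<in>carrier L. \<tau> (\<tau> l) = l) \<and>
     gamma_involution \<iota> (XX \<iota> L) (XX_act \<iota> L) (XX_map L \<tau>)"

section \<open>Central simple algebras with quadratic pair\<close>

definition central_simple :: "nat \<Rightarrow> ('f::field, 'a, 'm) module_scheme \<Rightarrow> bool" where
  "central_simple d A \<longleftrightarrow>
     assoc_algebra A \<and> vectorspace.fin_dim class_ring A \<and>
     \<one>\<^bsub>A\<^esub> \<noteq> \<zero>\<^bsub>A\<^esub> \<and> (\<forall>I. ideal I A \<longrightarrow> I = {\<zero>\<^bsub>A\<^esub>} \<or> I = carrier A) \<and>
     {z \<in> carrier A. \<forall>x\<in>carrier A. z \<otimes>\<^bsub>A\<^esub> x = x \<otimes>\<^bsub>A\<^esub> z} = range (\<lambda>c. c \<odot>\<^bsub>A\<^esub> \<one>\<^bsub>A\<^esub>) \<and>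
     subspace_dim A (carrier A) = d ^ 2"

definition mat_trace :: "nat \<Rightarrow> 's::field mat \<Rightarrow> 's" where
  "mat_trace d M = (\<Sum>k<d. M $$ (k, k))"

text \<open>The reduced trace of a central simple algebra of degree \<open>d\<close>, through a splitting over \<open>F\<^sub>s\<close>;
  it does not depend on the choice of the splitting. Its values, which lie in (the image of) \<open>F\<close>,
  are considered as elements of \<open>F\<^sub>s\<close>.\<close>

definition Trd ::
  "('f::field \<Rightarrow> 's::field) \<Rightarrow> nat \<Rightarrow> ('f, 'a, 'm) module_scheme \<Rightarrow> 'a \<Rightarrow> 's" where
  "Trd \<iota> d A a =
     mat_trace d ((SOME \<Phi>. \<Phi> \<in> alg_iso (scalar_ext \<iota> A) (module_mat TYPE('s) d d)) (tensor \<iota> A a 1))"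

definition Sym :: "('k::field, 'a, 'm) module_scheme \<Rightarrow> ('a \<Rightarrow> 'a) \<Rightarrow> 'a set" where
  "Sym A \<sigma> = {x \<in> carrier A. \<sigma> x = x}"

definition Skew :: "('k::field, 'a, 'm) module_scheme \<Rightarrow> ('a \<Rightarrow> 'a) \<Rightarrow> 'a set" where
  "Skew A \<sigma> = {x \<in> carrier A. \<sigma> x = \<ominus>\<^bsub>A\<^esub> x}"

definition linear_involution :: "('k::field, 'a, 'm) module_scheme \<Rightarrow> ('a \<Rightarrow> 'a) \<Rightarrow> bool" where
  "linear_involution A \<sigma> \<longleftrightarrow>
     (\<forall>x\<in>carrier A. \<sigma> x \<in> carrier A \<and> \<sigma> (\<sigma> x) = x) \<and>
     (\<forall>x\<in>carrier A. \<forall>y\<in>carrier A.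
        \<sigma> (x \<oplus>\<^bsub>A\<^esub> y) = \<sigma> x \<oplus>\<^bsub>A\<^esub> \<sigma> y \<and> \<sigma> (x \<otimes>\<^bsub>A\<^esub> y) = \<sigma> y \<otimes>\<^bsub>A\<^esub> \<sigma> x) \<and>
     (\<forall>c. \<forall>x\<in>carrier A. \<sigma> (c \<odot>\<^bsub>A\<^esub> x) = c \<odot>\<^bsub>A\<^esub> \<sigma> x)"

text \<open>Only the values of \<open>f\<close> on \<open>Sym A \<sigma>\<close> are meaningful.\<close>

definition quadratic_pair ::
  "('f::field \<Rightarrow> 's::field) \<Rightarrow> nat \<Rightarrow> ('f, 'a, 'm) module_scheme \<Rightarrow> ('a \<Rightarrow> 'a) \<Rightarrow> ('a \<Rightarrow> 'f) \<Rightarrow> bool" where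
  "quadratic_pair \<iota> n A \<sigma> f \<longleftrightarrow>
     linear_involution A \<sigma> \<and> linear_form_on A (Sym A \<sigma>) f \<and>
     subspace_dim A (Sym A \<sigma>) = n * (2 * n + 1) \<and>
     Trd \<iota> (2 * n) A ` Skew A \<sigma> = {0} \<and>
     (\<forall>x\<in>carrier A. \<iota> (f (x \<oplus>\<^bsub>A\<^esub> \<sigma> x)) = Trd \<iota> (2 * n) A x)"

text \<open>\<open>f\<^sub>s\<close> is the \<open>F\<^sub>s\<close>-linear form on \<open>Sym (A\<^sub>s, \<sigma>\<^sub>s) = Sym (A, \<sigma>) \<otimes> F\<^sub>s\<close> which extends \<open>f\<close>.\<close>

definition form_ext ::
  "('f::field \<Rightarrow> 's::field) \<Rightarrow> ('f, 'a, 'm) module_scheme \<Rightarrow> ('a \<Rightarrow> 'a) \<Rightarrow> ('a \<Rightarrow> 'f) \<Rightarrow>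
   ('a \<times> 's \<Rightarrow>\<^sub>0 int) set \<Rightarrow> 's" where
  "form_ext \<iota> A \<sigma> f =
     (THE g. g \<in> extensional (Sym (scalar_ext \<iota> A) (map_ext \<iota> A \<sigma>)) \<and>
             linear_form_on (scalar_ext \<iota> A) (Sym (scalar_ext \<iota> A) (map_ext \<iota> A \<sigma>)) g \<and>
             (\<forall>a\<in>Sym A \<sigma>. g (tensor \<iota> A a 1) = \<iota> (f a)))"

definition alg_inv_embedding ::
  "('f::field \<Rightarrow> 's::field) \<Rightarrow> nat \<Rightarrow> ('f, 'b, 'l) module_scheme \<Rightarrow> ('b \<Rightarrow> 'b) \<Rightarrow>
   ('f, 'a, 'm) module_scheme \<Rightarrow> ('a \<Rightarrow> 'a) \<Rightarrow> ('a \<Rightarrow> 'f) \<Rightarrow> ('b \<Rightarrow> 'a) \<Rightarrow> bool" where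
  "alg_inv_embedding \<iota> n L \<sigma>\<^sub>L A \<sigma> f \<epsilon> \<longleftrightarrow>
     etale \<iota> (2 * n) L \<and> etale_involution \<iota> L \<sigma>\<^sub>L \<and>
     \<epsilon> \<in> alg_hom L A \<and> inj_on \<epsilon> (carrier L) \<and>
     (\<forall>l\<in>carrier L. \<epsilon> (\<sigma>\<^sub>L l) = \<sigma> (\<epsilon> l)) \<and>
     (\<forall>x\<in>Sym A \<sigma>. \<forall>l\<in>carrier L. l \<oplus>\<^bsub>L\<^esub> \<sigma>\<^sub>L l = \<one>\<^bsub>L\<^esub> \<longrightarrow>
        \<iota> (f x) = Trd \<iota> (2 * n) A (\<epsilon> l \<otimes>\<^bsub>A\<^esub> x))"

section \<open>Severi-Brauer varieties and quadrics\<close>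

definition right_ideal :: "('k::field, 'a, 'm) module_scheme \<Rightarrow> 'a set \<Rightarrow> bool" where
  "right_ideal R I \<longleftrightarrow>
     additive_subgroup I R \<and> (\<forall>x\<in>I. \<forall>r\<in>carrier R. x \<otimes>\<^bsub>R\<^esub> r \<in> I)"

text \<open>The linear varieties of projective dimension \<open>k - 1\<close> in \<open>SB(A)\<close>, for \<open>A\<close> of degree \<open>2n\<close>
  (the empty variety for \<open>k = 0\<close>). A point lies on a linear variety when it is
  contained in it as an ideal.\<close>

definition SB_variety ::
  "('f::field \<Rightarrow> 's::field) \<Rightarrow> nat \<Rightarrow> ('f, 'a, 'm) module_scheme \<Rightarrow> nat \<Rightarrow>
   ('a \<times> 's \<Rightarrow>\<^sub>0 int) set set \<Rightarrow> bool" where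
  "SB_variety \<iota> n A k I \<longleftrightarrow>
     right_ideal (scalar_ext \<iota> A) I \<and> subspace_dim (scalar_ext \<iota> A) I = 2 * n * k"

definition SB_points ::
  "('f::field \<Rightarrow> 's::field) \<Rightarrow> nat \<Rightarrow> ('f, 'a, 'm) module_scheme \<Rightarrow>
   ('a \<times> 's \<Rightarrow>\<^sub>0 int) set set set" where
  "SB_points \<iota> n A = {I. SB_variety \<iota> n A 1 I}"

definition SB_span ::
  "('f::field \<Rightarrow> 's::field) \<Rightarrow> nat \<Rightarrow> ('f, 'a, 'm) module_scheme \<Rightarrow>
   ('a \<times> 's \<Rightarrow>\<^sub>0 int) set set set \<Rightarrow> ('a \<times> 's \<Rightarrow>\<^sub>0 int) set set" where
  "SB_span \<iota> n A P = \<Inter>{J. (\<exists>k. SB_variety \<iota> n A k J) \<and> (\<forall>I\<in>P. I \<subseteq> J)}"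

definition general_embedding ::
  "('f::field \<Rightarrow> 's::field) \<Rightarrow> nat \<Rightarrow> ('f, 'a, 'm) module_scheme \<Rightarrow>
   'y set \<Rightarrow> (('s \<Rightarrow> 's) \<Rightarrow> 'y \<Rightarrow> 'y) \<Rightarrow> ('y \<Rightarrow> ('a \<times> 's \<Rightarrow>\<^sub>0 int) set set) \<Rightarrow> bool" where
  "general_embedding \<iota> n A Y act \<epsilon> \<longleftrightarrow>
     inj_on \<epsilon> Y \<and> \<epsilon> ` Y \<subseteq> SB_points \<iota> n A \<and>
     (\<forall>\<gamma>\<in>carrier (Gal \<iota>). \<forall>y\<in>Y. \<epsilon> (act \<gamma> y) = galois_ext \<iota> A \<gamma> ` \<epsilon> y) \<and>
     (\<forall>k J. SB_variety \<iota> n A k J \<and> (\<forall>y\<in>Y. \<epsilon> y \<subseteq> J) \<longrightarrow> J = carrier (scalar_ext \<iota> A))"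

definition isotropic_ideal ::
  "('f::field \<Rightarrow> 's::field) \<Rightarrow> ('f, 'a, 'm) module_scheme \<Rightarrow> ('a \<Rightarrow> 'a) \<Rightarrow> ('a \<Rightarrow> 'f) \<Rightarrow>
   ('a \<times> 's \<Rightarrow>\<^sub>0 int) set set \<Rightarrow> bool" where
  "isotropic_ideal \<iota> A \<sigma> f I \<longleftrightarrow>
     right_ideal (scalar_ext \<iota> A) I \<and>
     (\<forall>x\<in>I. \<forall>y\<in>I. map_ext \<iota> A \<sigma> x \<otimes>\<^bsub>scalar_ext \<iota> A\<^esub> y = \<zero>\<^bsub>scalar_ext \<iota> A\<^esub>) \<and>
     form_ext \<iota> A \<sigma> f ` (I \<inter> Sym (scalar_ext \<iota> A) (map_ext \<iota> A \<sigma>)) = {0}"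

definition isotropic_subset :: "('y \<Rightarrow> 'y) \<Rightarrow> 'y set \<Rightarrow> 'y set \<Rightarrow> bool" where
  "isotropic_subset \<phi> Y Z \<longleftrightarrow> Z \<subseteq> Y \<and> (\<forall>y\<in>Y. \<not> {y, \<phi> y} \<subseteq> Z)"

text \<open>The points of the quadric \<open>Q(\<sigma>, f)\<close> are the isotropic right ideals of dimension \<open>2n\<close>, and the
  linear varieties which lie in it are the isotropic right ideals.\<close>

definition quadric_embedding ::
  "('f::field \<Rightarrow> 's::field) \<Rightarrow> nat \<Rightarrow> ('f, 'a, 'm) module_scheme \<Rightarrow> ('a \<Rightarrow> 'a) \<Rightarrow> ('a \<Rightarrow> 'f) \<Rightarrow>
   'y set \<Rightarrow> (('s \<Rightarrow> 's) \<Rightarrow> 'y \<Rightarrow> 'y) \<Rightarrow> ('y \<Rightarrow> 'y) \<Rightarrow> ('y \<Rightarrow> ('a \<times> 's \<Rightarrow>\<^sub>0 int) set set) \<Rightarrow> bool" where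
  "quadric_embedding \<iota> n A \<sigma> f Y act \<phi> \<epsilon> \<longleftrightarrow>
     general_embedding \<iota> n A Y act \<epsilon> \<and>
     (\<forall>Z. isotropic_subset \<phi> Y Z \<longrightarrow> isotropic_ideal \<iota> A \<sigma> f (SB_span \<iota> n A (\<epsilon> ` Z)))"

definition stabilizer_ext ::
  "('f::field \<Rightarrow> 's::field) \<Rightarrow> ('f, 'a, 'm) module_scheme \<Rightarrow> 'y set \<Rightarrow>
   ('y \<Rightarrow> ('a \<times> 's \<Rightarrow>\<^sub>0 int) set set) \<Rightarrow> ('a \<times> 's \<Rightarrow>\<^sub>0 int) set set" where
  "stabilizer_ext \<iota> A Y \<epsilon> =
     {x \<in> carrier (scalar_ext \<iota> A). \<forall>y\<in>Y. \<forall>z\<in>\<epsilon> y. x \<otimes>\<^bsub>scalar_ext \<iota> A\<^esub> z \<in> \<epsilon> y}"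

text \<open>\<open>L = L\<^sub>s\<^sup>\<Gamma>\<close>, considered as a subalgebra of \<open>A\<close> through the embedding \<open>a \<mapsto> a \<otimes> 1\<close> of \<open>A\<close> in \<open>A\<^sub>s\<close>.\<close>

definition stabilizer_alg ::
  "('f::field \<Rightarrow> 's::field) \<Rightarrow> ('f, 'a, 'm) module_scheme \<Rightarrow> 'y set \<Rightarrow>
   ('y \<Rightarrow> ('a \<times> 's \<Rightarrow>\<^sub>0 int) set set) \<Rightarrow> ('f, 'a, 'm) module_scheme" where
  "stabilizer_alg \<iota> A Y \<epsilon> = A\<lparr>carrier :=
     {a \<in> carrier A. tensor \<iota> A a 1 \<in>
        {x \<in> stabilizer_ext \<iota> A Y \<epsilon>. \<forall>\<gamma>\<in>carrier (Gal \<iota>). galois_ext \<iota> A \<gamma> x = x}}\<rparr>"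

text \<open>The map \<open>X(L) \<rightarrow> SB(A)\<close> induced by the inclusion of a subalgebra \<open>L\<close> in \<open>A\<close>.\<close>

definition induced_point ::
  "('f::field \<Rightarrow> 's::field) \<Rightarrow> ('f, 'a, 'm) module_scheme \<Rightarrow> ('f, 'a, 'l) module_scheme \<Rightarrow>
   ('a \<Rightarrow> 's) \<Rightarrow> ('a \<times> 's \<Rightarrow>\<^sub>0 int) set set" where
  "induced_point \<iota> A L \<xi> =
     {x \<in> carrier (scalar_ext \<iota> A). \<forall>l\<in>carrier L.
        tensor \<iota> A \<one>\<^bsub>A\<^esub> (\<xi> l) \<otimes>\<^bsub>scalar_ext \<iota> A\<^esub> x = tensor \<iota> A l 1 \<otimes>\<^bsub>scalar_ext \<iota> A\<^esub> x}"

end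

theory Submission
  imports Defs
begin

text \<open>
  The points \<open>\<epsilon>(y)\<close> are simultaneous eigenspaces of \<open>L\<close> for pairwise distinct characters, so they are
  independent, and by dimension their sum is \<open>A\<^sub>s\<close>. Hence \<open>A\<^sub>s\<close> contains orthogonal idempotents \<open>e\<^sub>y\<close> with
  sum 1 and \<open>e\<^sub>yA\<^sub>s = \<epsilon>(y)\<close>. For \<open>z \<noteq> \<phi>(y)\<close> the set \<open>{y, z}\<close> is isotropic, which gives
  \<open>\<sigma>(e\<^sub>y)e\<^sub>z = 0\<close>; therefore \<open>\<sigma>(e\<^sub>y)\<close> is the idempotent of \<open>\<phi>(y)\<close>, and \<open>\<sigma>\<close> restricts to \<open>\<sigma>\<^sub>L\<close>. The
  trace condition on \<open>f\<close> follows by decomposing a symmetric element along \<open>e + \<sigma>(e) = 1\<close>, where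
  \<open>e\<close> is the sum of the \<open>e\<^sub>y\<close> over a maximal isotropic subset of \<open>Y\<close>.

  The identification of \<open>Y\<close> with \<open>X(L)\<close> provides the characters of \<open>L\<close>, so that Galois descent is
  not used, and \<open>A\<^sub>s\<close> is split because, being simple, it acts faithfully by right multiplication
  on \<open>\<epsilon>(y)\<close>, which has dimension \<open>2n\<close>.
\<close>

section \<open>Associative algebras\<close>

text \<open>The obstacle is that \<open>A \<otimes> F\<^sub>s\<close> is a quotient of a free
  object, in which upper bounds are easy and lower bounds are not: that it is nonzero, that
  \<open>a \<mapsto> a \<otimes> 1\<close> is injective, that the symmetric elements of
  \<open>A\<^sub>s\<close> come from those of A, that f extends. All but the first rest on the
  predicate \<open>faithful\<close>: a relation whose coefficients are independent over F has only
  zero terms. It is the case of the zero ideal in the argument that proves \<open>A\<^sub>s\<close>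
  simple. Besides A being central simple, that argument needs 1 \<noteq> 0 in
  \<open>A\<^sub>s\<close>, which holds because the points have positive dimension. Likewise a basis
  of A only bounds the dimension of \<open>A\<^sub>s\<close> by 4n^2, and the 2n independent points
  of dimension 2n attain the bound.

  The reduced trace T belongs to an arbitrarily chosen splitting. It enters through linearity, T(xz)
  = T(zx) and f(x + \<sigma>(x)) = T(x); the last identity also yields T(\<sigma>(x)) = T(x). Since
  f is not determined by T in characteristic 2, the trace condition cannot be had by halving a
  symmetric element; the isotropic ideals have to supply the values of f.\<close>

locale assoc_alg = ring S for S :: "('k::field, 'a, 'm) module_scheme" (structure) +
  assumes vectorspace_class: "vectorspace class_ring S"
    and smult_mult_left: "\<And>c x y. x \<in> carrier S \<Longrightarrow> y \<in> carrier S \<Longrightarrow> (c \<odot> x) \<otimes> y = c \<odot> (x \<otimes> y)"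
    and smult_mult_right: "\<And>c x y. x \<in> carrier S \<Longrightarrow> y \<in> carrier S \<Longrightarrow> x \<otimes> (c \<odot> y) = c \<odot> (x \<otimes> y)"

lemma assoc_alg_iff: "assoc_alg S \<longleftrightarrow> assoc_algebra S"
  by (auto simp: assoc_alg_def assoc_alg_axioms_def assoc_algebra_def)

context assoc_alg
begin

interpretation V: vectorspace class_ring S
  by (rule vectorspace_class)

lemma scal_closed [simp, intro]: "x \<in> carrier S \<Longrightarrow> c \<odot> x \<in> carrier S"
  using V.smult_closed[of c x] by simp

lemma scal_l_distr: "x \<in> carrier S \<Longrightarrow> (c + d) \<odot> x = c \<odot> x \<oplus> d \<odot> x"
  using V.smult_l_distr[of c d x] by simp

lemma scal_r_distr: "x \<in> carrier S \<Longrightarrow> y \<in> carrier S \<Longrightarrow> c \<odot> (x \<oplus> y) = c \<odot> x \<oplus> c \<odot> y"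
  using V.smult_r_distr[of c x y] by simp

lemma scal_scal: "x \<in> carrier S \<Longrightarrow> c \<odot> (d \<odot> x) = (c * d) \<odot> x"
  using V.smult_assoc1[of c d x] by simp

lemma scal_1 [simp]: "x \<in> carrier S \<Longrightarrow> 1 \<odot> x = x"
  using V.smult_one[of x] by simp

lemma scal_0 [simp]: "x \<in> carrier S \<Longrightarrow> 0 \<odot> x = \<zero>"
  using V.lmult_0[of x] by simp

lemma scal_zero [simp]: "c \<odot> \<zero> = \<zero>"
  using V.rmult_0[of c] by simp

lemma scal_minus: "x \<in> carrier S \<Longrightarrow> (- c) \<odot> x = \<ominus> (c \<odot> x)"
  by (metis add.r_inv scal_closed scal_0 scal_l_distr add.inv_equality add.left_inverse zero_closed
      add.inv_closed a_comm ab_group_add_class.ab_left_minus)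

lemma finsum_scal:
  assumes "x \<in> carrier S"
  shows "finsum S (\<lambda>i. c i \<odot> x) I = (\<Sum>i\<in>I. c i) \<odot> x"
proof (induction I rule: infinite_finite_induct)
  case (insert i I)
  with assms show ?case
    by (subst finsum_insert) (auto simp: scal_l_distr)
qed (use assms in auto)

end

section \<open>The tensor product\<close>

lemma frag_extend_plus: "frag_extend (\<lambda>x. g x + h x) p = frag_extend g p + frag_extend h p"
  by (simp add: frag_extend_def frag_cmul_distrib2 sum.distrib)

lemma frag_extend_zero_fun [simp]: "frag_extend (\<lambda>x. 0) p = 0"
  by (simp add: frag_extend_def)

lemma pair_ring_simps:
  "carrier (pair_ring A) = {p. Poly_Mapping.keys p \<subseteq> carrier A \<times> UNIV}"
  "zero (pair_ring A) = 0" "add (pair_ring A) = (+)" "one (pair_ring A) = frag_of (\<one>\<^bsub>A\<^esub>, 1)"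
  by (auto simp: pair_ring_def)

lemma pair_mult_of: "frag_of (a, c) \<otimes>\<^bsub>pair_ring A\<^esub> frag_of (b, d) = frag_of (a \<otimes>\<^bsub>A\<^esub> b, c * d)"
  by (simp add: pair_ring_def)

lemma pair_mult_0: "0 \<otimes>\<^bsub>pair_ring A\<^esub> q = 0" "p \<otimes>\<^bsub>pair_ring A\<^esub> 0 = 0"
  by (simp_all add: pair_ring_def case_prod_unfold)

lemma pair_mult_add:
  "(p + p') \<otimes>\<^bsub>pair_ring A\<^esub> q = p \<otimes>\<^bsub>pair_ring A\<^esub> q + p' \<otimes>\<^bsub>pair_ring A\<^esub> q"
  "p \<otimes>\<^bsub>pair_ring A\<^esub> (q + q') = p \<otimes>\<^bsub>pair_ring A\<^esub> q + p \<otimes>\<^bsub>pair_ring A\<^esub> q'"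
  by (simp_all add: pair_ring_def frag_extend_add case_prod_unfold frag_extend_plus)

lemma pair_mult_diff:
  "(p - p') \<otimes>\<^bsub>pair_ring A\<^esub> q = p \<otimes>\<^bsub>pair_ring A\<^esub> q - p' \<otimes>\<^bsub>pair_ring A\<^esub> q"
  "p \<otimes>\<^bsub>pair_ring A\<^esub> (q - q') = p \<otimes>\<^bsub>pair_ring A\<^esub> q - p \<otimes>\<^bsub>pair_ring A\<^esub> q'"
  using pair_mult_add(1)[where p = "p - p'" and p' = p'] pair_mult_add(2)[where q = "q - q'" and q' = q']
  by (metis add_diff_cancel diff_add_cancel)+

text \<open>The pairs generate the free abelian group on \<open>A \<times> F\<^sub>s\<close> under
  differences, so additive statements reduce to pairs. Membership in the carrier is carried along
  because the ring axioms of A hold only there.\<close>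

lemma pair_induct [consumes 1, case_names zero of diff]:
  assumes "p \<in> carrier (pair_ring A)" and "P 0"
    and "\<And>a c. a \<in> carrier A \<Longrightarrow> P (frag_of (a, c))"
    and "\<And>p q. p \<in> carrier (pair_ring A) \<Longrightarrow> q \<in> carrier (pair_ring A) \<Longrightarrow> P p \<Longrightarrow> P q \<Longrightarrow> P (p - q)"
  shows "P p"
proof -
  have "Poly_Mapping.keys p \<subseteq> carrier A \<times> UNIV" using assms(1) by (simp add: pair_ring_simps)
  then have "P p \<and> p \<in> carrier (pair_ring A)"
  proof (induction p rule: frag_induction)
    case (diff p q)
    then show ?case using assms(4)[of p q] keys_diff[of p q] by (auto simp: pair_ring_simps)
  qed (use assms in \<open>auto simp: pair_ring_simps\<close>)
  then show ?thesis ..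
qed

lemma pair_of_closed: "a \<in> carrier A \<Longrightarrow> frag_of (a, c) \<in> carrier (pair_ring A)"
  by (simp add: pair_ring_simps)

lemma pair_zero_closed: "0 \<in> carrier (pair_ring A)"
  by (simp add: pair_ring_simps)

lemma pair_add_closed:
  "p \<in> carrier (pair_ring A) \<Longrightarrow> q \<in> carrier (pair_ring A) \<Longrightarrow> p + q \<in> carrier (pair_ring A)"
  using Poly_Mapping.keys_add[of p q] by (auto simp: pair_ring_simps)

lemma pair_diff_closed:
  "p \<in> carrier (pair_ring A) \<Longrightarrow> q \<in> carrier (pair_ring A) \<Longrightarrow> p - q \<in> carrier (pair_ring A)"
  using keys_diff[of p q] by (auto simp: pair_ring_simps)

locale field_extension_alg = field_hom \<iota> + A: assoc_alg A
  for \<iota> :: "'f::field \<Rightarrow> 's::field" and A :: "('f, 'a, 'm) module_scheme" (structure)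
begin

abbreviation P where "P \<equiv> (pair_ring A :: ('a \<times> 's \<Rightarrow>\<^sub>0 int) ring)"

lemma pair_mult_closed:
  "p \<in> carrier P \<Longrightarrow> q \<in> carrier P \<Longrightarrow> p \<otimes>\<^bsub>P\<^esub> q \<in> carrier P"
proof (induction p rule: pair_induct)
  case (of a c)
  from of(2) show ?case
    using of(1) by (induction q rule: pair_induct)
      (auto simp: pair_mult_0 pair_mult_diff pair_mult_of pair_diff_closed pair_of_closed pair_zero_closed)
qed (auto simp: pair_mult_0 pair_mult_diff pair_diff_closed pair_zero_closed)

lemma pair_mult_assoc:
  assumes "p \<in> carrier P" "q \<in> carrier P" "r \<in> carrier P"
  shows "(p \<otimes>\<^bsub>P\<^esub> q) \<otimes>\<^bsub>P\<^esub> r = p \<otimes>\<^bsub>P\<^esub> (q \<otimes>\<^bsub>P\<^esub> r)"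
  using assms(1)
proof (induction p rule: pair_induct)
  case (of a c)
  show ?case using assms(2)
  proof (induction q rule: pair_induct)
    case (of b d)
    show ?case using assms(3)
      by (induction r rule: pair_induct)
        (use of \<open>a \<in> carrier A\<close> in \<open>auto simp: pair_mult_0 pair_mult_diff pair_mult_of A.m_assoc mult.assoc\<close>)
  qed (auto simp: pair_mult_0 pair_mult_diff)
qed (auto simp: pair_mult_0 pair_mult_diff)

lemma pair_one:
  assumes "p \<in> carrier P"
  shows "\<one>\<^bsub>P\<^esub> \<otimes>\<^bsub>P\<^esub> p = p" "p \<otimes>\<^bsub>P\<^esub> \<one>\<^bsub>P\<^esub> = p"
  using assms
  by (induction p rule: pair_induct) (auto simp: pair_mult_0 pair_mult_diff pair_mult_of pair_ring_simps)

sublocale P: ring P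
proof (rule ringI)
  show "abelian_group P"
  proof (rule abelian_groupI)
    fix x assume "x \<in> carrier P"
    then show "\<exists>y\<in>carrier P. y \<oplus>\<^bsub>P\<^esub> x = \<zero>\<^bsub>P\<^esub>"
      by (intro bexI[of _ "- x"]) (auto simp: pair_ring_simps)
  qed (auto simp: pair_ring_simps(2-4) add_ac pair_add_closed, auto simp: pair_ring_simps)
  show "monoid P"
    by (rule monoidI)
      (auto simp: pair_mult_closed pair_mult_assoc pair_one, auto simp: pair_ring_simps)
qed (auto simp: pair_ring_simps(3) pair_mult_add)

lemma P_minus: "p \<in> carrier P \<Longrightarrow> \<ominus>\<^bsub>P\<^esub> p = - p"
  by (rule P.minus_equality) (auto simp: pair_ring_simps)

lemma P_diff: "p \<in> carrier P \<Longrightarrow> q \<in> carrier P \<Longrightarrow> p \<ominus>\<^bsub>P\<^esub> q = p - q"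
  by (simp add: a_minus_def P_minus pair_ring_simps)

section \<open>The quotient by the bilinearity relations\<close>

abbreviation T where "T \<equiv> tensor_ideal \<iota> A"
abbreviation AS where "AS \<equiv> scalar_ext \<iota> A"
abbreviation cls where "cls p \<equiv> T +>\<^bsub>P\<^esub> p"

lemma relations_closed: "tensor_relations \<iota> A \<subseteq> carrier P"
  by (auto simp: tensor_relations_def intro!: pair_diff_closed pair_of_closed)

sublocale T: ideal T P
  unfolding tensor_ideal_def by (rule P.genideal_ideal[OF relations_closed])

lemma relations_T: "tensor_relations \<iota> A \<subseteq> T"
  unfolding tensor_ideal_def by (rule P.genideal_self[OF relations_closed])

lemma T_minimal: "ideal J P \<Longrightarrow> tensor_relations \<iota> A \<subseteq> J \<Longrightarrow> T \<subseteq> J"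
  unfolding tensor_ideal_def by (rule P.genideal_minimal)

lemma AS_simps:
  "carrier AS = carrier (P Quot T)" "mult AS = mult (P Quot T)" "one AS = one (P Quot T)"
  "zero AS = zero (P Quot T)" "add AS = add (P Quot T)"
  by (simp_all add: scalar_ext_def Let_def)

text \<open>\<open>AS\<close> is not the quotient ring itself but a module record with the same ring
  fields, so the axioms are carried over one by one.\<close>

lemma AS_ring: "ring AS"
proof -
  interpret Q: ring "P Quot T" by (rule T.quotient_is_ring)
  have "abelian_group AS"
    by (rule abelian_groupI; unfold AS_simps)
      (simp_all add: Q.a_assoc Q.a_comm Q.add.m_lcomm Q.add.l_inv_ex)
  moreover have "monoid AS"
    by (rule monoidI; unfold AS_simps) (simp_all add: Q.m_assoc)
  ultimately show ?thesis
    by (rule ringI; unfold AS_simps) (simp_all add: Q.l_distr Q.r_distr)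
qed

lemma cls_closed [simp]: "p \<in> carrier P \<Longrightarrow> cls p \<in> carrier AS"
  by (simp add: AS_simps FactRing_simps a_r_coset_def) blast

lemma carrier_AS: "carrier AS = cls ` carrier P"
  by (auto simp: AS_simps FactRing_def A_RCOSETS_def RCOSETS_def a_r_coset_def)

lemma cls_mult: "p \<in> carrier P \<Longrightarrow> q \<in> carrier P \<Longrightarrow> cls p \<otimes>\<^bsub>AS\<^esub> cls q = cls (p \<otimes>\<^bsub>P\<^esub> q)"
  using ring_hom_mult[OF T.rcos_ring_hom] by (simp add: AS_simps)

lemma cls_add: "p \<in> carrier P \<Longrightarrow> q \<in> carrier P \<Longrightarrow> cls p \<oplus>\<^bsub>AS\<^esub> cls q = cls (p + q)"
  using ring_hom_add[OF T.rcos_ring_hom] by (simp add: AS_simps pair_ring_simps)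

lemma cls_one: "cls (frag_of (\<one>, 1)) = \<one>\<^bsub>AS\<^esub>"
  using ring_hom_one[OF T.rcos_ring_hom] by (simp add: AS_simps pair_ring_simps)

lemma cls_eq_iff: "p \<in> carrier P \<Longrightarrow> q \<in> carrier P \<Longrightarrow> cls p = cls q \<longleftrightarrow> p - q \<in> T"
  by (metis P.quotient_eq_iff_same_a_r_cos P_diff T.ideal_axioms)

lemma cls_0: "cls 0 = \<zero>\<^bsub>AS\<^esub>"
  using P.add.r_inv
  by (metis AS_simps(4) FactRing_simps(1) T.a_rcos_const T.zero_closed pair_ring_simps(2) ring.simps(1) monoid.simps(2))

lemma tensor_cls: "tensor \<iota> A a c = cls (frag_of (a, c))"
  by (simp add: tensor_def)

lemma tensor_closed [simp]: "a \<in> carrier A \<Longrightarrow> tensor \<iota> A a c \<in> carrier AS"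
  by (simp add: tensor_cls pair_of_closed)

lemma tensor_add_left:
  assumes "a \<in> carrier A" "b \<in> carrier A"
  shows "tensor \<iota> A (a \<oplus> b) c = tensor \<iota> A a c \<oplus>\<^bsub>AS\<^esub> tensor \<iota> A b c"
proof -
  have "frag_of (a \<oplus> b, c) - frag_of (a, c) - frag_of (b, c) \<in> T"
    by (rule subsetD[OF relations_T], unfold tensor_relations_def) (use assms in blast)
  then show ?thesis
    using assms by (simp add: tensor_cls cls_add cls_eq_iff pair_of_closed pair_add_closed diff_diff_eq)
qed

lemma tensor_add_right:
  assumes "a \<in> carrier A"
  shows "tensor \<iota> A a (c + d) = tensor \<iota> A a c \<oplus>\<^bsub>AS\<^esub> tensor \<iota> A a d"
proof -
  have "frag_of (a, c + d) - frag_of (a, c) - frag_of (a, d) \<in> T"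
    by (rule subsetD[OF relations_T], unfold tensor_relations_def) (use assms in blast)
  then show ?thesis
    using assms by (simp add: tensor_cls cls_add cls_eq_iff pair_of_closed pair_add_closed diff_diff_eq)
qed

lemma tensor_smult:
  assumes "a \<in> carrier A"
  shows "tensor \<iota> A (l \<odot> a) c = tensor \<iota> A a (\<iota> l * c)"
proof -
  have "frag_of (l \<odot> a, c) - frag_of (a, \<iota> l * c) \<in> T"
    by (rule subsetD[OF relations_T], unfold tensor_relations_def) (use assms in blast)
  then show ?thesis
    using assms by (simp add: tensor_cls cls_eq_iff pair_of_closed)
qed

lemma tensor_mult:
  "a \<in> carrier A \<Longrightarrow> b \<in> carrier A \<Longrightarrow>
    tensor \<iota> A a c \<otimes>\<^bsub>AS\<^esub> tensor \<iota> A b d = tensor \<iota> A (a \<otimes> b) (c * d)"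
  by (simp add: tensor_cls cls_mult pair_of_closed pair_mult_of)

lemma AS_smult: "smult AS c X = tensor \<iota> A \<one> c \<otimes>\<^bsub>AS\<^esub> X"
  by (simp add: scalar_ext_def Let_def)

lemma AS_smult_tensor: "a \<in> carrier A \<Longrightarrow> smult AS c (tensor \<iota> A a d) = tensor \<iota> A a (c * d)"
  by (simp add: AS_smult tensor_mult)

lemma AS_induct [consumes 1, case_names zero tensor diff]:
  assumes "X \<in> carrier AS" and zero: "Q \<zero>\<^bsub>AS\<^esub>"
    and tensor: "\<And>a c. a \<in> carrier A \<Longrightarrow> Q (tensor \<iota> A a c)"
    and diff: "\<And>X Y. X \<in> carrier AS \<Longrightarrow> Y \<in> carrier AS \<Longrightarrow> Q X \<Longrightarrow> Q Y \<Longrightarrow> Q (X \<ominus>\<^bsub>AS\<^esub> Y)"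
  shows "Q X"
proof -
  interpret AS: ring AS by (rule AS_ring)
  obtain p where p: "p \<in> carrier P" "X = cls p"
    using assms(1) by (auto simp: carrier_AS)
  from p(1) have "Q (cls p)"
  proof (induction p rule: pair_induct)
    case (diff p q)
    have "cls (p - q) \<oplus>\<^bsub>AS\<^esub> cls q = cls p"
      using diff by (simp add: cls_add pair_diff_closed)
    then have "cls (p - q) = cls p \<ominus>\<^bsub>AS\<^esub> cls q"
      using diff by (metis AS.add.inv_solve_right' AS.minus_eq cls_closed pair_diff_closed)
    with diff assms(4) show ?case by simp
  qed (use zero tensor in \<open>auto simp: cls_0 tensor_cls\<close>)
  with p show ?thesis by simp
qed

text \<open>Scalar multiplication is left multiplication by \<open>1 \<otimes> c\<close>. Only the
  centrality of these elements lets a scalar pass through the left factor of a product.\<close>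

lemma AS_central:
  assumes "X \<in> carrier AS"
  shows "X \<otimes>\<^bsub>AS\<^esub> tensor \<iota> A \<one> c = tensor \<iota> A \<one> c \<otimes>\<^bsub>AS\<^esub> X"
proof -
  interpret AS: ring AS by (rule AS_ring)
  from assms show ?thesis
    by (induction X rule: AS_induct)
      (auto simp: tensor_mult mult.commute AS.minus_eq AS.l_distr AS.r_distr AS.r_minus AS.l_minus)
qed

lemma AS_assoc_alg: "assoc_alg AS"
proof -
  interpret AS: ring AS by (rule AS_ring)
  have one: "tensor \<iota> A \<one> 1 = \<one>\<^bsub>AS\<^esub>" by (simp add: tensor_cls cls_one)
  have "module class_ring AS"
  proof (rule moduleI)
    show "cring (class_ring :: 's ring)" by (rule class_cring.cring_axioms)
  qed (auto simp: AS_smult tensor_add_right AS.l_distr AS.r_distr one class_ring_simps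
        AS.m_assoc[symmetric] tensor_mult AS.abelian_group_axioms)
  then have "vectorspace class_ring AS"
    by (simp add: vectorspace_def class_field)
  then show ?thesis
  proof (rule assoc_alg.intro[OF AS_ring assoc_alg_axioms.intro])
    fix c X Y assume X: "X \<in> carrier AS" and Y: "Y \<in> carrier AS"
    show "(c \<odot>\<^bsub>AS\<^esub> X) \<otimes>\<^bsub>AS\<^esub> Y = c \<odot>\<^bsub>AS\<^esub> (X \<otimes>\<^bsub>AS\<^esub> Y)"
      using X Y by (simp add: AS_smult AS.m_assoc)
    have "X \<otimes>\<^bsub>AS\<^esub> (tensor \<iota> A \<one> c \<otimes>\<^bsub>AS\<^esub> Y) = (X \<otimes>\<^bsub>AS\<^esub> tensor \<iota> A \<one> c) \<otimes>\<^bsub>AS\<^esub> Y"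
      using X Y by (simp add: AS.m_assoc)
    then show "X \<otimes>\<^bsub>AS\<^esub> (c \<odot>\<^bsub>AS\<^esub> Y) = c \<odot>\<^bsub>AS\<^esub> (X \<otimes>\<^bsub>AS\<^esub> Y)"
      using X Y by (simp add: AS_smult AS.m_assoc AS_central)
  qed
qed

lemma tensor_one_one: "tensor \<iota> A \<one> 1 = \<one>\<^bsub>AS\<^esub>"
  by (simp add: tensor_cls cls_one)

lemma T_closed: "p \<in> T \<Longrightarrow> p \<in> carrier P"
  by (rule T.Icarr)

lemma T_diff: "p \<in> T \<Longrightarrow> q \<in> T \<Longrightarrow> p - q \<in> T"
  by (metis P_diff T.a_inv_closed T.a_closed T_closed a_minus_def)

lemma T_zero: "0 \<in> T"
  using T.zero_closed by (simp add: pair_ring_simps)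

text \<open>\<open>T\<close> is a generated ideal, so a property of all its elements is obtained
  from an ideal that contains the relations. Closure under differences stands in for the subgroup
  conditions.\<close>

lemma pair_ring_idealI:
  assumes "J \<subseteq> carrier P" "0 \<in> J" "\<And>p q. p \<in> J \<Longrightarrow> q \<in> J \<Longrightarrow> p - q \<in> J"
    and "\<And>p q. p \<in> J \<Longrightarrow> q \<in> carrier P \<Longrightarrow> q \<otimes>\<^bsub>P\<^esub> p \<in> J"
    and "\<And>p q. p \<in> J \<Longrightarrow> q \<in> carrier P \<Longrightarrow> p \<otimes>\<^bsub>P\<^esub> q \<in> J"
  shows "ideal J P"
proof (rule idealI)
  have neg: "- p \<in> J" if "p \<in> J" for p using assms(3)[OF assms(2) that] by simp
  show "subgroup J (add_monoid P)"
  proof (rule P.add.subgroupI)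
    show "J \<subseteq> carrier P" "J \<noteq> {}" using assms(1,2) by blast+
    fix p assume p: "p \<in> J"
    then show "\<ominus>\<^bsub>P\<^esub> p \<in> J" using assms(1) neg by (simp add: P_minus subset_iff)
    fix q assume "q \<in> J"
    then show "p \<oplus>\<^bsub>P\<^esub> q \<in> J" using assms(3)[OF p neg, of q] by (simp add: pair_ring_simps(3))
  qed
  show "ring P" by (rule P.ring_axioms)
  show "x \<otimes>\<^bsub>P\<^esub> a \<in> J" "a \<otimes>\<^bsub>P\<^esub> x \<in> J" if "a \<in> J" "x \<in> carrier P" for a x
    using assms(4,5) that by blast+
qed

section \<open>Maps induced on the tensor product by a map of the algebra and a map of the
  scalars\<close>

context
  fixes g :: "'a \<Rightarrow> 'a" and h :: "'s \<Rightarrow> 's"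
  assumes g_closed: "\<And>a. a \<in> carrier A \<Longrightarrow> g a \<in> carrier A"
    and g_add: "\<And>a b. a \<in> carrier A \<Longrightarrow> b \<in> carrier A \<Longrightarrow> g (a \<oplus> b) = g a \<oplus> g b"
    and g_smult: "\<And>l a. a \<in> carrier A \<Longrightarrow> g (l \<odot> a) = l \<odot> g a"
    and g_mult: "(\<forall>a\<in>carrier A. \<forall>b\<in>carrier A. g (a \<otimes> b) = g a \<otimes> g b) \<or>
      (\<forall>a\<in>carrier A. \<forall>b\<in>carrier A. g (a \<otimes> b) = g b \<otimes> g a)"
    and h_add: "\<And>c d. h (c + d) = h c + h d"
    and h_mult: "\<And>c d. h (c * d) = h c * h d"
    and h_base: "\<And>l. h (\<iota> l) = \<iota> l"
begin

abbreviation F where "F \<equiv> frag_extend (\<lambda>(a, c). frag_of (g a, h c))"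

lemma F_closed: "p \<in> carrier P \<Longrightarrow> F p \<in> carrier P"
  by (induction p rule: pair_induct)
    (auto simp: pair_zero_closed frag_extend_diff pair_diff_closed pair_of_closed g_closed)

text \<open>The multiplicative case serves the Galois action, the antimultiplicative one the
  involution. Commutativity of the scalars is what makes the second case work.\<close>

lemma F_mult:
  "(\<forall>p\<in>carrier P. \<forall>q\<in>carrier P. F (p \<otimes>\<^bsub>P\<^esub> q) = F p \<otimes>\<^bsub>P\<^esub> F q) \<or>
   (\<forall>p\<in>carrier P. \<forall>q\<in>carrier P. F (p \<otimes>\<^bsub>P\<^esub> q) = F q \<otimes>\<^bsub>P\<^esub> F p)"
  using g_mult
proof (rule disj_forward; intro ballI)
  fix p q assume *: "\<forall>a\<in>carrier A. \<forall>b\<in>carrier A. g (a \<otimes> b) = g a \<otimes> g b"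
    and p: "p \<in> carrier P" and q: "q \<in> carrier P"
  from p show "F (p \<otimes>\<^bsub>P\<^esub> q) = F p \<otimes>\<^bsub>P\<^esub> F q"
  proof (induction p rule: pair_induct)
    case (of a c)
    from q show ?case
      by (induction q rule: pair_induct)
        (use of * in \<open>auto simp: pair_mult_0 pair_mult_diff frag_extend_diff pair_mult_of h_mult\<close>)
  qed (auto simp: pair_mult_0 pair_mult_diff frag_extend_diff)
next
  fix p q assume *: "\<forall>a\<in>carrier A. \<forall>b\<in>carrier A. g (a \<otimes> b) = g b \<otimes> g a"
    and p: "p \<in> carrier P" and q: "q \<in> carrier P"
  from p show "F (p \<otimes>\<^bsub>P\<^esub> q) = F q \<otimes>\<^bsub>P\<^esub> F p"
  proof (induction p rule: pair_induct)
    case (of a c)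
    from q show ?case
      by (induction q rule: pair_induct)
        (use of * in \<open>auto simp: pair_mult_0 pair_mult_diff frag_extend_diff pair_mult_of h_mult mult.commute\<close>)
  qed (auto simp: pair_mult_0 pair_mult_diff frag_extend_diff)
qed

text \<open>The preimage of \<open>T\<close> under \<open>F\<close> is a two-sided ideal, whether
  \<open>F\<close> preserves or reverses products, and \<open>F\<close> sends each relation to a
  relation of the same kind. Minimality of \<open>T\<close> finishes the argument.\<close>

lemma F_T:
  assumes "p \<in> T"
  shows "F p \<in> T"
proof -
  let ?J = "{p \<in> carrier P. F p \<in> T}"
  have "ideal ?J P"
  proof (rule pair_ring_idealI)
    fix p q assume pq: "p \<in> ?J" "q \<in> carrier P"
    then have "F p \<otimes>\<^bsub>P\<^esub> F q \<in> T" "F q \<otimes>\<^bsub>P\<^esub> F p \<in> T"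
      using T.I_l_closed T.I_r_closed F_closed by auto
    then show "q \<otimes>\<^bsub>P\<^esub> p \<in> ?J" "p \<otimes>\<^bsub>P\<^esub> q \<in> ?J"
      using F_mult pq pair_mult_closed by (metis (mono_tags, lifting) mem_Collect_eq)+
  qed (auto simp: T_zero pair_zero_closed T_diff frag_extend_diff pair_diff_closed)
  moreover have "r \<in> ?J" if r: "r \<in> tensor_relations \<iota> A" for r
  proof -
    have "F r \<in> tensor_relations \<iota> A"
    proof -
      consider (left) a b c where "r = frag_of (a \<oplus> b, c) - frag_of (a, c) - frag_of (b, c)"
          "a \<in> carrier A" "b \<in> carrier A"
        | (right) a c d where "r = frag_of (a, c + d) - frag_of (a, c) - frag_of (a, d)" "a \<in> carrier A"
        | (scalar) l a c where "r = frag_of (l \<odot> a, c) - frag_of (a, \<iota> l * c)" "a \<in> carrier A"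
        using r unfolding tensor_relations_def by blast
      then show ?thesis
      proof cases
        case left
        then have "F r = frag_of (g a \<oplus> g b, h c) - frag_of (g a, h c) - frag_of (g b, h c)"
          by (simp add: frag_extend_diff g_add)
        with left g_closed show ?thesis unfolding tensor_relations_def by blast
      next
        case right
        then have "F r = frag_of (g a, h c + h d) - frag_of (g a, h c) - frag_of (g a, h d)"
          by (simp add: frag_extend_diff h_add)
        with right g_closed show ?thesis unfolding tensor_relations_def by blast
      next
        case scalar
        then have "F r = frag_of (l \<odot> g a, h c) - frag_of (g a, \<iota> l * h c)"
          by (simp add: frag_extend_diff g_smult h_mult h_base)
        with scalar g_closed show ?thesis unfolding tensor_relations_def by blast
      qed
    qed
    with relations_T relations_closed r show ?thesis by auto
  qed
  ultimately have "T \<subseteq> ?J" by (intro T_minimal) auto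
  with assms show ?thesis by auto
qed

text \<open>\<open>tensor_map\<close> takes the only element of the image of a coset; that this
  image is a singleton is the stability of \<open>T\<close> under \<open>F\<close>.\<close>

lemma tensor_map_cls:
  assumes p: "p \<in> carrier P"
  shows "tensor_map \<iota> A g h (cls p) = cls (F p)"
proof -
  have same: "cls (F q) = cls (F p)" if "q \<in> cls p" for q
  proof -
    from that obtain t where t: "t \<in> T" "q = t + p"
      by (auto simp: a_r_coset_def' pair_ring_simps)
    then show ?thesis
      using p F_T[of t] by (subst cls_eq_iff) (auto simp: F_closed T_closed pair_add_closed frag_extend_add)
  qed
  have "cls p \<noteq> {}" using T.a_rcos_self[OF p] by blast
  then show ?thesis
    unfolding tensor_map_def by (rule the_elem_image_unique) (rule same)
qed

lemma AS_cases:
  assumes "X \<in> carrier AS"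
  obtains p where "p \<in> carrier P" "X = cls p"
  using assms unfolding carrier_AS by (rule imageE)

lemma tensor_map_closed:
  assumes "X \<in> carrier AS"
  shows "tensor_map \<iota> A g h X \<in> carrier AS"
  using assms
proof (rule AS_cases)
  fix p assume p: "p \<in> carrier P" "X = cls p"
  show ?thesis unfolding p(2) tensor_map_cls[OF p(1)] by (rule cls_closed[OF F_closed[OF p(1)]])
qed

lemma tensor_map_tensor:
  assumes "a \<in> carrier A"
  shows "tensor_map \<iota> A g h (tensor \<iota> A a c) = tensor \<iota> A (g a) (h c)"
  unfolding tensor_cls tensor_map_cls[OF pair_of_closed[OF assms]] by simp

lemma tensor_map_add:
  assumes "X \<in> carrier AS" "Y \<in> carrier AS"
  shows "tensor_map \<iota> A g h (X \<oplus>\<^bsub>AS\<^esub> Y) = tensor_map \<iota> A g h X \<oplus>\<^bsub>AS\<^esub> tensor_map \<iota> A g h Y"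
  using assms(1)
proof (rule AS_cases)
  fix p assume p: "p \<in> carrier P" "X = cls p"
  obtain q where q: "q \<in> carrier P" "Y = cls q" using assms(2) by (rule AS_cases)
  note F_closed[OF p(1)] F_closed[OF q(1)] pair_add_closed[OF p(1) q(1)]
  then show ?thesis
    unfolding p(2) q(2) cls_add[OF p(1) q(1)]
    by (simp only: tensor_map_cls p(1) q(1) cls_add frag_extend_add)
qed

end

end

section \<open>Base change\<close>

text \<open>Used for A inside \<open>A \<otimes> F\<^sub>s\<close> and again for L inside
  \<open>L \<otimes> F\<^sub>s\<close>. That the target is a tensor product is expressed separately:
  \<open>lin\<close> of the source is everything (generation) and the source is
  \<open>faithful\<close> (injectivity).\<close>

locale base_change = field_hom \<iota> + A: assoc_alg A + S: assoc_alg S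
  for \<iota> :: "'f::field \<Rightarrow> 's::field"
    and A :: "('f, 'a, 'm) module_scheme"
    and S :: "('s, 'b, 'l) module_scheme" +
  fixes \<tau> :: "'a \<Rightarrow> 'b"
  assumes \<tau>_closed [simp, intro]: "a \<in> carrier A \<Longrightarrow> \<tau> a \<in> carrier S"
    and \<tau>_add: "a \<in> carrier A \<Longrightarrow> b \<in> carrier A \<Longrightarrow> \<tau> (a \<oplus>\<^bsub>A\<^esub> b) = \<tau> a \<oplus>\<^bsub>S\<^esub> \<tau> b"
    and \<tau>_mult: "a \<in> carrier A \<Longrightarrow> b \<in> carrier A \<Longrightarrow> \<tau> (a \<otimes>\<^bsub>A\<^esub> b) = \<tau> a \<otimes>\<^bsub>S\<^esub> \<tau> b"
    and \<tau>_one [simp]: "\<tau> \<one>\<^bsub>A\<^esub> = \<one>\<^bsub>S\<^esub>"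
    and \<tau>_smult: "a \<in> carrier A \<Longrightarrow> \<tau> (l \<odot>\<^bsub>A\<^esub> a) = \<iota> l \<odot>\<^bsub>S\<^esub> \<tau> a"
begin

definition comb :: "'i set \<Rightarrow> ('i \<Rightarrow> 'a) \<Rightarrow> ('i \<Rightarrow> 's) \<Rightarrow> 'b" where
  "comb I a c = finsum S (\<lambda>i. c i \<odot>\<^bsub>S\<^esub> \<tau> (a i)) I"

definition indep :: "'i set \<Rightarrow> ('i \<Rightarrow> 's) \<Rightarrow> bool" where
  "indep I c \<longleftrightarrow> (\<forall>l. (\<Sum>i\<in>I. \<iota> (l i) * c i) = 0 \<longrightarrow> (\<forall>i\<in>I. l i = 0))"

definition subsp :: "'a set \<Rightarrow> bool" where
  "subsp V \<longleftrightarrow> V \<subseteq> carrier A \<and> \<zero>\<^bsub>A\<^esub> \<in> V \<and> (\<forall>x\<in>V. \<forall>y\<in>V. x \<oplus>\<^bsub>A\<^esub> y \<in> V) \<and> (\<forall>c. \<forall>x\<in>V. c \<odot>\<^bsub>A\<^esub> x \<in> V)"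

definition semilin :: "'a set \<Rightarrow> ('a \<Rightarrow> 's) \<Rightarrow> bool" where
  "semilin V g \<longleftrightarrow> (\<forall>x\<in>V. \<forall>y\<in>V. g (x \<oplus>\<^bsub>A\<^esub> y) = g x + g y) \<and> (\<forall>c. \<forall>x\<in>V. g (c \<odot>\<^bsub>A\<^esub> x) = \<iota> c * g x)"

text \<open>Injectivity of the natural map from \<open>V \<otimes> F\<^sub>s\<close> to S, phrased
  without a tensor product or a basis. The index sets consist of natural numbers because a
  definition cannot quantify over index types.\<close>

definition faithful :: "'a set \<Rightarrow> bool" where
  "faithful V \<longleftrightarrow> (\<forall>(I::nat set) a c. finite I \<longrightarrow> a \<in> I \<rightarrow> V \<longrightarrow> indep I c \<longrightarrow> comb I a c = \<zero>\<^bsub>S\<^esub> \<longrightarrow>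
     (\<forall>i\<in>I. a i = \<zero>\<^bsub>A\<^esub>))"

lemma semilin_0: "semilin V (\<lambda>_. 0)"
  by (simp add: semilin_def)

lemma \<tau>_zero [simp]: "\<tau> \<zero>\<^bsub>A\<^esub> = \<zero>\<^bsub>S\<^esub>"
  using \<tau>_smult[of "\<zero>\<^bsub>A\<^esub>" 0] by simp

lemma \<tau>_minus: "a \<in> carrier A \<Longrightarrow> \<tau> (\<ominus>\<^bsub>A\<^esub> a) = \<ominus>\<^bsub>S\<^esub> \<tau> a"
  using \<tau>_smult[of a "-1"] by (simp add: A.scal_minus S.scal_minus hom_distribs)

lemma comb_closed [simp]: "a \<in> I \<rightarrow> carrier A \<Longrightarrow> comb I a c \<in> carrier S"
  unfolding comb_def by (rule S.finsum_closed) auto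

lemma comb_empty [simp]: "comb {} a c = \<zero>\<^bsub>S\<^esub>"
  by (simp add: comb_def)

lemma comb_insert:
  "finite I \<Longrightarrow> i \<notin> I \<Longrightarrow> a \<in> insert i I \<rightarrow> carrier A \<Longrightarrow>
    comb (insert i I) a c = c i \<odot>\<^bsub>S\<^esub> \<tau> (a i) \<oplus>\<^bsub>S\<^esub> comb I a c"
  unfolding comb_def by (subst S.finsum_insert) auto

lemma comb_cong:
  "(\<And>i. i \<in> I \<Longrightarrow> a i = a' i) \<Longrightarrow> (\<And>i. i \<in> I \<Longrightarrow> c i = c' i) \<Longrightarrow> a' \<in> I \<rightarrow> carrier A \<Longrightarrow>
    comb I a c = comb I a' c'"
  unfolding comb_def by (rule S.finsum_cong') (auto simp: Pi_iff)

lemma comb_add: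
  assumes "a \<in> I \<rightarrow> carrier A" "b \<in> I \<rightarrow> carrier A"
  shows "comb I (\<lambda>i. a i \<oplus>\<^bsub>A\<^esub> b i) c = comb I a c \<oplus>\<^bsub>S\<^esub> comb I b c"
proof -
  have "comb I (\<lambda>i. a i \<oplus>\<^bsub>A\<^esub> b i) c =
      finsum S (\<lambda>i. c i \<odot>\<^bsub>S\<^esub> \<tau> (a i) \<oplus>\<^bsub>S\<^esub> c i \<odot>\<^bsub>S\<^esub> \<tau> (b i)) I"
    unfolding comb_def
    by (rule S.finsum_cong') (use assms in \<open>auto simp: \<tau>_add S.scal_r_distr Pi_iff\<close>)
  also have "\<dots> = comb I a c \<oplus>\<^bsub>S\<^esub> comb I b c"
    unfolding comb_def by (rule S.finsum_addf) (use assms in auto)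
  finally show ?thesis .
qed

lemma comb_smult_const:
  assumes "x \<in> carrier A"
  shows "comb I (\<lambda>i. l i \<odot>\<^bsub>A\<^esub> x) c = (\<Sum>i\<in>I. \<iota> (l i) * c i) \<odot>\<^bsub>S\<^esub> \<tau> x"
proof -
  have "comb I (\<lambda>i. l i \<odot>\<^bsub>A\<^esub> x) c = finsum S (\<lambda>i. (\<iota> (l i) * c i) \<odot>\<^bsub>S\<^esub> \<tau> x) I"
    unfolding comb_def
    by (rule S.finsum_cong') (use assms in \<open>auto simp: \<tau>_smult S.scal_scal mult.commute\<close>)
  with assms show ?thesis by (simp add: S.finsum_scal)
qed

lemma comb_zero: "(\<And>i. i \<in> I \<Longrightarrow> a i = \<zero>\<^bsub>A\<^esub>) \<Longrightarrow> comb I a c = \<zero>\<^bsub>S\<^esub>"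
  unfolding comb_def by (rule S.add.finprod_one_eqI) simp

lemma comb_smult:
  assumes "a \<in> I \<rightarrow> carrier A"
  shows "comb I (\<lambda>i. l \<odot>\<^bsub>A\<^esub> a i) c = \<iota> l \<odot>\<^bsub>S\<^esub> comb I a c"
  using assms
proof (induction I rule: infinite_finite_induct)
  case (insert i I)
  then have "a i \<in> carrier A" "a \<in> I \<rightarrow> carrier A" by auto
  moreover have "(\<lambda>i. l \<odot>\<^bsub>A\<^esub> a i) \<in> insert i I \<rightarrow> carrier A"
    by (intro Pi_I A.scal_closed) (use insert.prems in auto)
  moreover note insert
  ultimately show ?case
    by (simp add: comb_insert \<tau>_smult S.scal_r_distr S.scal_scal mult.commute)
qed (simp_all add: comb_def)

lemma comb_mult_left:
  assumes "a \<in> I \<rightarrow> carrier A" "u \<in> carrier A"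
  shows "comb I (\<lambda>i. u \<otimes>\<^bsub>A\<^esub> a i) c = \<tau> u \<otimes>\<^bsub>S\<^esub> comb I a c"
  using assms(1)
proof (induction I rule: infinite_finite_induct)
  case (insert i I)
  moreover have "a \<in> I \<rightarrow> carrier A" "a i \<in> carrier A"
    "(\<lambda>i. u \<otimes>\<^bsub>A\<^esub> a i) \<in> insert i I \<rightarrow> carrier A" using insert.prems assms(2) by auto
  ultimately show ?case using assms(2)
    by (simp add: comb_insert S.r_distr \<tau>_mult S.smult_mult_right)
qed (use assms(2) in \<open>auto simp: comb_def\<close>)

lemma comb_mult_right:
  assumes "a \<in> I \<rightarrow> carrier A" "u \<in> carrier A"
  shows "comb I (\<lambda>i. a i \<otimes>\<^bsub>A\<^esub> u) c = comb I a c \<otimes>\<^bsub>S\<^esub> \<tau> u"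
  using assms(1)
proof (induction I rule: infinite_finite_induct)
  case (insert i I)
  moreover have "a \<in> I \<rightarrow> carrier A" "a i \<in> carrier A"
    "(\<lambda>i. a i \<otimes>\<^bsub>A\<^esub> u) \<in> insert i I \<rightarrow> carrier A" using insert.prems assms(2) by auto
  ultimately show ?case using assms(2)
    by (simp add: comb_insert S.l_distr \<tau>_mult S.smult_mult_left)
qed (use assms(2) in \<open>auto simp: comb_def\<close>)

lemma comb_act:
  assumes "a \<in> I \<rightarrow> carrier A" "x \<in> carrier S"
    and "\<And>i. i \<in> I \<Longrightarrow> \<tau> (a i) \<otimes>\<^bsub>S\<^esub> x = \<xi> (a i) \<odot>\<^bsub>S\<^esub> x"
  shows "comb I a c \<otimes>\<^bsub>S\<^esub> x = (\<Sum>i\<in>I. c i * \<xi> (a i)) \<odot>\<^bsub>S\<^esub> x"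
  using assms(1,3)
proof (induction I rule: infinite_finite_induct)
  case (insert i I)
  moreover have "a \<in> I \<rightarrow> carrier A" "a i \<in> carrier A" using insert.prems by auto
  ultimately show ?case using assms(2)
    by (simp add: comb_insert S.l_distr S.smult_mult_left S.scal_scal S.scal_l_distr)
qed (use assms(2) in \<open>auto simp: comb_def\<close>)

text \<open>A linear relation over the base field between the coefficients allows one of them to be
  eliminated.\<close>

lemma comb_reduce:
  fixes I :: "nat set"
  assumes V: "subsp V" and g: "semilin V g" and "finite I" "a \<in> I \<rightarrow> V"
  shows "\<exists>J b. J \<subseteq> I \<and> b \<in> J \<rightarrow> V \<and> indep J c \<and> comb I a c = comb J b c \<and>
    (\<Sum>i\<in>I. c i * g (a i)) = (\<Sum>i\<in>J. c i * g (b i))"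
  using assms(3,4)
proof (induction I arbitrary: a rule: finite_psubset_induct)
  case (psubset I)
  have VA: "V \<subseteq> carrier A" using V by (simp add: subsp_def)
  show ?case
  proof (cases "indep I c")
    case True
    with psubset show ?thesis by blast
  next
    case False
    then obtain l k where l: "(\<Sum>i\<in>I. \<iota> (l i) * c i) = 0" and k: "k \<in> I" "l k \<noteq> 0"
      by (auto simp: indep_def)
    let ?K = "I - {k}"
    let ?m = "\<lambda>i. - (l i / l k)"
    have fin: "finite ?K" using psubset by simp
    have ck: "c k = (\<Sum>i\<in>?K. \<iota> (?m i) * c i)"
    proof -
      have "\<iota> (l k) * c k + (\<Sum>i\<in>?K. \<iota> (l i) * c i) = 0"
        using l k psubset.hyps by (simp add: sum.remove)
      then have "\<iota> (l k) * c k = - (\<Sum>i\<in>?K. \<iota> (l i) * c i)"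
        by (simp only: eq_neg_iff_add_eq_0)
      then have "c k = (- (\<Sum>i\<in>?K. \<iota> (l i) * c i)) / \<iota> (l k)"
        using k by (subst nonzero_eq_divide_eq) (simp_all add: mult.commute)
      moreover have "(\<Sum>i\<in>?K. \<iota> (?m i) * c i) = - ((\<Sum>i\<in>?K. \<iota> (l i) * c i) / \<iota> (l k))"
        by (simp add: sum_divide_distrib sum_negf hom_distribs)
      ultimately show ?thesis by simp
    qed
    \<comment> \<open>Substituting the expression for \<open>c k\<close> distributes the term at
      \<open>k\<close> over the others: \<open>a i\<close> absorbs the multiple \<open>?m i\<close>
      of \<open>a k\<close>. Since \<open>g\<close> is semilinear, the sum with \<open>g\<close>
      undergoes the same substitution and keeps its value.\<close>
    define b where "b i = a i \<oplus>\<^bsub>A\<^esub> ?m i \<odot>\<^bsub>A\<^esub> a k" for i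
    have aK: "a \<in> ?K \<rightarrow> V" "a k \<in> V" using psubset.prems k by auto
    have bK: "b \<in> ?K \<rightarrow> V"
    proof
      fix i assume "i \<in> ?K"
      then have "a i \<in> V" using aK by blast
      with aK(2) V show "b i \<in> V" unfolding b_def subsp_def by blast
    qed
    have "comb I a c = comb (insert k ?K) a c" using k by (simp add: insert_absorb)
    also have "\<dots> = c k \<odot>\<^bsub>S\<^esub> \<tau> (a k) \<oplus>\<^bsub>S\<^esub> comb ?K a c"
      by (rule comb_insert) (use fin psubset.prems VA k in auto)
    also have "\<dots> = comb ?K a c \<oplus>\<^bsub>S\<^esub> comb ?K (\<lambda>i. ?m i \<odot>\<^bsub>A\<^esub> a k) c"
      using aK VA by (subst comb_smult_const) (auto simp: ck[symmetric] intro!: S.a_comm comb_closed)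
    also have "\<dots> = comb ?K b c"
      unfolding b_def by (rule comb_add[symmetric]) (use aK VA in auto)
    finally have 1: "comb I a c = comb ?K b c" .
    have "(\<Sum>i\<in>?K. c i * g (b i)) = (\<Sum>i\<in>?K. c i * g (a i) + \<iota> (?m i) * c i * g (a k))"
    proof (rule sum.cong)
      fix i assume "i \<in> ?K"
      then have "a i \<in> V" using aK by auto
      moreover have "?m i \<odot>\<^bsub>A\<^esub> a k \<in> V" using V aK by (simp add: subsp_def)
      ultimately have "g (b i) = g (a i) + \<iota> (?m i) * g (a k)"
        using g aK(2) unfolding b_def semilin_def by simp
      then show "c i * g (b i) = c i * g (a i) + \<iota> (?m i) * c i * g (a k)"
        by (simp add: algebra_simps)
    qed simp
    also have "\<dots> = (\<Sum>i\<in>?K. c i * g (a i)) + c k * g (a k)"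
      by (subst ck) (simp add: sum.distrib sum_distrib_right)
    also have "\<dots> = (\<Sum>i\<in>I. c i * g (a i))"
      using k psubset.hyps by (simp add: sum.remove)
    finally have 2: "(\<Sum>i\<in>I. c i * g (a i)) = (\<Sum>i\<in>?K. c i * g (b i))" by simp
    obtain J d where "J \<subseteq> ?K" "d \<in> J \<rightarrow> V" "indep J c" "comb ?K b c = comb J d c"
      "(\<Sum>i\<in>?K. c i * g (b i)) = (\<Sum>i\<in>J. c i * g (d i))"
      using psubset.IH[of ?K b] k bK by blast
    with 1 2 show ?thesis by (intro exI[of _ J] exI[of _ d]) auto
  qed
qed

section \<open>Linear disjointness and the extension of semilinear forms\<close>

lemma faithful_mono:
  assumes "faithful V" "W \<subseteq> V"
  shows "faithful W"
  unfolding faithful_def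
proof (intro allI impI)
  fix I :: "nat set" and a c
  assume I: "finite I" "a \<in> I \<rightarrow> W" "indep I c" "comb I a c = \<zero>\<^bsub>S\<^esub>"
  then have "a \<in> I \<rightarrow> V" using assms(2) by auto
  from assms(1)[unfolded faithful_def, rule_format, OF I(1) this I(3,4)]
  show "\<forall>i\<in>I. a i = \<zero>\<^bsub>A\<^esub>" by blast
qed

text \<open>This is what makes the extension of \<open>g\<close> well defined. After the reduction
  to independent coefficients, faithfulness makes every remaining \<open>b i\<close> zero, and the
  reduction has not changed the sum with \<open>g\<close>.\<close>

lemma faithful_sum:
  fixes I :: "nat set"
  assumes "faithful V" "subsp V" "semilin V g" "finite I" "a \<in> I \<rightarrow> V" "comb I a c = \<zero>\<^bsub>S\<^esub>"
  shows "(\<Sum>i\<in>I. c i * g (a i)) = 0"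
proof -
  obtain J b where J: "J \<subseteq> I" "b \<in> J \<rightarrow> V" "indep J c" "comb I a c = comb J b c"
    "(\<Sum>i\<in>I. c i * g (a i)) = (\<Sum>i\<in>J. c i * g (b i))"
    using comb_reduce[OF assms(2-5), of c] by blast
  have fin: "finite J" using J(1) assms(4) by (rule finite_subset)
  have zero: "comb J b c = \<zero>\<^bsub>S\<^esub>" using assms(6) J(4) by simp
  have b: "\<forall>i\<in>J. b i = \<zero>\<^bsub>A\<^esub>"
    using assms(1)[unfolded faithful_def, rule_format, OF fin J(2,3) zero] by blast
  have "\<zero>\<^bsub>A\<^esub> \<in> V" using assms(2) by (simp add: subsp_def)
  then have "g (0 \<odot>\<^bsub>A\<^esub> \<zero>\<^bsub>A\<^esub>) = \<iota> 0 * g \<zero>\<^bsub>A\<^esub>" using assms(3) unfolding semilin_def by blast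
  then have "g \<zero>\<^bsub>A\<^esub> = 0" by simp
  with b J(5) show ?thesis by simp
qed

text \<open>The graph of the \<open>F\<^sub>s\<close>-linear extension of \<open>g\<close>, built as
  a relation so that no representation of an element has to be chosen. It is single-valued only when
  V is faithful.\<close>

inductive_set graph :: "'a set \<Rightarrow> ('a \<Rightarrow> 's) \<Rightarrow> ('b \<times> 's) set"
  for V g where
  zero: "(\<zero>\<^bsub>S\<^esub>, 0) \<in> graph V g"
| step: "(X, t) \<in> graph V g \<Longrightarrow> a \<in> V \<Longrightarrow> (c \<odot>\<^bsub>S\<^esub> \<tau> a \<oplus>\<^bsub>S\<^esub> X, c * g a + t) \<in> graph V g"

text \<open>The \<open>F\<^sub>s\<close>-span of the image of V. As the domain of the graph of the
  zero form it inherits its closure properties from \<open>graph\<close>.\<close>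

definition lin :: "'a set \<Rightarrow> 'b set" where
  "lin V = fst ` graph V (\<lambda>_. 0)"

lemma graph_closed: "(X, t) \<in> graph V g \<Longrightarrow> subsp V \<Longrightarrow> X \<in> carrier S"
  by (induction rule: graph.induct) (auto simp: subsp_def)

lemma graph_add:
  assumes "(X, t) \<in> graph V g" "(Y, u) \<in> graph V g" "subsp V"
  shows "(X \<oplus>\<^bsub>S\<^esub> Y, t + u) \<in> graph V g"
  using assms
proof (induction rule: graph.induct)
  case zero
  then show ?case using graph_closed[of Y u V g] by simp
next
  case (step X t a c)
  have cl: "X \<in> carrier S" "Y \<in> carrier S" "a \<in> carrier A"
    using step graph_closed by (auto simp: subsp_def)
  show ?case using graph.step[OF step.IH step.hyps(2), of c] step.prems cl
    by (simp add: S.a_assoc add.assoc)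
qed

lemma graph_smult:
  assumes "(X, t) \<in> graph V g" "subsp V"
  shows "(d \<odot>\<^bsub>S\<^esub> X, d * t) \<in> graph V g"
  using assms
proof (induction rule: graph.induct)
  case zero
  then show ?case using graph.zero by simp
next
  case (step X t a c)
  have cl: "X \<in> carrier S" "a \<in> carrier A"
    using step graph_closed by (auto simp: subsp_def)
  show ?case using graph.step[OF step.IH step.hyps(2), of "d * c"] step.prems cl
    by (simp add: S.scal_r_distr S.scal_scal algebra_simps)
qed

lemma graph_single: "a \<in> V \<Longrightarrow> subsp V \<Longrightarrow> (c \<odot>\<^bsub>S\<^esub> \<tau> a, c * g a) \<in> graph V g"
  using graph.step[OF graph.zero, of a V c g] by (auto simp: subsp_def subset_iff)

lemma graph_rep:
  assumes "(X, t) \<in> graph V g" "subsp V"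
  shows "\<exists>(r::nat) a c. a \<in> {..<r} \<rightarrow> V \<and> X = comb {..<r} a c \<and> t = (\<Sum>i<r. c i * g (a i))"
  using assms
proof (induction rule: graph.induct)
  case zero
  show ?case by (intro exI[of _ 0]) auto
next
  case (step X t a' c')
  then obtain r :: nat and a c where r: "a \<in> {..<r} \<rightarrow> V" "X = comb {..<r} a c" "t = (\<Sum>i<r. c i * g (a i))"
    by blast
  have VA: "V \<subseteq> carrier A" using step.prems by (simp add: subsp_def)
  let ?a = "a(r := a')" and ?c = "c(r := c')"
  have "comb {..<Suc r} ?a ?c = c' \<odot>\<^bsub>S\<^esub> \<tau> a' \<oplus>\<^bsub>S\<^esub> comb {..<r} ?a ?c"
    using r(1) step.hyps(2) VA
    by (subst lessThan_Suc, subst comb_insert) (auto simp: Pi_iff less_Suc_eq)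
  also have "comb {..<r} ?a ?c = comb {..<r} a c"
    using r(1) VA by (intro comb_cong) auto
  finally have "c' \<odot>\<^bsub>S\<^esub> \<tau> a' \<oplus>\<^bsub>S\<^esub> X = comb {..<Suc r} ?a ?c" using r(2) by (simp only:)
  moreover have "c' * g a' + t = (\<Sum>i<Suc r. ?c i * g (?a i))"
    using r by (simp add: add.commute)
  moreover have "?a \<in> {..<Suc r} \<rightarrow> V" using r(1) step.hyps(2) by (auto simp: less_Suc_eq)
  ultimately show ?case by (intro exI[of _ "Suc r"] exI[of _ ?a] exI[of _ ?c] conjI)
qed

text \<open>The difference of two entries over the same element is an entry over zero, where
  \<open>faithful_sum\<close> forces the second component to vanish.\<close>

lemma graph_functional:
  assumes "faithful V" "subsp V" "semilin V g" "(X, t) \<in> graph V g" "(X, u) \<in> graph V g"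
  shows "t = u"
proof -
  have "(X \<oplus>\<^bsub>S\<^esub> (-1) \<odot>\<^bsub>S\<^esub> X, t + (-1) * u) \<in> graph V g"
    by (intro graph_add graph_smult assms)
  moreover have "X \<oplus>\<^bsub>S\<^esub> (-1) \<odot>\<^bsub>S\<^esub> X = \<zero>\<^bsub>S\<^esub>"
    using graph_closed[OF assms(4,2)] by (simp add: S.scal_minus S.r_neg)
  ultimately have "(\<zero>\<^bsub>S\<^esub>, t - u) \<in> graph V g" by simp
  from graph_rep[OF this assms(2)] obtain r :: nat and a c
    where r: "a \<in> {..<r} \<rightarrow> V" "\<zero>\<^bsub>S\<^esub> = comb {..<r} a c" "t - u = (\<Sum>i<r. c i * g (a i))"
    by blast
  from r(3) show ?thesis using faithful_sum[OF assms(1-3) _ r(1) r(2)[symmetric]] by simp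
qed

text \<open>The first components in a derivation of \<open>graph\<close> do not involve
  \<open>g\<close>, so the extension of any form is defined on the same span.\<close>

lemma lin_graph: "X \<in> lin V \<longleftrightarrow> (\<exists>t. (X, t) \<in> graph V g)"
proof
  assume "X \<in> lin V"
  then obtain t where "(X, t) \<in> graph V (\<lambda>_. 0)" by (auto simp: lin_def)
  then show "\<exists>t. (X, t) \<in> graph V g"
    by (induction rule: graph.induct) (auto intro: graph.intros)
next
  assume "\<exists>t. (X, t) \<in> graph V g"
  then obtain t where "(X, t) \<in> graph V g" by blast
  then have "\<exists>t. (X, t) \<in> graph V (\<lambda>_. 0)"
    by (induction rule: graph.induct) (auto intro: graph.intros)
  then show "X \<in> lin V" by (force simp: lin_def)
qed

lemma lin_zero: "\<zero>\<^bsub>S\<^esub> \<in> lin V"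
  unfolding lin_graph[of _ V "\<lambda>_. 0"] using graph.zero by blast

lemma carrier_subsp: "subsp (carrier A)"
  by (auto simp: subsp_def)

lemma lin_induct [consumes 2, case_names zero step]:
  assumes "X \<in> lin V" "subsp V" "Q \<zero>\<^bsub>S\<^esub>"
    and "\<And>X a c. X \<in> lin V \<Longrightarrow> X \<in> carrier S \<Longrightarrow> a \<in> V \<Longrightarrow> a \<in> carrier A \<Longrightarrow> Q X \<Longrightarrow> Q (c \<odot>\<^bsub>S\<^esub> \<tau> a \<oplus>\<^bsub>S\<^esub> X)"
  shows "Q X"
proof -
  obtain t where "(X, t) \<in> graph V (\<lambda>_. 0)" using assms(1) by (auto simp: lin_def)
  then show ?thesis
  proof (induction rule: graph.induct)
    case (step X t a c)
    have "X \<in> lin V" using step.hyps(1) by (force simp: lin_def)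
    moreover have "a \<in> carrier A" using step.hyps(2) assms(2) by (auto simp: subsp_def)
    ultimately show ?case
      using assms(4) step graph_closed[OF step.hyps(1) assms(2)] by blast
  qed (rule assms)
qed

lemma lin_rep:
  assumes "X \<in> lin V" "subsp V"
  obtains r :: nat and a c where "a \<in> {..<r} \<rightarrow> V" "X = comb {..<r} a c"
proof -
  obtain t where "(X, t) \<in> graph V (\<lambda>_. 0)" using assms(1) by (auto simp: lin_def)
  from graph_rep[OF this assms(2)] that show ?thesis by blast
qed

text \<open>This is \<open>comb_reduce\<close> for the zero form; \<open>faithful\<close> and
  \<open>central_simple_ideal\<close> apply only to representations with independent
  coefficients.\<close>

lemma lin_rep_indep:
  assumes "X \<in> lin V" "subsp V"
  obtains I :: "nat set" and a c where "finite I" "a \<in> I \<rightarrow> V" "indep I c" "X = comb I a c"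
proof -
  obtain r :: nat and a c where r: "a \<in> {..<r} \<rightarrow> V" "X = comb {..<r} a c"
    using assms by (rule lin_rep)
  obtain J b where "J \<subseteq> {..<r}" "b \<in> J \<rightarrow> V" "indep J c" "comb {..<r} a c = comb J b c"
    using comb_reduce[OF assms(2) semilin_0 _ r(1), of c] by blast
  with r that[of J b c] show ?thesis by (simp add: finite_subset)
qed

lemma lin_closed: "X \<in> lin V \<Longrightarrow> subsp V \<Longrightarrow> X \<in> carrier S"
  using graph_closed by (auto simp: lin_def)

lemma lin_add: "X \<in> lin V \<Longrightarrow> Y \<in> lin V \<Longrightarrow> subsp V \<Longrightarrow> X \<oplus>\<^bsub>S\<^esub> Y \<in> lin V"
  unfolding lin_graph[of _ V "\<lambda>_. 0"] using graph_add by blast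

lemma lin_smult: "X \<in> lin V \<Longrightarrow> subsp V \<Longrightarrow> c \<odot>\<^bsub>S\<^esub> X \<in> lin V"
  unfolding lin_graph[of _ V "\<lambda>_. 0"] using graph_smult by blast

lemma lin_single: "a \<in> V \<Longrightarrow> subsp V \<Longrightarrow> c \<odot>\<^bsub>S\<^esub> \<tau> a \<in> lin V"
  unfolding lin_graph[of _ V "\<lambda>_. 0"] using graph_single by blast

lemma comb_lin: "finite I \<Longrightarrow> a \<in> I \<rightarrow> V \<Longrightarrow> subsp V \<Longrightarrow> comb I a c \<in> lin V"
proof (induction I rule: finite_induct)
  case empty
  then show ?case by (simp add: lin_zero)
next
  case (insert i I)
  then have "a \<in> insert i I \<rightarrow> carrier A" by (auto simp: subsp_def Pi_iff subset_iff)
  with insert show ?case by (simp add: comb_insert lin_add lin_single Pi_iff)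
qed

text \<open>Plays the part of the universal property of the tensor product. It extends f to the
  symmetric elements of \<open>A\<^sub>s\<close>, and the characters of L to
  \<open>L \<otimes> F\<^sub>s\<close>.\<close>

lemma semilinear_extension:
  assumes "faithful V" "subsp V" "semilin V g"
  obtains h where "\<And>X Y. X \<in> lin V \<Longrightarrow> Y \<in> lin V \<Longrightarrow> h (X \<oplus>\<^bsub>S\<^esub> Y) = h X + h Y"
    and "\<And>X c. X \<in> lin V \<Longrightarrow> h (c \<odot>\<^bsub>S\<^esub> X) = c * h X"
    and "\<And>a. a \<in> V \<Longrightarrow> h (\<tau> a) = g a"
proof -
  define h where "h X = (THE t. (X, t) \<in> graph V g)" for X
  have h: "h X = t" if "(X, t) \<in> graph V g" for X t
    unfolding h_def using that graph_functional[OF assms] by blast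
  show ?thesis
  proof (rule that[of h])
    show "h (X \<oplus>\<^bsub>S\<^esub> Y) = h X + h Y" if XY: "X \<in> lin V" "Y \<in> lin V" for X Y
    proof -
      obtain t u where "(X, t) \<in> graph V g" "(Y, u) \<in> graph V g"
        using XY by (auto simp: lin_graph[of _ V g])
      then show ?thesis using h graph_add[of X t V g Y u] assms(2) by simp
    qed
    show "h (c \<odot>\<^bsub>S\<^esub> X) = c * h X" if X: "X \<in> lin V" for X c
    proof -
      obtain t where "(X, t) \<in> graph V g" using X lin_graph by blast
      then show ?thesis using h graph_smult[of X t V g c] assms(2) by simp
    qed
    show "h (\<tau> a) = g a" if "a \<in> V" for a
      using h[OF graph_single[OF that assms(2), of 1 g]] that assms(2) by (auto simp: subsp_def subset_iff)
  qed
qed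

text \<open>The tensor product of a central simple algebra with an extension field is simple.
  The coefficient of \<open>c\<^sub>r\<close> is normalized to 1; commutators then remove this term, so that by induction
  the other coefficients are central, and the element is a nonzero scalar.\<close>

lemma central_simple_ideal:
  assumes simple: "\<And>J. ideal J A \<Longrightarrow> J = {\<zero>\<^bsub>A\<^esub>} \<or> J = carrier A"
    and central: "\<And>z. z \<in> carrier A \<Longrightarrow> (\<And>x. x \<in> carrier A \<Longrightarrow> z \<otimes>\<^bsub>A\<^esub> x = x \<otimes>\<^bsub>A\<^esub> z) \<Longrightarrow>
      \<exists>c. z = c \<odot>\<^bsub>A\<^esub> \<one>\<^bsub>A\<^esub>"
    and U: "ideal U S" "\<one>\<^bsub>S\<^esub> \<notin> U"
    and "finite I" "a \<in> I \<rightarrow> carrier A" "indep I c" "comb I a c \<in> U"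
  shows "\<forall>i\<in>I. a i = \<zero>\<^bsub>A\<^esub>"
  using assms(5-)
proof (induction I arbitrary: a rule: finite_induct)
  case (insert r I)
  interpret U: ideal U S by fact
  have indep: "indep I c"
    unfolding indep_def
  proof (intro allI impI)
    fix l assume "(\<Sum>i\<in>I. \<iota> (l i) * c i) = 0"
    moreover have "(\<Sum>i\<in>I. \<iota> ((l(r := 0)) i) * c i) = (\<Sum>i\<in>I. \<iota> (l i) * c i)"
      by (rule sum.cong) (use insert.hyps in auto)
    ultimately have "(\<Sum>i\<in>insert r I. \<iota> ((l(r := 0)) i) * c i) = 0"
      using insert.hyps by (simp del: fun_upd_apply) simp
    then have "\<forall>i\<in>insert r I. (l(r := 0)) i = 0"
      using insert.prems(2) unfolding indep_def by blast
    then show "\<forall>i\<in>I. l i = 0" using insert.hyps by (metis fun_upd_other insertI2)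
  qed
  \<comment> \<open>The coefficients that occur at \<open>r\<close> in elements of \<open>U\<close>,
    with the scalars \<open>c\<close> fixed. Multiplying by \<open>\<tau> x\<close> on either side
    acts on all coefficients at once, so they form a two-sided ideal of A. Either it is zero, which
    settles the coefficient at \<open>r\<close>, or it contains 1.\<close>
  define J where "J = {u. \<exists>b. b \<in> insert r I \<rightarrow> carrier A \<and> b r = u \<and> comb (insert r I) b c \<in> U}"
  have "ideal J A"
  proof (rule idealI)
    show "subgroup J (add_monoid A)"
    proof (rule A.add.subgroupI)
      show "J \<subseteq> carrier A" by (auto simp: J_def)
      show "J \<noteq> {}" using insert.prems(1,3) by (auto simp: J_def)
    next
      fix u assume "u \<in> J"
      then obtain b where b: "b \<in> insert r I \<rightarrow> carrier A" "b r = u" "comb (insert r I) b c \<in> U"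
        by (auto simp: J_def)
      let ?m = "\<ominus>\<^bsub>A\<^esub> \<one>\<^bsub>A\<^esub>"
      have "comb (insert r I) (\<lambda>i. ?m \<otimes>\<^bsub>A\<^esub> b i) c \<in> U"
        using b by (subst comb_mult_left) (auto intro!: U.I_l_closed)
      moreover have "?m \<otimes>\<^bsub>A\<^esub> b r = \<ominus>\<^bsub>A\<^esub> u" using b by (auto simp: A.l_minus)
      moreover have "(\<lambda>i. ?m \<otimes>\<^bsub>A\<^esub> b i) \<in> insert r I \<rightarrow> carrier A" using b(1) by auto
      ultimately show "\<ominus>\<^bsub>A\<^esub> u \<in> J"
        unfolding J_def by (intro CollectI exI[of _ "\<lambda>i. ?m \<otimes>\<^bsub>A\<^esub> b i"] conjI)
    next
      fix u v assume "u \<in> J" "v \<in> J"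
      then obtain b d where b: "b \<in> insert r I \<rightarrow> carrier A" "b r = u" "comb (insert r I) b c \<in> U"
        and d: "d \<in> insert r I \<rightarrow> carrier A" "d r = v" "comb (insert r I) d c \<in> U"
        by (auto simp: J_def)
      then have "comb (insert r I) (\<lambda>i. b i \<oplus>\<^bsub>A\<^esub> d i) c \<in> U" by (simp add: comb_add)
      with b d show "u \<oplus>\<^bsub>A\<^esub> v \<in> J"
        unfolding J_def by (intro CollectI exI[of _ "\<lambda>i. b i \<oplus>\<^bsub>A\<^esub> d i"]) auto
    qed
  next
    fix u x assume "u \<in> J" and x: "x \<in> carrier A"
    then obtain b where b: "b \<in> insert r I \<rightarrow> carrier A" "b r = u" "comb (insert r I) b c \<in> U"
      by (auto simp: J_def)
    have "comb (insert r I) (\<lambda>i. x \<otimes>\<^bsub>A\<^esub> b i) c \<in> U" "comb (insert r I) (\<lambda>i. b i \<otimes>\<^bsub>A\<^esub> x) c \<in> U"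
      unfolding comb_mult_left[OF b(1) x] comb_mult_right[OF b(1) x]
      using U.I_l_closed U.I_r_closed b(3) \<tau>_closed[OF x] by blast+
    moreover have "(\<lambda>i. x \<otimes>\<^bsub>A\<^esub> b i) \<in> insert r I \<rightarrow> carrier A"
      "(\<lambda>i. b i \<otimes>\<^bsub>A\<^esub> x) \<in> insert r I \<rightarrow> carrier A"
      using b(1) x by auto
    ultimately show "x \<otimes>\<^bsub>A\<^esub> u \<in> J" "u \<otimes>\<^bsub>A\<^esub> x \<in> J"
      unfolding J_def using b(2) by blast+
  qed (rule A.ring_axioms)
  moreover have "\<one>\<^bsub>A\<^esub> \<notin> J"
  proof
    assume "\<one>\<^bsub>A\<^esub> \<in> J"
    then obtain b where b: "b \<in> insert r I \<rightarrow> carrier A" "b r = \<one>\<^bsub>A\<^esub>" "comb (insert r I) b c \<in> U"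
      by (auto simp: J_def)
    have bI: "b \<in> I \<rightarrow> carrier A" using b(1) by auto
    have comm: "x \<otimes>\<^bsub>A\<^esub> b i \<ominus>\<^bsub>A\<^esub> b i \<otimes>\<^bsub>A\<^esub> x = \<zero>\<^bsub>A\<^esub>" if x: "x \<in> carrier A" and i: "i \<in> I" for x i
    proof -
      let ?d = "\<lambda>i. x \<otimes>\<^bsub>A\<^esub> b i \<oplus>\<^bsub>A\<^esub> b i \<otimes>\<^bsub>A\<^esub> (\<ominus>\<^bsub>A\<^esub> x)"
      have d: "?d \<in> insert r I \<rightarrow> carrier A" using b(1) x by auto
      have dr: "?d r = \<zero>\<^bsub>A\<^esub>" using b(2) x by (simp add: A.r_neg)
      have "comb (insert r I) ?d c =
          \<tau> x \<otimes>\<^bsub>S\<^esub> comb (insert r I) b c \<oplus>\<^bsub>S\<^esub> comb (insert r I) b c \<otimes>\<^bsub>S\<^esub> \<tau> (\<ominus>\<^bsub>A\<^esub> x)"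
        using b(1) x by (subst comb_add) (auto simp: comb_mult_left comb_mult_right)
      also have "\<dots> \<in> U"
        by (rule U.a_closed[OF U.I_l_closed[OF b(3)] U.I_r_closed[OF b(3)]]) (use x in auto)
      finally have "comb I ?d c \<in> U"
        using insert.hyps d dr comb_closed[of ?d I c] by (subst (asm) comb_insert) auto
      then have "\<forall>i\<in>I. ?d i = \<zero>\<^bsub>A\<^esub>" using d indep by (intro insert.IH) auto
      then have "?d i = \<zero>\<^bsub>A\<^esub>" using i by blast
      moreover have "b i \<in> carrier A" using bI i by blast
      ultimately show ?thesis using x by (simp add: A.minus_eq A.r_minus)
    qed
    have "\<exists>l. b i = l \<odot>\<^bsub>A\<^esub> \<one>\<^bsub>A\<^esub>" if "i \<in> insert r I" for i
    proof (cases "i = r")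
      case True
      then show ?thesis using b(2) by (intro exI[of _ 1]) simp
    next
      case False
      with that have i: "i \<in> I" by simp
      show ?thesis
      proof (rule central)
        show bi: "b i \<in> carrier A" using bI i by blast
        fix x assume x: "x \<in> carrier A"
        have "b i \<otimes>\<^bsub>A\<^esub> x \<oplus>\<^bsub>A\<^esub> (x \<otimes>\<^bsub>A\<^esub> b i \<ominus>\<^bsub>A\<^esub> b i \<otimes>\<^bsub>A\<^esub> x) = x \<otimes>\<^bsub>A\<^esub> b i"
          using bi x by (simp add: A.minus_eq A.a_lcomm A.r_neg)
        then show "b i \<otimes>\<^bsub>A\<^esub> x = x \<otimes>\<^bsub>A\<^esub> b i" using comm[OF x i] bi x by simp
      qed
    qed
    then obtain l where l: "\<And>i. i \<in> insert r I \<Longrightarrow> b i = l i \<odot>\<^bsub>A\<^esub> \<one>\<^bsub>A\<^esub>" by metis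
    have lr: "l r \<noteq> 0"
    proof
      assume "l r = 0"
      then have "\<one>\<^bsub>A\<^esub> = \<zero>\<^bsub>A\<^esub>" using l[of r] b(2) by simp
      then have "\<one>\<^bsub>S\<^esub> = \<zero>\<^bsub>S\<^esub>" using \<tau>_one \<tau>_zero by metis
      then show False using U U.zero_closed by simp
    qed
    let ?s = "\<Sum>i\<in>insert r I. \<iota> (l i) * c i"
    have "?s \<noteq> 0" using insert.prems(2) lr unfolding indep_def by blast
    have "comb (insert r I) b c = comb (insert r I) (\<lambda>i. l i \<odot>\<^bsub>A\<^esub> \<one>\<^bsub>A\<^esub>) c"
      by (rule comb_cong) (use l in auto)
    also have "\<dots> = ?s \<odot>\<^bsub>S\<^esub> \<one>\<^bsub>S\<^esub>" by (subst comb_smult_const) simp_all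
    finally have "?s \<odot>\<^bsub>S\<^esub> \<one>\<^bsub>S\<^esub> \<in> U" using b(3) by simp
    then have "(inverse ?s \<odot>\<^bsub>S\<^esub> \<one>\<^bsub>S\<^esub>) \<otimes>\<^bsub>S\<^esub> (?s \<odot>\<^bsub>S\<^esub> \<one>\<^bsub>S\<^esub>) \<in> U" by (rule U.I_l_closed) simp
    moreover have "(inverse ?s \<odot>\<^bsub>S\<^esub> \<one>\<^bsub>S\<^esub>) \<otimes>\<^bsub>S\<^esub> (?s \<odot>\<^bsub>S\<^esub> \<one>\<^bsub>S\<^esub>) = \<one>\<^bsub>S\<^esub>"
      using \<open>?s \<noteq> 0\<close> by (simp add: S.smult_mult_left S.scal_scal)
    ultimately show False using U by simp
  qed
  ultimately have "J = {\<zero>\<^bsub>A\<^esub>}" using simple by blast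
  moreover have "a r \<in> J" using insert.prems by (auto simp: J_def)
  ultimately have ar: "a r = \<zero>\<^bsub>A\<^esub>" by simp
  then have "comb I a c \<in> U"
    using insert.hyps insert.prems comb_closed[of a I c] by (subst (asm) comb_insert) auto
  then have "\<forall>i\<in>I. a i = \<zero>\<^bsub>A\<^esub>" using indep insert.prems by (intro insert.IH) auto
  with ar show ?case by simp
qed simp

end

section \<open>Characters and idempotents\<close>

text \<open>Interpreted twice: over \<open>A\<^sub>s\<close> the interpolating elements become the
  idempotents of the points, and over \<open>L \<otimes> F\<^sub>s\<close> they give the
  surjectivity of its splitting.\<close>

locale characters = base_change \<iota> A S \<tau>
  for \<iota> :: "'f::field \<Rightarrow> 's::field"
    and A :: "('f, 'a, 'm) module_scheme"
    and S :: "('s, 'b, 'l) module_scheme"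
    and \<tau> :: "'a \<Rightarrow> 'b" +
  fixes L :: "'a set" and Y :: "'y set" and \<xi> :: "'y \<Rightarrow> 'a \<Rightarrow> 's"
  assumes finite_Y: "finite Y"
    and L_subsp: "subsp L"
    and L_mult: "\<And>x y. x \<in> L \<Longrightarrow> y \<in> L \<Longrightarrow> x \<otimes>\<^bsub>A\<^esub> y \<in> L"
    and L_one: "\<one>\<^bsub>A\<^esub> \<in> L"
    and \<xi>_semilin: "\<And>y. y \<in> Y \<Longrightarrow> semilin L (\<xi> y)"
    and \<xi>_mult: "\<And>y k l. y \<in> Y \<Longrightarrow> k \<in> L \<Longrightarrow> l \<in> L \<Longrightarrow> \<xi> y (k \<otimes>\<^bsub>A\<^esub> l) = \<xi> y k * \<xi> y l"
    and \<xi>_one: "\<And>y. y \<in> Y \<Longrightarrow> \<xi> y \<one>\<^bsub>A\<^esub> = 1"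
    and \<xi>_separate: "\<And>y z. y \<in> Y \<Longrightarrow> z \<in> Y \<Longrightarrow> y \<noteq> z \<Longrightarrow> \<exists>l\<in>L. \<xi> y l \<noteq> \<xi> z l"
begin

lemma L_carrier: "l \<in> L \<Longrightarrow> l \<in> carrier A"
  using L_subsp by (auto simp: subsp_def)

text \<open>The pairs of an element of \<open>L \<otimes> F\<^sub>s\<close> and the family of its values under the characters.\<close>

inductive_set joint :: "('b \<times> ('y \<Rightarrow> 's)) set" where
  zero: "(\<zero>\<^bsub>S\<^esub>, \<lambda>_. 0) \<in> joint"
| step: "(X, v) \<in> joint \<Longrightarrow> l \<in> L \<Longrightarrow> (c \<odot>\<^bsub>S\<^esub> \<tau> l \<oplus>\<^bsub>S\<^esub> X, \<lambda>y. c * \<xi> y l + v y) \<in> joint"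
| ext: "(X, v) \<in> joint \<Longrightarrow> (\<And>y. y \<in> Y \<Longrightarrow> v y = w y) \<Longrightarrow> (X, w) \<in> joint"

lemma joint_lin: "(X, v) \<in> joint \<Longrightarrow> X \<in> lin L"
proof (induction rule: joint.induct)
  case zero
  show ?case by (rule lin_zero)
qed (auto intro: lin_add lin_single L_subsp)

lemma joint_closed: "(X, v) \<in> joint \<Longrightarrow> X \<in> carrier S"
  using joint_lin lin_closed L_subsp by blast

lemma joint_add:
  assumes "(X, v) \<in> joint" "(X', v') \<in> joint"
  shows "(X \<oplus>\<^bsub>S\<^esub> X', \<lambda>y. v y + v' y) \<in> joint"
  using assms
proof (induction rule: joint.induct)
  case zero
  then show ?case using joint_closed by simp
next
  case (step X v l c)
  then show ?case
    using joint.step[of "X \<oplus>\<^bsub>S\<^esub> X'" "\<lambda>y. v y + v' y" l c] joint_closed L_carrier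
    by (simp add: S.a_assoc add.assoc)
next
  case (ext X v w)
  then show ?case using joint.ext[of "X \<oplus>\<^bsub>S\<^esub> X'" "\<lambda>y. v y + v' y" "\<lambda>y. w y + v' y"] by simp
qed

lemma joint_smult: "(X, v) \<in> joint \<Longrightarrow> (c \<odot>\<^bsub>S\<^esub> X, \<lambda>y. c * v y) \<in> joint"
proof (induction rule: joint.induct)
  case zero
  then show ?case using joint.zero by simp
next
  case (step X v l d)
  then show ?case
    using joint.step[of "c \<odot>\<^bsub>S\<^esub> X" "\<lambda>y. c * v y" l "c * d"] joint_closed L_carrier
    by (simp add: S.scal_r_distr S.scal_scal algebra_simps)
next
  case (ext X v w)
  then show ?case using joint.ext[of "c \<odot>\<^bsub>S\<^esub> X" "\<lambda>y. c * v y" "\<lambda>y. c * w y"] by simp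
qed

lemma joint_single: "l \<in> L \<Longrightarrow> (c \<odot>\<^bsub>S\<^esub> \<tau> l, \<lambda>y. c * \<xi> y l) \<in> joint"
  using joint.step[OF joint.zero, of l c] L_carrier by simp

lemma joint_one: "(\<one>\<^bsub>S\<^esub>, \<lambda>_. 1) \<in> joint"
  using joint.ext[OF joint_single[OF L_one, of 1], of "\<lambda>_. 1"] by (simp add: \<xi>_one)

lemma joint_mult_single:
  assumes "(X, v) \<in> joint" "l \<in> L"
  shows "(\<tau> l \<otimes>\<^bsub>S\<^esub> X, \<lambda>y. \<xi> y l * v y) \<in> joint"
  using assms(1)
proof (induction rule: joint.induct)
  case zero
  then show ?case using joint.zero L_carrier assms(2) by simp
next
  case (step X v k d)
  have "(d \<odot>\<^bsub>S\<^esub> \<tau> (l \<otimes>\<^bsub>A\<^esub> k) \<oplus>\<^bsub>S\<^esub> \<tau> l \<otimes>\<^bsub>S\<^esub> X, \<lambda>y. d * \<xi> y (l \<otimes>\<^bsub>A\<^esub> k) + \<xi> y l * v y) \<in> joint"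
    using step assms(2) by (intro joint.step L_mult)
  moreover have "\<tau> l \<otimes>\<^bsub>S\<^esub> (d \<odot>\<^bsub>S\<^esub> \<tau> k \<oplus>\<^bsub>S\<^esub> X) = d \<odot>\<^bsub>S\<^esub> \<tau> (l \<otimes>\<^bsub>A\<^esub> k) \<oplus>\<^bsub>S\<^esub> \<tau> l \<otimes>\<^bsub>S\<^esub> X"
    using step assms(2) joint_closed L_carrier by (simp add: S.r_distr S.smult_mult_right \<tau>_mult)
  ultimately show ?case
    using step assms(2) by (auto intro: joint.ext simp: \<xi>_mult algebra_simps)
next
  case (ext X v w)
  then show ?case using joint.ext[of "\<tau> l \<otimes>\<^bsub>S\<^esub> X" "\<lambda>y. \<xi> y l * v y" "\<lambda>y. \<xi> y l * w y"] by simp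
qed

lemma joint_mult:
  assumes "(X, v) \<in> joint" "(X', v') \<in> joint"
  shows "(X \<otimes>\<^bsub>S\<^esub> X', \<lambda>y. v y * v' y) \<in> joint"
  using assms(1)
proof (induction rule: joint.induct)
  case zero
  then show ?case using joint.zero joint_closed assms(2) by simp
next
  case (step X v k d)
  have "(d \<odot>\<^bsub>S\<^esub> (\<tau> k \<otimes>\<^bsub>S\<^esub> X') \<oplus>\<^bsub>S\<^esub> X \<otimes>\<^bsub>S\<^esub> X', \<lambda>y. d * (\<xi> y k * v' y) + v y * v' y) \<in> joint"
    using step assms(2) by (intro joint_add joint_smult joint_mult_single)
  moreover have "(d \<odot>\<^bsub>S\<^esub> \<tau> k \<oplus>\<^bsub>S\<^esub> X) \<otimes>\<^bsub>S\<^esub> X' = d \<odot>\<^bsub>S\<^esub> (\<tau> k \<otimes>\<^bsub>S\<^esub> X') \<oplus>\<^bsub>S\<^esub> X \<otimes>\<^bsub>S\<^esub> X'"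
    using step assms(2) joint_closed L_carrier by (simp add: S.l_distr S.smult_mult_left)
  ultimately show ?case
    by (simp add: algebra_simps)
next
  case (ext X v w)
  then show ?case using joint.ext[of "X \<otimes>\<^bsub>S\<^esub> X'" "\<lambda>y. v y * v' y" "\<lambda>y. w y * v' y"] by simp
qed

text \<open>Lagrange interpolation: for each \<open>z\<close> in \<open>Z\<close> choose
  \<open>l\<close> with different values at \<open>y\<close> and \<open>z\<close>, and multiply the
  factors (\<open>l\<close> - \<xi>(z,l)) / (\<xi>(y,l) - \<xi>(z,l)), which are 1 at
  \<open>y\<close> and 0 at \<open>z\<close>.\<close>

lemma joint_separate:
  assumes "y \<in> Y" "Z \<subseteq> Y" "y \<notin> Z"
  shows "\<exists>X v. (X, v) \<in> joint \<and> v y = 1 \<and> (\<forall>z\<in>Z. v z = 0)"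
proof -
  have "finite Z" using assms(2) finite_Y finite_subset by blast
  then show ?thesis using assms(2,3)
  proof (induction Z rule: finite_induct)
    case empty
    show ?case using joint_one by auto
  next
    case (insert z Z)
    then obtain X v where X: "(X, v) \<in> joint" "v y = 1" "\<forall>z\<in>Z. v z = 0" by auto
    have z: "z \<in> Y" "y \<noteq> z" using insert.prems by auto
    then obtain l where l: "l \<in> L" "\<xi> y l \<noteq> \<xi> z l" using \<xi>_separate assms(1) by blast
    let ?d = "\<xi> y l - \<xi> z l"
    let ?X = "(1 / ?d) \<odot>\<^bsub>S\<^esub> \<tau> l \<oplus>\<^bsub>S\<^esub> (- \<xi> z l / ?d) \<odot>\<^bsub>S\<^esub> \<one>\<^bsub>S\<^esub>"
    let ?v = "\<lambda>x. (1 / ?d) * \<xi> x l + (- \<xi> z l / ?d) * 1"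
    have "(?X, ?v) \<in> joint"
      using l by (intro joint_add joint_smult[OF joint_one] joint_single)
    then have "(?X \<otimes>\<^bsub>S\<^esub> X, \<lambda>x. ?v x * v x) \<in> joint" by (rule joint_mult[OF _ X(1)])
    moreover have "?v y = 1" "?v z = 0"
      using l by (simp_all add: diff_divide_distrib[symmetric])
    ultimately show ?case using X by (intro exI[of _ "?X \<otimes>\<^bsub>S\<^esub> X"] exI[of _ "\<lambda>x. ?v x * v x"]) auto
  qed
qed

lemma joint_idempotent:
  assumes "y \<in> Y"
  shows "\<exists>X. (X, \<lambda>z. if z = y then 1 else 0) \<in> joint"
proof -
  obtain X v where X: "(X, v) \<in> joint" "v y = 1" "\<forall>z\<in>Y - {y}. v z = 0"
    using joint_separate[OF assms, of "Y - {y}"] by blast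
  show ?thesis
    by (rule exI, rule joint.ext[OF X(1)]) (use X in auto)
qed

lemma joint_finite:
  assumes "finite Z" "Z \<subseteq> Y"
  shows "\<exists>X. (X, \<lambda>y. if y \<in> Z then v y else 0) \<in> joint"
  using assms
proof (induction Z rule: finite_induct)
  case empty
  then show ?case using joint.zero by auto
next
  case (insert z Z)
  then obtain X where X: "(X, \<lambda>y. if y \<in> Z then v y else 0) \<in> joint" by auto
  obtain X' where X': "(X', \<lambda>y. if y = z then 1 else 0) \<in> joint"
    using joint_idempotent[of z] insert.prems by auto
  show ?case
    by (rule exI, rule joint.ext[OF joint_add[OF X joint_smult[OF X', of "v z"]]])
      (use insert.hyps in auto)
qed

text \<open>The Chinese remainder theorem for pairwise distinct characters: combine the elements
  that are 1 at one character and 0 at the others.\<close>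

lemma joint_surj: "\<exists>X. (X, v) \<in> joint"
proof -
  obtain X where "(X, \<lambda>y. if y \<in> Y then v y else 0) \<in> joint"
    using joint_finite[OF finite_Y subset_refl] by blast
  then have "(X, v) \<in> joint" by (rule joint.ext) simp
  then show ?thesis ..
qed

lemma lin_joint:
  assumes "X \<in> lin L"
  shows "\<exists>v. (X, v) \<in> joint"
  using assms L_subsp
proof (induction X rule: lin_induct)
  case zero
  then show ?case using joint.zero by blast
next
  case (step X a c)
  then show ?case using joint.step by blast
qed

text \<open>Ties the recorded values to the multiplication in S: on a common eigenvector of L with
  character \<open>\<xi> y\<close>, an \<open>F\<^sub>s\<close>-combination of elements of L acts by
  the same combination of values.\<close>

lemma joint_act:
  assumes "(X, v) \<in> joint" "y \<in> Y" "x \<in> carrier S" "\<And>l. l \<in> L \<Longrightarrow> \<tau> l \<otimes>\<^bsub>S\<^esub> x = \<xi> y l \<odot>\<^bsub>S\<^esub> x"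
  shows "X \<otimes>\<^bsub>S\<^esub> x = v y \<odot>\<^bsub>S\<^esub> x"
  using assms
proof (induction rule: joint.induct)
  case (step X v l c)
  then show ?case
    using joint_closed[OF step.hyps(1)] L_carrier
    by (simp add: S.l_distr S.smult_mult_left S.scal_scal S.scal_l_distr)
qed auto

text \<open>Once the character at \<open>y\<close> extends linearly to \<open>lin L\<close>, the
  recorded value is the value of the extension and hence depends on X alone.\<close>

lemma joint_hom:
  assumes "(X, v) \<in> joint" "y \<in> Y"
    and "\<And>X X'. X \<in> lin L \<Longrightarrow> X' \<in> lin L \<Longrightarrow> h (X \<oplus>\<^bsub>S\<^esub> X') = h X + h X'"
    and "\<And>X c. X \<in> lin L \<Longrightarrow> h (c \<odot>\<^bsub>S\<^esub> X) = c * h X"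
    and "\<And>l. l \<in> L \<Longrightarrow> h (\<tau> l) = \<xi> y l"
  shows "h X = v y"
  using assms(1)
proof (induction rule: joint.induct)
  case zero
  have "\<zero>\<^bsub>S\<^esub> \<in> lin L" using joint_lin[OF joint.zero] .
  from assms(4)[OF this, of 0] show ?case by simp
next
  case (step X v l c)
  have "\<tau> l \<in> lin L" using lin_single[OF step.hyps(2) L_subsp, of 1] step.hyps(2) L_carrier by simp
  with step show ?case
    using assms(3,4,5) joint_lin[OF step.hyps(1)] lin_smult[OF _ L_subsp] by simp
next
  case (ext X v w)
  then show ?case using assms(2) by simp
qed

end

text \<open>A maximal independent subset of W exists because independent sets have at most
  \<open>dim\<close> elements. Independence and span are the same in W and in the whole space, so it
  is a basis of W and its size is the dimension of W.\<close>

lemma (in vectorspace) subspace_basis: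
  assumes "fin_dim" and W: "subspace K W V"
  obtains B where "B \<subseteq> W" "finite B" "lin_indpt B" "span B = W" "card B = vectorspace.dim K (vs W)"
proof -
  have sub: "submodule K W V" using W by simp
  have WV: "W \<subseteq> carrier V" using sub by (simp add: submodule_def)
  interpret W: vectorspace K "vs W" by (rule subspace_is_vs[OF W])
  have "\<exists>B. finite B \<and> maximal B (\<lambda>S. S \<subseteq> W \<and> lin_indpt S)"
  proof (rule maximal_exists[where N = dim and B = "{}"])
    show "finite S \<and> card S \<le> dim" if "S \<subseteq> W \<and> lin_indpt S" for S
      using li_le_dim[OF assms(1), of S] that WV by blast
    show "{} \<subseteq> W \<and> lin_indpt {}" by (simp add: lin_dep_def)
  qed
  then obtain B where B: "finite B" "maximal B (\<lambda>S. S \<subseteq> W \<and> lin_indpt S)" by blast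
  then have BW: "B \<subseteq> W" "lin_indpt B" by (auto simp: maximal_def)
  have "W.basis B"
  proof (rule W.max_li_is_basis)
    show "maximal B (\<lambda>S. S \<subseteq> carrier (vs W) \<and> W.lin_indpt S)"
      using B(2) span_li_not_depend(2)[OF _ sub] unfolding maximal_def by (auto 4 3)
  qed
  then have "W.span B = W" "card B = W.dim"
    using W.dim_basis[OF B(1)] by (auto simp: W.basis_def)
  then show ?thesis
    using that[of B] B(1) BW span_li_not_depend(1)[OF BW(1) sub] by simp
qed

section \<open>Decomposition into eigenspaces\<close>

text \<open>The size of S enters only as an upper bound, through generators. The matching lower
  bound will come from the \<open>card Y\<close> independent eigenspaces of dimension
  \<open>card Y\<close>.\<close>

locale eigenspaces = characters \<iota> A S \<tau> L Y \<xi>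
  for \<iota> :: "'f::field \<Rightarrow> 's::field"
    and A :: "('f, 'a, 'm) module_scheme"
    and S :: "('s, 'b, 'l) module_scheme"
    and \<tau> :: "'a \<Rightarrow> 'b"
    and L :: "'a set" and Y :: "'y set" and \<xi> :: "'y \<Rightarrow> 'a \<Rightarrow> 's" +
  fixes E :: "'y \<Rightarrow> 'b set"
  assumes E_eq: "\<And>y. y \<in> Y \<Longrightarrow> E y = {x \<in> carrier S. \<forall>l\<in>L. \<tau> l \<otimes>\<^bsub>S\<^esub> x = \<xi> y l \<odot>\<^bsub>S\<^esub> x}"
    and E_dim: "\<And>y. y \<in> Y \<Longrightarrow> vectorspace.dim class_ring (S\<lparr>carrier := E y\<rparr>) = card Y"
    and generators: "\<exists>G. finite G \<and> card G \<le> card Y * card Y \<and> G \<subseteq> carrier S \<and>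
      LinearCombinations.module.span class_ring S G = carrier S"
begin

sublocale V: vectorspace class_ring S
  by (rule S.vectorspace_class)

lemma lincomb_eq: "V.lincomb a B = finsum S (\<lambda>v. a v \<odot>\<^bsub>S\<^esub> v) B"
  by (simp add: V.lincomb_def)

lemma V_fin_dim: "V.fin_dim"
  using generators unfolding V.fin_dim_def by auto

lemma V_dim_le: "V.dim \<le> card Y * card Y"
  using generators V.gen_ge_dim by (meson le_trans)

lemma E_closed: "y \<in> Y \<Longrightarrow> x \<in> E y \<Longrightarrow> x \<in> carrier S"
  by (simp add: E_eq)

lemma E_eigen: "y \<in> Y \<Longrightarrow> x \<in> E y \<Longrightarrow> l \<in> L \<Longrightarrow> \<tau> l \<otimes>\<^bsub>S\<^esub> x = \<xi> y l \<odot>\<^bsub>S\<^esub> x"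
  by (simp add: E_eq)

lemma E_mult: "y \<in> Y \<Longrightarrow> x \<in> E y \<Longrightarrow> X \<in> carrier S \<Longrightarrow> x \<otimes>\<^bsub>S\<^esub> X \<in> E y"
  using L_carrier by (simp add: E_eq S.m_assoc[symmetric] S.smult_mult_left)

lemma E_add: "y \<in> Y \<Longrightarrow> x \<in> E y \<Longrightarrow> x' \<in> E y \<Longrightarrow> x \<oplus>\<^bsub>S\<^esub> x' \<in> E y"
  using L_carrier by (simp add: E_eq S.r_distr S.scal_r_distr)

lemma E_smult: "y \<in> Y \<Longrightarrow> x \<in> E y \<Longrightarrow> c \<odot>\<^bsub>S\<^esub> x \<in> E y"
  using L_carrier by (simp add: E_eq S.smult_mult_right S.scal_scal mult.commute)

lemma E_zero: "y \<in> Y \<Longrightarrow> \<zero>\<^bsub>S\<^esub> \<in> E y"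
  using L_carrier by (simp add: E_eq)

lemma E_subspace:
  assumes "y \<in> Y"
  shows "subspace class_ring (E y) S"
proof -
  have "submodule class_ring (E y) S"
    by (rule submodule.intro)
      (use assms in \<open>auto simp: E_closed E_zero E_add E_smult V.module_axioms\<close>)
  then show ?thesis by (simp add: subspace_def V.vectorspace_axioms)
qed

definition B where
  "B y = (SOME B. B \<subseteq> E y \<and> finite B \<and> V.lin_indpt B \<and> V.span B = E y \<and> card B = card Y)"

lemma B:
  assumes "y \<in> Y"
  shows "B y \<subseteq> E y" "finite (B y)" "V.lin_indpt (B y)" "V.span (B y) = E y" "card (B y) = card Y"
proof -
  obtain C where "C \<subseteq> E y" "finite C" "V.lin_indpt C" "V.span C = E y" "card C = card Y"
    using V.subspace_basis[OF V_fin_dim E_subspace[OF assms]] E_dim[OF assms] by metis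
  then have "\<exists>C. C \<subseteq> E y \<and> finite C \<and> V.lin_indpt C \<and> V.span C = E y \<and> card C = card Y" by blast
  from someI_ex[OF this] show "B y \<subseteq> E y" "finite (B y)" "V.lin_indpt (B y)" "V.span (B y) = E y" "card (B y) = card Y"
    unfolding B_def by blast+
qed

text \<open>Chosen in the span of L, so that \<open>joint_act\<close> determines its action on every
  eigenspace: the identity on \<open>E y\<close> and zero on the others.\<close>

definition e where "e y = (SOME X. (X, \<lambda>z. if z = y then 1 else 0) \<in> joint)"

lemma e_joint: "y \<in> Y \<Longrightarrow> (e y, \<lambda>z. if z = y then 1 else 0) \<in> joint"
  unfolding e_def using joint_idempotent by (rule someI_ex)

lemma e_closed [simp]: "y \<in> Y \<Longrightarrow> e y \<in> carrier S"
  using e_joint joint_closed by blast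

lemma e_act:
  assumes "y \<in> Y" "z \<in> Y" "x \<in> E z"
  shows "e y \<otimes>\<^bsub>S\<^esub> x = (if z = y then x else \<zero>\<^bsub>S\<^esub>)"
  using joint_act[OF e_joint[OF assms(1)] assms(2) E_closed[OF assms(2,3)] E_eigen[OF assms(2,3)]]
    E_closed[OF assms(2,3)] by auto

definition BB where "BB = (\<Union>y\<in>Y. B y)"

lemma BB_closed: "BB \<subseteq> carrier S"
  using B(1) E_closed by (fastforce simp: BB_def)

lemma BB_finite: "finite BB"
  using finite_Y B(2) by (auto simp: BB_def)

text \<open>Left multiplication by \<open>e y\<close> projects onto \<open>E y\<close> along the
  other eigenspaces. This is used for the independence of \<open>BB\<close> and again, once
  \<open>BB\<close> spans, to see that \<open>e y\<close> maps S into \<open>E y\<close>.\<close>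

lemma e_lincomb:
  assumes "y \<in> Y"
  shows "e y \<otimes>\<^bsub>S\<^esub> V.lincomb a BB = V.lincomb a (B y)"
proof -
  have BY: "B y \<subseteq> BB" using assms by (auto simp: BB_def)
  have "e y \<otimes>\<^bsub>S\<^esub> V.lincomb a BB = finsum S (\<lambda>v. e y \<otimes>\<^bsub>S\<^esub> (a v \<odot>\<^bsub>S\<^esub> v)) BB"
    unfolding lincomb_eq by (rule S.finsum_rdistr[OF BB_finite]) (use assms BB_closed in auto)
  also have "\<dots> = finsum S (\<lambda>v. if v \<in> B y then a v \<odot>\<^bsub>S\<^esub> v else \<zero>\<^bsub>S\<^esub>) BB"
  proof (rule S.finsum_cong')
    fix v assume v: "v \<in> BB"
    then obtain z where z: "z \<in> Y" "v \<in> B z" by (auto simp: BB_def)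
    have vE: "v \<in> E z" using z B(1) by blast
    have vS: "v \<in> carrier S" using v BB_closed by blast
    have ev: "e y \<otimes>\<^bsub>S\<^esub> v = (if z = y then v else \<zero>\<^bsub>S\<^esub>)" using e_act[OF assms z(1) vE] .
    show "e y \<otimes>\<^bsub>S\<^esub> (a v \<odot>\<^bsub>S\<^esub> v) = (if v \<in> B y then a v \<odot>\<^bsub>S\<^esub> v else \<zero>\<^bsub>S\<^esub>)"
    proof (cases "v \<in> B y")
      case True
      then have "v \<in> E y" using B(1) assms by blast
      then have "e y \<otimes>\<^bsub>S\<^esub> v = v" using e_act[OF assms assms] by simp
      with True vS assms show ?thesis by (simp add: S.smult_mult_right)
    next
      case False
      then have "z \<noteq> y" using z by blast
      with ev False vS assms show ?thesis by (simp add: S.smult_mult_right)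
    qed
  qed (use BB_closed in auto)
  also have "\<dots> = V.lincomb a (B y)"
    unfolding lincomb_eq using BY BB_closed
    by (intro S.add.finprod_mono_neutral_cong_right[OF BB_finite BY]) auto
  finally show ?thesis .
qed

lemma B_disjoint:
  assumes "y \<in> Y" "z \<in> Y" "y \<noteq> z"
  shows "B y \<inter> B z = {}"
proof -
  have "v = \<zero>\<^bsub>S\<^esub>" if "v \<in> B y" "v \<in> B z" for v
  proof -
    have "v \<in> E y" "v \<in> E z" using that B(1) assms(1,2) by blast+
    then show ?thesis
      using e_act[OF assms(1) assms(1), of v] e_act[OF assms(1,2), of v] assms(3) by simp
  qed
  moreover have "\<zero>\<^bsub>S\<^esub> \<notin> B y"
    using V.vs_zero_lin_dep[OF _ B(3)] B(1) E_closed assms(1) by blast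
  ultimately show ?thesis by blast
qed

lemma BB_card: "card BB = card Y * card Y"
proof -
  have "card BB = (\<Sum>y\<in>Y. card (B y))"
    unfolding BB_def using finite_Y B(2) B_disjoint by (intro card_UN_disjoint) auto
  with B(5) show ?thesis by simp
qed

text \<open>Multiplying a relation by \<open>e y\<close> isolates its part in \<open>B y\<close>,
  which is independent.\<close>

lemma BB_indpt: "V.lin_indpt BB"
proof (rule V.finite_lin_indpt2[OF BB_finite BB_closed])
  fix a :: "'b \<Rightarrow> 's" assume a: "V.lincomb a BB = \<zero>\<^bsub>S\<^esub>"
  show "\<forall>v\<in>BB. a v = \<zero>\<^bsub>class_ring\<^esub>"
  proof
    fix v assume "v \<in> BB"
    then obtain y where y: "y \<in> Y" "v \<in> B y" by (auto simp: BB_def)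
    have "V.lincomb a (B y) = \<zero>\<^bsub>S\<^esub>" using e_lincomb[OF y(1), of a] a y(1) by simp
    then have "a \<in> B y \<rightarrow> {\<zero>\<^bsub>class_ring\<^esub>}"
      by (intro V.not_lindepD[OF B(3)[OF y(1)] B(2)[OF y(1)]]) auto
    with y(2) show "a v = \<zero>\<^bsub>class_ring\<^esub>" by auto
  qed
qed

text \<open>There are \<open>card Y * card Y\<close> independent vectors in a space of at most that
  dimension.\<close>

lemma BB_basis: "V.basis BB"
  using V_fin_dim BB_finite BB_closed BB_indpt
  by (rule V.dim_li_is_basis) (use V_dim_le BB_card in simp)

lemma V_dim: "V.dim = card Y * card Y"
  using V.dim_basis[OF BB_finite BB_basis] BB_card by simp

lemma BB_rep:
  assumes "X \<in> carrier S"
  obtains a where "X = V.lincomb a BB"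
proof -
  have "X \<in> V.span BB" using BB_basis assms by (simp add: V.basis_def)
  with V.finite_in_span[OF BB_finite BB_closed] that show ?thesis by blast
qed

lemma e_mult_E: 
  assumes "y \<in> Y" "X \<in> carrier S"
  shows "e y \<otimes>\<^bsub>S\<^esub> X \<in> E y"
proof -
  obtain a where a: "X = V.lincomb a BB" using assms(2) by (rule BB_rep)
  have "V.lincomb a (B y) \<in> V.span (B y)"
    unfolding V.span_def using B(2)[OF assms(1)] by auto
  then show ?thesis using a e_lincomb[OF assms(1)] B(4)[OF assms(1)] by simp
qed

lemma e_E: "y \<in> Y \<Longrightarrow> e y \<in> E y"
  using e_mult_E[of y "\<one>\<^bsub>S\<^esub>"] by simp

text \<open>The sum fixes every vector of the basis \<open>BB\<close> by left multiplication, and 1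
  is a combination of these vectors, so the sum times 1 is 1.\<close>

lemma e_sum: "finsum S e Y = \<one>\<^bsub>S\<^esub>"
proof -
  let ?s = "finsum S e Y"
  have s: "?s \<in> carrier S" by (rule S.finsum_closed) auto
  have b: "?s \<otimes>\<^bsub>S\<^esub> v = v" if v: "v \<in> BB" for v
  proof -
    obtain z where z: "z \<in> Y" "v \<in> B z" using v by (auto simp: BB_def)
    then have vE: "v \<in> E z" using B(1) by blast
    have vS: "v \<in> carrier S" using v BB_closed by blast
    have "?s \<otimes>\<^bsub>S\<^esub> v = finsum S (\<lambda>y. e y \<otimes>\<^bsub>S\<^esub> v) Y"
      by (rule S.finsum_ldistr[OF finite_Y vS]) auto
    also have "\<dots> = finsum S (\<lambda>y. if z = y then v else \<zero>\<^bsub>S\<^esub>) Y"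
      by (rule S.finsum_cong') (use e_act[OF _ z(1) vE] vS in auto)
    also have "\<dots> = v" using S.add.finprod_singleton[OF z(1) finite_Y, of "\<lambda>_. v"] vS by simp
    finally show ?thesis .
  qed
  obtain a where a: "\<one>\<^bsub>S\<^esub> = V.lincomb a BB" using S.one_closed by (rule BB_rep)
  have "?s = ?s \<otimes>\<^bsub>S\<^esub> V.lincomb a BB" using s a[symmetric] by simp
  also have "\<dots> = finsum S (\<lambda>v. ?s \<otimes>\<^bsub>S\<^esub> (a v \<odot>\<^bsub>S\<^esub> v)) BB"
    unfolding lincomb_eq by (rule S.finsum_rdistr[OF BB_finite s]) (use BB_closed in auto)
  also have "\<dots> = finsum S (\<lambda>v. a v \<odot>\<^bsub>S\<^esub> v) BB"
    by (rule S.finsum_cong') (use BB_closed b s in \<open>auto simp: S.smult_mult_right subset_iff\<close>)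
  also have "\<dots> = \<one>\<^bsub>S\<^esub>" using a by (simp add: lincomb_eq)
  finally show ?thesis .
qed

lemma \<tau>_expand:
  assumes "l \<in> L"
  shows "\<tau> l = finsum S (\<lambda>y. \<xi> y l \<odot>\<^bsub>S\<^esub> e y) Y"
proof -
  have "\<tau> l = \<tau> l \<otimes>\<^bsub>S\<^esub> finsum S e Y" using L_carrier[OF assms] by (simp add: e_sum)
  also have "\<dots> = finsum S (\<lambda>y. \<tau> l \<otimes>\<^bsub>S\<^esub> e y) Y"
    by (rule S.finsum_rdistr[OF finite_Y]) (use L_carrier[OF assms] in auto)
  also have "\<dots> = finsum S (\<lambda>y. \<xi> y l \<odot>\<^bsub>S\<^esub> e y) Y"
    by (rule S.finsum_cong') (use assms e_E E_eigen in auto)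
  finally show ?thesis .
qed

end

section \<open>Splitting\<close>

locale simple_eigenspaces = eigenspaces \<iota> A S \<tau> L Y \<xi> E
  for \<iota> :: "'f::field \<Rightarrow> 's::field"
    and A :: "('f, 'a, 'm) module_scheme"
    and S :: "('s, 'b, 'l) module_scheme"
    and \<tau> :: "'a \<Rightarrow> 'b"
    and L :: "'a set" and Y :: "'y set" and \<xi> :: "'y \<Rightarrow> 'a \<Rightarrow> 's" and E :: "'y \<Rightarrow> 'b set" +
  assumes Y_nonempty: "Y \<noteq> {}"
    and S_lin: "X \<in> carrier S \<Longrightarrow> X \<in> lin (carrier A)"
    and A_simple: "ideal J A \<Longrightarrow> J = {\<zero>\<^bsub>A\<^esub>} \<or> J = carrier A"
    and A_central: "z \<in> carrier A \<Longrightarrow> (\<And>x. x \<in> carrier A \<Longrightarrow> z \<otimes>\<^bsub>A\<^esub> x = x \<otimes>\<^bsub>A\<^esub> z) \<Longrightarrow>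
      \<exists>c. z = c \<odot>\<^bsub>A\<^esub> \<one>\<^bsub>A\<^esub>"
begin

lemma card_Y_pos: "card Y > 0"
  using Y_nonempty finite_Y by (simp add: card_gt_0_iff)

lemma B_nonzero:
  assumes "y \<in> Y" "v \<in> B y"
  shows "v \<in> carrier S" "v \<noteq> \<zero>\<^bsub>S\<^esub>"
proof -
  have "B y \<subseteq> carrier S" using B(1)[OF assms(1)] E_closed[OF assms(1)] by blast
  with assms(2) V.vs_zero_lin_dep[OF _ B(3)[OF assms(1)]]
  show "v \<in> carrier S" "v \<noteq> \<zero>\<^bsub>S\<^esub>" by blast+
qed

text \<open>An eigenspace of positive dimension contains a nonzero vector, so the ring cannot be
  trivial.\<close>

lemma one_nonzero: "\<one>\<^bsub>S\<^esub> \<noteq> \<zero>\<^bsub>S\<^esub>"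
proof
  assume 1: "\<one>\<^bsub>S\<^esub> = \<zero>\<^bsub>S\<^esub>"
  obtain y where y: "y \<in> Y" using Y_nonempty by blast
  then obtain v where v: "v \<in> B y" using B(5)[OF y] card_Y_pos by (metis card.empty ex_in_conv less_not_refl)
  have "v = \<one>\<^bsub>S\<^esub> \<otimes>\<^bsub>S\<^esub> v" using B_nonzero[OF y v] by simp
  also have "\<dots> = \<zero>\<^bsub>S\<^esub>" unfolding 1 using B_nonzero[OF y v] by simp
  finally show False using B_nonzero[OF y v] by simp
qed

text \<open>Here \<open>central_simple_ideal\<close> is applied to an arbitrary proper ideal; the
  lemma \<open>faithful\<close> is its application to the zero ideal, which is proper by
  \<open>one_nonzero\<close>.\<close>

lemma S_simple:
  assumes "ideal U S" "\<one>\<^bsub>S\<^esub> \<notin> U" "X \<in> U"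
  shows "X = \<zero>\<^bsub>S\<^esub>"
proof -
  have "X \<in> carrier S" using assms ideal.Icarr by metis
  then obtain I :: "nat set" and a c
    where I: "finite I" "a \<in> I \<rightarrow> carrier A" "indep I c" "X = comb I a c"
    using lin_rep_indep[OF S_lin carrier_subsp] by blast
  have "\<forall>i\<in>I. a i = \<zero>\<^bsub>A\<^esub>"
    by (rule central_simple_ideal[OF A_simple A_central assms(1,2) I(1-3)]) (use I assms(3) in auto)
  then have "comb I a c = \<zero>\<^bsub>S\<^esub>" by (intro comb_zero) simp
  with I show ?thesis by simp
qed

lemma zero_ideal: "ideal {\<zero>\<^bsub>S\<^esub>} S"
  by (rule S.zeroideal)

lemma faithful: 
  assumes "V \<subseteq> carrier A"
  shows "faithful V"
  unfolding faithful_def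
proof (intro allI impI)
  fix I :: "nat set" and a c
  assume I: "finite I" "a \<in> I \<rightarrow> V" "indep I c" "comb I a c = \<zero>\<^bsub>S\<^esub>"
  show "\<forall>i\<in>I. a i = \<zero>\<^bsub>A\<^esub>"
    by (rule central_simple_ideal[OF A_simple A_central zero_ideal _ I(1) _ I(3)])
      (use I assms one_nonzero in auto)
qed

lemma \<tau>_inj: "a \<in> carrier A \<Longrightarrow> \<tau> a = \<zero>\<^bsub>S\<^esub> \<Longrightarrow> a = \<zero>\<^bsub>A\<^esub>"
proof -
  assume a: "a \<in> carrier A" "\<tau> a = \<zero>\<^bsub>S\<^esub>"
  have "indep {0::nat} (\<lambda>_. 1)" by (simp add: indep_def)
  moreover have "comb {0::nat} (\<lambda>_. a) (\<lambda>_. 1) = \<zero>\<^bsub>S\<^esub>"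
    using a by (simp add: comb_insert)
  ultimately show ?thesis
    using faithful[OF subset_refl, unfolded faithful_def, rule_format, of "{0}" "\<lambda>_. a" "\<lambda>_. 1" 0] a by auto
qed

lemma \<tau>_eqD:
  assumes "a \<in> carrier A" "b \<in> carrier A" "\<tau> a = \<tau> b"
  shows "a = b"
proof -
  have "\<tau> (a \<ominus>\<^bsub>A\<^esub> b) = \<zero>\<^bsub>S\<^esub>"
    using assms by (simp add: A.minus_eq \<tau>_add \<tau>_minus S.r_neg)
  then have "a \<ominus>\<^bsub>A\<^esub> b = \<zero>\<^bsub>A\<^esub>" using assms by (intro \<tau>_inj) auto
  then show ?thesis using assms by simp
qed

section \<open>The matrix representation on a single eigenspace\<close>

definition y0 where "y0 = (SOME y. y \<in> Y)"

lemma y0: "y0 \<in> Y"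
  unfolding y0_def using Y_nonempty some_in_eq by blast

abbreviation "B0 \<equiv> B y0"

lemmas B0 = B[OF y0]

lemma B0_closed: "B0 \<subseteq> carrier S"
  using B_nonzero[OF y0] by blast

text \<open>Coordinates with respect to \<open>B0\<close>. The values outside \<open>B0\<close> are
  arbitrary, so every lemma about \<open>crd\<close> evaluates it at basis vectors.\<close>

definition crd where "crd x = (SOME a. V.lincomb a B0 = x)"

lemma lincomb_crd: "x \<in> E y0 \<Longrightarrow> V.lincomb (crd x) B0 = x"
proof -
  assume "x \<in> E y0"
  then have "x \<in> V.span B0" using B0(4) by simp
  then have "\<exists>a. V.lincomb a B0 = x"
    using V.finite_in_span[OF B0(2) B0_closed] by blast
  then show ?thesis unfolding crd_def by (rule someI_ex)
qed

lemma lincomb_E0: "V.lincomb a B0 \<in> E y0"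
  unfolding B0(4)[symmetric] V.span_def using B0(2) by auto

lemma crd_eq:
  assumes "V.lincomb a B0 = x" "v \<in> B0"
  shows "crd x v = a v"
proof -
  have "V.lincomb (\<lambda>v. crd x v \<ominus>\<^bsub>class_ring\<^esub> a v) B0 = V.lincomb (crd x) B0 \<ominus>\<^bsub>S\<^esub> V.lincomb a B0"
    by (rule V.lincomb_diff[OF B0(2) B0_closed]) auto
  also have "\<dots> = \<zero>\<^bsub>S\<^esub>"
    using lincomb_crd[of x] lincomb_E0[of a] assms(1) E_closed[OF y0] by (simp add: S.minus_eq S.r_neg)
  finally have "(\<lambda>v. crd x v \<ominus>\<^bsub>class_ring\<^esub> a v) \<in> B0 \<rightarrow> {\<zero>\<^bsub>class_ring\<^esub>}"
    by (intro V.not_lindepD[OF B0(3) B0(2)]) auto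
  with assms(2) show ?thesis by (auto simp: class_ring_simps)
qed

lemma crd_add:
  assumes "x \<in> E y0" "x' \<in> E y0" "v \<in> B0"
  shows "crd (x \<oplus>\<^bsub>S\<^esub> x') v = crd x v + crd x' v"
proof -
  have "V.lincomb (\<lambda>v. crd x v + crd x' v) B0 = x \<oplus>\<^bsub>S\<^esub> x'"
    using V.lincomb_sum[OF B0(2) B0_closed, of "crd x" "crd x'"] assms by (simp add: lincomb_crd)
  from crd_eq[OF this assms(3)] show ?thesis .
qed

lemma crd_smult:
  assumes "x \<in> E y0" "v \<in> B0"
  shows "crd (c \<odot>\<^bsub>S\<^esub> x) v = c * crd x v"
proof -
  have "V.lincomb (\<lambda>v. c * crd x v) B0 = c \<odot>\<^bsub>S\<^esub> x"
    using V.lincomb_smult[OF B0_closed, of "crd x" c] assms by (simp add: lincomb_crd)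
  from crd_eq[OF this assms(2)] show ?thesis .
qed

lemma crd_finsum:
  assumes "finite I" "g \<in> I \<rightarrow> E y0" "v \<in> B0"
  shows "finsum S g I \<in> E y0" "crd (finsum S g I) v = (\<Sum>i\<in>I. crd (g i) v)"
proof -
  have "finsum S g I \<in> E y0 \<and> crd (finsum S g I) v = (\<Sum>i\<in>I. crd (g i) v)"
    using assms(1,2)
  proof (induction I rule: finite_induct)
    case empty
    have "crd (0 \<odot>\<^bsub>S\<^esub> \<zero>\<^bsub>S\<^esub>) v = 0"
      using crd_smult[OF E_zero[OF y0] assms(3), of 0] by simp
    then show ?case using E_zero[OF y0] by simp
  next
    case (insert i I)
    then have "g i \<in> E y0" "g \<in> I \<rightarrow> E y0" by auto
    moreover from this have "g i \<in> carrier S" "g \<in> I \<rightarrow> carrier S" using E_closed[OF y0] by auto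
    ultimately show ?case using insert by (simp add: E_add[OF y0] crd_add[OF _ _ assms(3)])
  qed
  then show "finsum S g I \<in> E y0" "crd (finsum S g I) v = (\<Sum>i\<in>I. crd (g i) v)" by auto
qed

lemma crd_basis:
  assumes "v \<in> B0" "w \<in> B0"
  shows "crd v w = (if w = v then 1 else 0)"
proof -
  have "V.lincomb (\<lambda>w. if w = v then 1 else 0) B0 = finsum S (\<lambda>w. if v = w then w else \<zero>\<^bsub>S\<^esub>) B0"
    unfolding lincomb_eq by (rule S.finsum_cong') (use B0_closed in auto)
  also have "\<dots> = v"
    using S.add.finprod_singleton[OF assms(1) B0(2), of "\<lambda>w. w"] B0_closed by auto
  finally show ?thesis using crd_eq assms(2) by simp
qed

definition enum :: "nat \<Rightarrow> 'b" where
  "enum = (SOME w. bij_betw w {..<card Y} B0)"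

lemma enum: "bij_betw enum {..<card Y} B0"
proof -
  have "\<exists>w. bij_betw w {..<card Y} B0"
    using ex_bij_betw_nat_finite[OF B0(2)] by (simp add: B0(5) lessThan_atLeast0)
  then show ?thesis unfolding enum_def by (rule someI_ex)
qed

lemma enum_B0: "i < card Y \<Longrightarrow> enum i \<in> B0"
  using enum by (auto simp: bij_betw_def)

text \<open>Right multiplication on one of the eigenspaces, with row vectors as coordinates.\<close>

definition rmat :: "'b \<Rightarrow> 's mat" where
  "rmat X = mat (card Y) (card Y) (\<lambda>(i, j). crd (enum i \<otimes>\<^bsub>S\<^esub> X) (enum j))"

lemma enum_E: "i < card Y \<Longrightarrow> enum i \<in> E y0"
  using enum_B0 B0(1) by blast

lemma enum_mult_E: "i < card Y \<Longrightarrow> X \<in> carrier S \<Longrightarrow> enum i \<otimes>\<^bsub>S\<^esub> X \<in> E y0"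
  using enum_E E_mult[OF y0] by blast

lemma rmat_carrier [simp]: "rmat X \<in> carrier_mat (card Y) (card Y)"
  by (simp add: rmat_def)

text \<open>Right multiplication by a product acts first by X and then by X'. With rows as
  coordinates this is the matrix product in the same order, so \<open>rmat\<close> is a homomorphism
  and not an antihomomorphism.\<close>

lemma rmat_mult:
  assumes "X \<in> carrier S" "X' \<in> carrier S"
  shows "rmat (X \<otimes>\<^bsub>S\<^esub> X') = rmat X * rmat X'"
proof (rule eq_matI)
  fix i k assume "i < dim_row (rmat X * rmat X')" "k < dim_col (rmat X * rmat X')"
  then have i: "i < card Y" and k: "k < card Y" by (simp_all add: rmat_def)
  let ?x = "enum i \<otimes>\<^bsub>S\<^esub> X"
  have x: "?x \<in> E y0" "?x \<in> carrier S" using enum_mult_E[OF i assms(1)] E_closed[OF y0] by auto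
  have e: "enum i \<in> carrier S" using enum_E[OF i] E_closed[OF y0] by auto
  have vX': "v \<otimes>\<^bsub>S\<^esub> X' \<in> E y0" "v \<in> carrier S" if "v \<in> B0" for v
    using that B0(1) B0_closed E_mult[OF y0 _ assms(2)] by auto
  have "enum i \<otimes>\<^bsub>S\<^esub> (X \<otimes>\<^bsub>S\<^esub> X') = V.lincomb (crd ?x) B0 \<otimes>\<^bsub>S\<^esub> X'"
    using assms e by (simp add: lincomb_crd[OF x(1)] S.m_assoc)
  also have "\<dots> = finsum S (\<lambda>v. (crd ?x v \<odot>\<^bsub>S\<^esub> v) \<otimes>\<^bsub>S\<^esub> X') B0"
    unfolding lincomb_eq by (rule S.finsum_ldistr[OF B0(2) assms(2)]) (use B0_closed in auto)
  also have "\<dots> = finsum S (\<lambda>v. crd ?x v \<odot>\<^bsub>S\<^esub> (v \<otimes>\<^bsub>S\<^esub> X')) B0"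
    by (rule S.finsum_cong') (use vX' assms(2) in \<open>auto simp: S.smult_mult_left\<close>)
  finally have eq: "enum i \<otimes>\<^bsub>S\<^esub> (X \<otimes>\<^bsub>S\<^esub> X') = finsum S (\<lambda>v. crd ?x v \<odot>\<^bsub>S\<^esub> (v \<otimes>\<^bsub>S\<^esub> X')) B0" .
  have "crd (enum i \<otimes>\<^bsub>S\<^esub> (X \<otimes>\<^bsub>S\<^esub> X')) (enum k) = (\<Sum>v\<in>B0. crd (crd ?x v \<odot>\<^bsub>S\<^esub> (v \<otimes>\<^bsub>S\<^esub> X')) (enum k))"
    unfolding eq by (rule crd_finsum(2)[OF B0(2) _ enum_B0[OF k]]) (use vX' E_smult[OF y0] in auto)
  also have "\<dots> = (\<Sum>v\<in>B0. crd ?x v * crd (v \<otimes>\<^bsub>S\<^esub> X') (enum k))"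
    by (rule sum.cong) (use vX' in \<open>auto simp: crd_smult[OF _ enum_B0[OF k]]\<close>)
  also have "\<dots> = (\<Sum>j<card Y. crd ?x (enum j) * crd (enum j \<otimes>\<^bsub>S\<^esub> X') (enum k))"
    by (rule sum.reindex_bij_betw[OF enum, symmetric])
  finally show "rmat (X \<otimes>\<^bsub>S\<^esub> X') $$ (i, k) = (rmat X * rmat X') $$ (i, k)"
    using i k by (simp add: rmat_def scalar_prod_def lessThan_atLeast0)
qed (simp_all add: rmat_def)

lemma rmat_add:
  assumes "X \<in> carrier S" "X' \<in> carrier S"
  shows "rmat (X \<oplus>\<^bsub>S\<^esub> X') = rmat X + rmat X'"
proof (rule eq_matI)
  fix i k assume "i < dim_row (rmat X + rmat X')" "k < dim_col (rmat X + rmat X')"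
  then have i: "i < card Y" and k: "k < card Y" by (simp_all add: rmat_def)
  have e: "enum i \<in> carrier S" using enum_E[OF i] E_closed[OF y0] by auto
  have "crd (enum i \<otimes>\<^bsub>S\<^esub> (X \<oplus>\<^bsub>S\<^esub> X')) (enum k) = crd (enum i \<otimes>\<^bsub>S\<^esub> X) (enum k) + crd (enum i \<otimes>\<^bsub>S\<^esub> X') (enum k)"
    using e assms by (simp add: S.r_distr crd_add[OF enum_mult_E[OF i] enum_mult_E[OF i] enum_B0[OF k]])
  with i k show "rmat (X \<oplus>\<^bsub>S\<^esub> X') $$ (i, k) = (rmat X + rmat X') $$ (i, k)"
    by (simp add: rmat_def)
qed (simp_all add: rmat_def)

lemma rmat_smult:
  assumes "X \<in> carrier S"
  shows "rmat (c \<odot>\<^bsub>S\<^esub> X) = c \<cdot>\<^sub>m rmat X"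
proof (rule eq_matI)
  fix i k assume "i < dim_row (c \<cdot>\<^sub>m rmat X)" "k < dim_col (c \<cdot>\<^sub>m rmat X)"
  then have i: "i < card Y" and k: "k < card Y" by (simp_all add: rmat_def)
  have e: "enum i \<in> carrier S" using enum_E[OF i] E_closed[OF y0] by auto
  have "crd (enum i \<otimes>\<^bsub>S\<^esub> (c \<odot>\<^bsub>S\<^esub> X)) (enum k) = c * crd (enum i \<otimes>\<^bsub>S\<^esub> X) (enum k)"
    using e assms by (simp add: S.smult_mult_right crd_smult[OF enum_mult_E[OF i] enum_B0[OF k]])
  with i k show "rmat (c \<odot>\<^bsub>S\<^esub> X) $$ (i, k) = (c \<cdot>\<^sub>m rmat X) $$ (i, k)"
    by (simp add: rmat_def)
qed (simp_all add: rmat_def)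

lemma rmat_one: "rmat \<one>\<^bsub>S\<^esub> = 1\<^sub>m (card Y)"
proof (rule eq_matI)
  fix i k assume "i < dim_row (1\<^sub>m (card Y))" "k < dim_col (1\<^sub>m (card Y))"
  then have i: "i < card Y" and k: "k < card Y" by simp_all
  have e: "enum i \<in> carrier S" using enum_E[OF i] E_closed[OF y0] by auto
  have "enum k = enum i \<longleftrightarrow> k = i"
    using enum i k by (auto simp: bij_betw_def inj_on_def)
  with i k e show "rmat \<one>\<^bsub>S\<^esub> $$ (i, k) = 1\<^sub>m (card Y) $$ (i, k)"
    by (auto simp: rmat_def crd_basis enum_B0)
qed (simp_all add: rmat_def)

text \<open>The right annihilator of \<open>E y0\<close> is a two-sided ideal because
  \<open>E y0\<close> is stable under right multiplication. It does not contain 1 since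
  \<open>E y0\<close> is nonzero, so simplicity makes it zero.\<close>

lemma rmat_eq_zero:
  assumes X: "X \<in> carrier S" and "rmat X = 0\<^sub>m (card Y) (card Y)"
  shows "X = \<zero>\<^bsub>S\<^esub>"
proof -
  let ?U = "{X \<in> carrier S. \<forall>x\<in>E y0. x \<otimes>\<^bsub>S\<^esub> X = \<zero>\<^bsub>S\<^esub>}"
  note Ec = E_closed[OF y0] and Em = E_mult[OF y0]
  have "ideal ?U S"
  proof (rule idealI)
    show "subgroup ?U (add_monoid S)"
      by (rule S.add.subgroupI) (use Ec in \<open>auto simp: S.r_distr S.r_minus\<close>)
  next
    fix u x assume u: "u \<in> ?U" and x: "x \<in> carrier S"
    have "z \<otimes>\<^bsub>S\<^esub> (x \<otimes>\<^bsub>S\<^esub> u) = (z \<otimes>\<^bsub>S\<^esub> x) \<otimes>\<^bsub>S\<^esub> u" if "z \<in> E y0" for z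
      using that u x Ec by (simp add: S.m_assoc)
    then have "\<forall>z\<in>E y0. z \<otimes>\<^bsub>S\<^esub> (x \<otimes>\<^bsub>S\<^esub> u) = \<zero>\<^bsub>S\<^esub>" using u x Em by simp
    with u x show "x \<otimes>\<^bsub>S\<^esub> u \<in> ?U" by simp
    have "z \<otimes>\<^bsub>S\<^esub> (u \<otimes>\<^bsub>S\<^esub> x) = (z \<otimes>\<^bsub>S\<^esub> u) \<otimes>\<^bsub>S\<^esub> x" if "z \<in> E y0" for z
      using that u x Ec by (intro S.m_assoc[symmetric]) auto
    then have "\<forall>z\<in>E y0. z \<otimes>\<^bsub>S\<^esub> (u \<otimes>\<^bsub>S\<^esub> x) = \<zero>\<^bsub>S\<^esub>" using u x by simp
    with u x show "u \<otimes>\<^bsub>S\<^esub> x \<in> ?U" by simp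
  qed (rule S.ring_axioms)
  moreover have "\<one>\<^bsub>S\<^esub> \<notin> ?U"
  proof
    assume "\<one>\<^bsub>S\<^esub> \<in> ?U"
    then have "enum 0 \<otimes>\<^bsub>S\<^esub> \<one>\<^bsub>S\<^esub> = \<zero>\<^bsub>S\<^esub>" using enum_E[OF card_Y_pos] by blast
    then show False using B_nonzero[OF y0 enum_B0[OF card_Y_pos]] by simp
  qed
  moreover have "X \<in> ?U"
  proof (intro CollectI conjI ballI X)
    have enum0: "v \<otimes>\<^bsub>S\<^esub> X = \<zero>\<^bsub>S\<^esub>" if v: "v \<in> B0" for v
    proof -
      obtain i where i: "i < card Y" "v = enum i" using v enum by (auto simp: bij_betw_def)
      have "crd (v \<otimes>\<^bsub>S\<^esub> X) w = 0" if w: "w \<in> B0" for w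
      proof -
        obtain j where j: "j < card Y" "w = enum j" using w enum by (auto simp: bij_betw_def)
        have "rmat X $$ (i, j) = 0" using assms(2) i j by simp
        then show ?thesis using i j by (simp add: rmat_def)
      qed
      then have "V.lincomb (crd (v \<otimes>\<^bsub>S\<^esub> X)) B0 = \<zero>\<^bsub>S\<^esub>"
        by (intro V.lincomb_zero[OF B0_closed]) auto
      then show ?thesis using lincomb_crd[OF enum_mult_E[OF i(1) X]] i(2) by simp
    qed
    fix x assume x: "x \<in> E y0"
    have "x \<otimes>\<^bsub>S\<^esub> X = V.lincomb (crd x) B0 \<otimes>\<^bsub>S\<^esub> X" using lincomb_crd[OF x] by simp
    also have "\<dots> = finsum S (\<lambda>v. (crd x v \<odot>\<^bsub>S\<^esub> v) \<otimes>\<^bsub>S\<^esub> X) B0"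
      unfolding lincomb_eq by (rule S.finsum_ldistr[OF B0(2) X]) (use B0_closed in auto)
    also have "\<dots> = \<zero>\<^bsub>S\<^esub>"
      by (rule S.add.finprod_one_eqI) (use X B0_closed enum0 in \<open>auto simp: S.smult_mult_left subset_iff\<close>)
    finally show "x \<otimes>\<^bsub>S\<^esub> X = \<zero>\<^bsub>S\<^esub>" .
  qed
  ultimately show ?thesis by (rule S_simple)
qed

lemma rmat_inj: "inj_on rmat (carrier S)"
proof (rule inj_onI)
  fix X X' assume X: "X \<in> carrier S" "X' \<in> carrier S" "rmat X = rmat X'"
  have dims: "dim_row (rmat X') = card Y" "dim_col (rmat X') = card Y" by (simp_all add: rmat_def)
  have "rmat (X \<oplus>\<^bsub>S\<^esub> (-1) \<odot>\<^bsub>S\<^esub> X') = rmat X' + (-1) \<cdot>\<^sub>m rmat X'"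
    using X by (simp add: rmat_add rmat_smult)
  also have "\<dots> = 0\<^sub>m (card Y) (card Y)" by (rule eq_matI) (simp_all add: dims)
  finally have "X \<oplus>\<^bsub>S\<^esub> (-1) \<odot>\<^bsub>S\<^esub> X' = \<zero>\<^bsub>S\<^esub>" using X by (intro rmat_eq_zero) auto
  then show "X = X'" using X by (simp add: S.scal_minus S.minus_eq[symmetric])
qed

text \<open>A dimension count: matrices are read row by row as vectors of length \<open>?n\<close>,
  and an injective linear map from S, whose dimension is also \<open>?n\<close>, has full
  rank.\<close>

lemma rmat_surj:
  assumes M: "M \<in> carrier_mat (card Y) (card Y)"
  shows "\<exists>X\<in>carrier S. rmat X = M"
proof -
  let ?N = "card Y"
  let ?n = "?N * ?N"
  let ?W = "module_vec TYPE('s) ?n"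
  define pack where "pack M = vec ?n (\<lambda>k. M $$ (k div ?N, k mod ?N))" for M :: "'s mat"
  have ij: "k div ?N < ?N" "k mod ?N < ?N" if "k < ?n" for k
    using that card_Y_pos by (auto simp: less_mult_imp_div_less)
  have pack_inj: "M = M'" if "M \<in> carrier_mat ?N ?N" "M' \<in> carrier_mat ?N ?N" "pack M = pack M'" for M M'
  proof (rule eq_matI)
    fix i j assume "i < dim_row M'" "j < dim_col M'"
    with that(2) have lt: "i < ?N" "j < ?N" by auto
    then have "i * ?N + j < Suc i * ?N" by simp
    also have "\<dots> \<le> ?n" using lt by (intro mult_le_mono1) simp
    finally have k: "i * ?N + j < ?n" .
    have "pack M $ (i * ?N + j) = pack M' $ (i * ?N + j)" using that(3) by simp
    with k lt show "M $$ (i, j) = M' $$ (i, j)" by (simp add: pack_def)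
  qed (use that in auto)
  interpret W: vec_space "TYPE('s)" ?n .
  let ?T = "\<lambda>X. pack (rmat X)"
  have T: "linear_map class_ring S ?W ?T"
  proof -
    have "mod_hom class_ring S ?W ?T"
    proof (intro mod_hom.intro mod_hom_axioms.intro)
      show "module class_ring S" by (rule V.module_axioms)
      show "module class_ring ?W" by (rule W.module_axioms)
      show "?T \<in> LinearCombinations.module_hom class_ring S ?W"
        unfolding LinearCombinations.module_hom_def
        by (auto simp: module_vec_def pack_def rmat_add rmat_smult ij
            intro!: eq_vecI) (auto simp: rmat_def ij)
    qed
    then show ?thesis
      by (intro linear_map.intro V.vectorspace_axioms W.vectorspace_axioms)
  qed
  interpret T: linear_map class_ring S ?W ?T by (rule T)
  have inj: "inj_on ?T (carrier S)"
    using rmat_inj pack_inj[OF rmat_carrier rmat_carrier] by (auto simp: inj_on_def)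
  have "vectorspace.dim class_ring (?W\<lparr>carrier := T.imT\<rparr>) = ?n"
    using T.rank_nullity[OF V_fin_dim] T.inj_imp_dim_ker0[OF inj] V_dim by simp
  moreover obtain C where C: "C \<subseteq> T.imT" "finite C" "W.lin_indpt C" "W.span C = T.imT"
    "card C = vectorspace.dim class_ring (?W\<lparr>carrier := T.imT\<rparr>)"
    using W.subspace_basis[OF W.fin_dim T.imT_is_subspace] by blast
  ultimately have "W.basis C"
    using T.imT_is_subspace
    by (intro W.dim_li_is_basis) (auto simp: W.dim_is_n subspace_def submodule_def)
  then have "T.imT = carrier_vec ?n" using C by (simp add: W.basis_def)
  moreover have "pack M \<in> carrier_vec ?n" by (simp add: pack_def)
  ultimately obtain X where "X \<in> carrier S" "pack M = ?T X" by (auto simp: T.im_def)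
  then show ?thesis using pack_inj[OF M rmat_carrier] by metis
qed

lemma rmat_alg_iso: "rmat \<in> alg_iso S (module_mat TYPE('s) (card Y) (card Y))"
proof -
  have "rmat \<in> Ring.ring_hom S (module_mat TYPE('s) (card Y) (card Y))"
    by (rule ring_hom_memI) (auto simp: module_mat_simps rmat_mult rmat_add rmat_one)
  moreover note rmat_inj
  moreover have "rmat ` carrier S = carrier_mat (card Y) (card Y)"
    using rmat_surj by (auto simp: image_iff)
  ultimately show ?thesis
    by (simp add: alg_iso_def alg_hom_def bij_betw_def module_mat_simps rmat_smult)
qed

end

section \<open>Quadrics\<close>

text \<open>An isotropic subset that is maximal for inclusion meets every orbit of \<phi>: if it
  contained neither \<open>y\<close> nor \<open>\<phi> y\<close>, then \<open>y\<close> could be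
  added. Being isotropic, it contains only one element of each orbit.\<close>

lemma transversal:
  assumes "finite Y" "\<And>y. y \<in> Y \<Longrightarrow> \<phi> y \<in> Y" "\<And>y. y \<in> Y \<Longrightarrow> \<phi> (\<phi> y) = y" "\<And>y. y \<in> Y \<Longrightarrow> \<phi> y \<noteq> y"
  obtains R where "isotropic_subset \<phi> Y R" "isotropic_subset \<phi> Y (\<phi> ` R)" "Y = R \<union> \<phi> ` R" "R \<inter> \<phi> ` R = {}" "inj_on \<phi> R"
proof -
  let ?P = "{R. isotropic_subset \<phi> Y R}"
  have fin: "finite ?P"
    by (rule finite_subset[of _ "Pow Y"]) (use assms(1) in \<open>auto simp: isotropic_subset_def\<close>)
  have "{} \<in> ?P" by (simp add: isotropic_subset_def)
  from finite_has_maximal2[OF fin this]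
  obtain R where R: "R \<in> ?P" "\<forall>R'\<in>?P. R \<subseteq> R' \<longrightarrow> R = R'"
    by (elim bexE conjE)
  have RY: "R \<subseteq> Y" and iso: "\<And>y. y \<in> R \<Longrightarrow> \<phi> y \<notin> R" using R(1) by (auto simp: isotropic_subset_def)
  have cover: "y \<in> R \<or> \<phi> y \<in> R" if y: "y \<in> Y" for y
  proof (rule ccontr)
    assume n: "\<not> (y \<in> R \<or> \<phi> y \<in> R)"
    have "insert y R \<in> ?P"
      unfolding isotropic_subset_def
    proof (intro CollectI conjI ballI notI)
      show "insert y R \<subseteq> Y" using y RY by simp
      fix z assume z: "z \<in> Y" "{z, \<phi> z} \<subseteq> insert y R"
      then consider "z = y" | "\<phi> z = y" "z \<noteq> y" | "z \<in> R" "\<phi> z \<in> R" by auto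
      then show False
      proof cases
        case 1
        then show False using z n assms(4)[OF y] by auto
      next
        case 2
        then have "z = \<phi> y" using assms(3) z(1) by metis
        then show False using z n 2 by auto
      next
        case 3
        then show False using iso by blast
      qed
    qed
    from R(2)[rule_format, OF this] n show False by auto
  qed
  have "Y = R \<union> \<phi> ` R"
  proof
    show "Y \<subseteq> R \<union> \<phi> ` R"
    proof
      fix y assume y: "y \<in> Y"
      show "y \<in> R \<union> \<phi> ` R"
        using cover[OF y] assms(3)[OF y] by (metis UnI1 UnI2 imageI)
    qed
  qed (use RY assms(2) in auto)
  moreover have "R \<inter> \<phi> ` R = {}" using iso by auto
  moreover have "isotropic_subset \<phi> Y (\<phi> ` R)"
    unfolding isotropic_subset_def
  proof (intro conjI ballI notI)
    show "\<phi> ` R \<subseteq> Y" using RY assms(2) by auto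
    fix y assume y: "y \<in> Y" "{y, \<phi> y} \<subseteq> \<phi> ` R"
    then obtain u v where u: "u \<in> R" "y = \<phi> u" and v: "v \<in> R" "\<phi> y = \<phi> v" by auto
    have "y = v" using v y RY assms(3) by (metis subsetD)
    then show False using iso u v by auto
  qed
  moreover have "inj_on \<phi> R" using RY assms(3) by (metis inj_onI subsetD)
  ultimately show ?thesis using R(1) that by blast
qed

text \<open>\<open>T\<close> and \<open>f\<close> stand for the reduced trace and the form over
  \<open>F\<^sub>s\<close>; \<open>f\<close> is additive on symmetric elements only. The set
  \<open>J\<close> of the last assumption stands for the linear variety spanned by the points of
  R.\<close>

locale quadric_eigenspaces = eigenspaces \<iota> A S \<tau> L Y \<xi> E
  for \<iota> :: "'f::field \<Rightarrow> 's::field"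
    and A :: "('f, 'a, 'm) module_scheme"
    and S :: "('s, 'b, 'l) module_scheme"
    and \<tau> :: "'a \<Rightarrow> 'b"
    and L :: "'a set" and Y :: "'y set" and \<xi> :: "'y \<Rightarrow> 'a \<Rightarrow> 's" and E :: "'y \<Rightarrow> 'b set" +
  fixes \<sigma> :: "'b \<Rightarrow> 'b" and T f :: "'b \<Rightarrow> 's" and \<phi> :: "'y \<Rightarrow> 'y"
  assumes \<sigma>_closed [simp]: "X \<in> carrier S \<Longrightarrow> \<sigma> X \<in> carrier S"
    and \<sigma>_\<sigma> [simp]: "X \<in> carrier S \<Longrightarrow> \<sigma> (\<sigma> X) = X"
    and \<sigma>_add: "X \<in> carrier S \<Longrightarrow> Z \<in> carrier S \<Longrightarrow> \<sigma> (X \<oplus>\<^bsub>S\<^esub> Z) = \<sigma> X \<oplus>\<^bsub>S\<^esub> \<sigma> Z"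
    and \<sigma>_mult: "X \<in> carrier S \<Longrightarrow> Z \<in> carrier S \<Longrightarrow> \<sigma> (X \<otimes>\<^bsub>S\<^esub> Z) = \<sigma> Z \<otimes>\<^bsub>S\<^esub> \<sigma> X"
    and \<sigma>_smult: "X \<in> carrier S \<Longrightarrow> \<sigma> (c \<odot>\<^bsub>S\<^esub> X) = c \<odot>\<^bsub>S\<^esub> \<sigma> X"
    and T_add: "X \<in> carrier S \<Longrightarrow> Z \<in> carrier S \<Longrightarrow> T (X \<oplus>\<^bsub>S\<^esub> Z) = T X + T Z"
    and T_smult: "X \<in> carrier S \<Longrightarrow> T (c \<odot>\<^bsub>S\<^esub> X) = c * T X"
    and T_mult: "X \<in> carrier S \<Longrightarrow> Z \<in> carrier S \<Longrightarrow> T (X \<otimes>\<^bsub>S\<^esub> Z) = T (Z \<otimes>\<^bsub>S\<^esub> X)"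
    and T_\<sigma>: "X \<in> carrier S \<Longrightarrow> T (\<sigma> X) = T X"
    and f_add: "X \<in> carrier S \<Longrightarrow> \<sigma> X = X \<Longrightarrow> Z \<in> carrier S \<Longrightarrow> \<sigma> Z = Z \<Longrightarrow> f (X \<oplus>\<^bsub>S\<^esub> Z) = f X + f Z"
    and f_trace: "X \<in> carrier S \<Longrightarrow> f (X \<oplus>\<^bsub>S\<^esub> \<sigma> X) = T X"
    and \<phi>_closed [simp]: "y \<in> Y \<Longrightarrow> \<phi> y \<in> Y"
    and \<phi>_\<phi> [simp]: "y \<in> Y \<Longrightarrow> \<phi> (\<phi> y) = y"
    and \<phi>_fixfree: "y \<in> Y \<Longrightarrow> \<phi> y \<noteq> y"
    and isotropic: "isotropic_subset \<phi> Y R \<Longrightarrow> \<exists>J. (\<forall>z\<in>R. E z \<subseteq> J) \<and> J \<subseteq> carrier S \<and>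
      \<zero>\<^bsub>S\<^esub> \<in> J \<and> (\<forall>x\<in>J. \<forall>x'\<in>J. x \<oplus>\<^bsub>S\<^esub> x' \<in> J) \<and> (\<forall>x\<in>J. \<forall>r\<in>carrier S. x \<otimes>\<^bsub>S\<^esub> r \<in> J) \<and>
      (\<forall>x\<in>J. \<forall>x'\<in>J. \<sigma> x \<otimes>\<^bsub>S\<^esub> x' = \<zero>\<^bsub>S\<^esub>) \<and> (\<forall>x\<in>J. \<sigma> x = x \<longrightarrow> f x = 0)"
begin

lemma \<sigma>_one: "\<sigma> \<one>\<^bsub>S\<^esub> = \<one>\<^bsub>S\<^esub>"
proof -
  have "\<one>\<^bsub>S\<^esub> = \<sigma> (\<one>\<^bsub>S\<^esub> \<otimes>\<^bsub>S\<^esub> \<sigma> \<one>\<^bsub>S\<^esub>)" by simp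
  also have "\<dots> = \<sigma> (\<sigma> \<one>\<^bsub>S\<^esub>) \<otimes>\<^bsub>S\<^esub> \<sigma> \<one>\<^bsub>S\<^esub>" by (rule \<sigma>_mult) auto
  finally show ?thesis by simp
qed

lemma \<sigma>_zero: "\<sigma> \<zero>\<^bsub>S\<^esub> = \<zero>\<^bsub>S\<^esub>"
  using \<sigma>_smult[of "\<zero>\<^bsub>S\<^esub>" 0] by simp

lemma \<sigma>_finsum:
  "finite I \<Longrightarrow> g \<in> I \<rightarrow> carrier S \<Longrightarrow> \<sigma> (finsum S g I) = finsum S (\<lambda>i. \<sigma> (g i)) I"
proof (induction I rule: finite_induct)
  case (insert i I)
  then have "g i \<in> carrier S" "g \<in> I \<rightarrow> carrier S" by auto
  moreover from this(2) have "(\<lambda>i. \<sigma> (g i)) \<in> I \<rightarrow> carrier S" by (intro Pi_I \<sigma>_closed) (rule Pi_mem)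
  moreover note insert
  ultimately show ?case by (simp add: \<sigma>_add)
qed (simp add: \<sigma>_zero)

lemma T_finsum:
  "finite I \<Longrightarrow> g \<in> I \<rightarrow> carrier S \<Longrightarrow> T (finsum S g I) = (\<Sum>i\<in>I. T (g i))"
proof (induction I rule: finite_induct)
  case empty
  show ?case using T_smult[of "\<zero>\<^bsub>S\<^esub>" 0] by simp
next
  case (insert i I)
  then have "g i \<in> carrier S" "g \<in> I \<rightarrow> carrier S" by auto
  with insert show ?case by (simp add: T_add)
qed

text \<open>The case \<open>z = y\<close> is included: a singleton is isotropic because \<phi> has
  no fixed points.\<close>

lemma \<sigma>_e_mult_e:
  assumes "y \<in> Y" "z \<in> Y" "z \<noteq> \<phi> y"
  shows "\<sigma> (e y) \<otimes>\<^bsub>S\<^esub> e z = \<zero>\<^bsub>S\<^esub>"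
proof -
  have "isotropic_subset \<phi> Y {y, z}"
    unfolding isotropic_subset_def
  proof (intro conjI ballI notI)
    fix x assume "x \<in> Y" "{x, \<phi> x} \<subseteq> {y, z}"
    then show False using assms \<phi>_fixfree \<phi>_\<phi> by (metis insert_iff insert_subset singletonD)
  qed (use assms in auto)
  with isotropic[OF this] show ?thesis using e_E assms by (metis insertCI subsetD)
qed

text \<open>Both sides equal \<open>\<sigma> (e y) \<otimes> e (\<phi> y)\<close>: multiply
  \<open>\<sigma> (e y)\<close> on the right by 1 = \<Sum> \<open>e z\<close>, and
  \<open>e (\<phi> y)\<close> on the left by 1 = \<sigma>(1) = \<Sum> \<open>\<sigma> (e z)\<close>.
  In each sum \<open>\<sigma>_e_mult_e\<close> leaves a single term.\<close>

lemma \<sigma>_e: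
  assumes y: "y \<in> Y"
  shows "\<sigma> (e y) = e (\<phi> y)"
proof -
  have "\<sigma> (e y) = \<sigma> (e y) \<otimes>\<^bsub>S\<^esub> finsum S e Y" using y by (simp add: e_sum)
  also have "\<dots> = finsum S (\<lambda>z. \<sigma> (e y) \<otimes>\<^bsub>S\<^esub> e z) Y"
    by (rule S.finsum_rdistr[OF finite_Y]) (use y in auto)
  also have "\<dots> = finsum S (\<lambda>z. if \<phi> y = z then \<sigma> (e y) \<otimes>\<^bsub>S\<^esub> e z else \<zero>\<^bsub>S\<^esub>) Y"
    by (rule S.finsum_cong') (use y \<sigma>_e_mult_e in auto)
  also have "\<dots> = \<sigma> (e y) \<otimes>\<^bsub>S\<^esub> e (\<phi> y)"
    by (rule S.add.finprod_singleton) (use y finite_Y in auto)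
  finally have 1: "\<sigma> (e y) = \<sigma> (e y) \<otimes>\<^bsub>S\<^esub> e (\<phi> y)" .
  have "e (\<phi> y) = \<sigma> (finsum S e Y) \<otimes>\<^bsub>S\<^esub> e (\<phi> y)" using y by (simp add: e_sum \<sigma>_one)
  also have "\<sigma> (finsum S e Y) = finsum S (\<lambda>z. \<sigma> (e z)) Y" by (rule \<sigma>_finsum[OF finite_Y]) auto
  also have "\<dots> \<otimes>\<^bsub>S\<^esub> e (\<phi> y) = finsum S (\<lambda>z. \<sigma> (e z) \<otimes>\<^bsub>S\<^esub> e (\<phi> y)) Y"
    by (rule S.finsum_ldistr[OF finite_Y]) (use y in auto)
  also have "\<dots> = finsum S (\<lambda>z. if y = z then \<sigma> (e z) \<otimes>\<^bsub>S\<^esub> e (\<phi> y) else \<zero>\<^bsub>S\<^esub>) Y"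
  proof (rule S.finsum_cong')
    fix z assume z: "z \<in> Y"
    show "\<sigma> (e z) \<otimes>\<^bsub>S\<^esub> e (\<phi> y) = (if y = z then \<sigma> (e z) \<otimes>\<^bsub>S\<^esub> e (\<phi> y) else \<zero>\<^bsub>S\<^esub>)"
    proof (cases "y = z")
      case False
      then have "\<phi> y \<noteq> \<phi> z" using y z \<phi>_\<phi> by metis
      then show ?thesis using \<sigma>_e_mult_e[OF z, of "\<phi> y"] y False by simp
    qed simp
  qed (use y in auto)
  also have "\<dots> = \<sigma> (e y) \<otimes>\<^bsub>S\<^esub> e (\<phi> y)"
    by (rule S.add.finprod_singleton) (use y finite_Y in auto)
  finally show ?thesis using 1 by simp
qed

lemma \<phi>_bij: "bij_betw \<phi> Y Y"
  by (rule bij_betwI[of _ _ _ \<phi>]) auto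

text \<open>Expand \<open>\<tau> l\<close> in the idempotents, move each \<open>e y\<close> to
  \<open>e (\<phi> y)\<close> and reindex the sum. With \<open>k\<close> the image of
  \<open>l\<close> under the involution of L, this is the compatibility of the two
  involutions.\<close>

lemma \<sigma>_\<tau>:
  assumes "k \<in> L" "l \<in> L" "\<And>y. y \<in> Y \<Longrightarrow> \<xi> (\<phi> y) l = \<xi> y k"
  shows "\<sigma> (\<tau> l) = \<tau> k"
proof -
  have "\<sigma> (\<tau> l) = finsum S (\<lambda>y. \<sigma> (\<xi> y l \<odot>\<^bsub>S\<^esub> e y)) Y"
    unfolding \<tau>_expand[OF assms(2)] by (rule \<sigma>_finsum[OF finite_Y]) auto
  also have "\<dots> = finsum S (\<lambda>y. \<xi> (\<phi> y) k \<odot>\<^bsub>S\<^esub> e (\<phi> y)) Y"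
    by (rule S.finsum_cong') (use assms(3)[symmetric] in \<open>auto simp: \<sigma>_smult \<sigma>_e\<close>)
  also have "\<dots> = finsum S (\<lambda>y. \<xi> y k \<odot>\<^bsub>S\<^esub> e y) (\<phi> ` Y)"
    by (rule S.finsum_reindex[symmetric]) (use \<phi>_bij in \<open>auto simp: bij_betw_def\<close>)
  also have "\<phi> ` Y = Y" using \<phi>_bij by (simp add: bij_betw_def)
  finally show ?thesis using \<tau>_expand[OF assms(1)] by simp
qed

text \<open>With \<open>e\<^sub>1\<close> the sum of the idempotents over a set of representatives of the orbits of \<open>\<phi>\<close>
  and \<open>e\<^sub>2 = \<sigma>(e\<^sub>1) = 1 - e\<^sub>1\<close>, a symmetric \<open>X\<close> is the sum of \<open>e\<^sub>1Xe\<^sub>1 + \<sigma>(e\<^sub>1Xe\<^sub>1)\<close> and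
  of the symmetric elements \<open>e\<^sub>1Xe\<^sub>2\<close>, \<open>e\<^sub>2Xe\<^sub>1\<close> of isotropic ideals.\<close>

lemma f_eq_T:
  assumes l: "l \<in> L" "\<And>y. y \<in> Y \<Longrightarrow> \<xi> y l + \<xi> (\<phi> y) l = 1"
    and X: "X \<in> carrier S" "\<sigma> X = X"
  shows "f X = T (\<tau> l \<otimes>\<^bsub>S\<^esub> X)"
proof -
  obtain R where R: "isotropic_subset \<phi> Y R" "isotropic_subset \<phi> Y (\<phi> ` R)"
    "Y = R \<union> \<phi> ` R" "R \<inter> \<phi> ` R = {}" "inj_on \<phi> R"
    using transversal[of Y \<phi>] finite_Y \<phi>_fixfree by auto
  have RY: "R \<subseteq> Y" "\<phi> ` R \<subseteq> Y" using R(1,2) by (simp_all add: isotropic_subset_def)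
  have finR: "finite R" using RY(1) finite_Y by (rule finite_subset)
  have cl: "e \<in> R \<rightarrow> carrier S" "e \<in> \<phi> ` R \<rightarrow> carrier S" using RY by (auto intro!: e_closed)
  define e1 where "e1 = finsum S e R"
  define e2 where "e2 = finsum S e (\<phi> ` R)"
  have e12 [simp]: "e1 \<in> carrier S" "e2 \<in> carrier S"
    unfolding e1_def e2_def using cl by (auto intro: S.finsum_closed)
  have sum: "e1 \<oplus>\<^bsub>S\<^esub> e2 = \<one>\<^bsub>S\<^esub>"
  proof -
    have "finsum S e (R \<union> \<phi> ` R) = e1 \<oplus>\<^bsub>S\<^esub> e2"
      unfolding e1_def e2_def by (rule S.finsum_Un_disjoint[OF finR finite_imageI[OF finR] R(4) cl])
    then show ?thesis by (simp add: R(3)[symmetric] e_sum)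
  qed
  have \<sigma>1: "\<sigma> e1 = e2"
  proof -
    have "\<sigma> e1 = finsum S (\<lambda>y. \<sigma> (e y)) R" unfolding e1_def by (rule \<sigma>_finsum[OF finR cl(1)])
    also have "\<dots> = finsum S (\<lambda>y. e (\<phi> y)) R"
      by (rule S.finsum_cong') (use RY \<sigma>_e in auto)
    also have "\<dots> = e2" unfolding e2_def by (rule S.finsum_reindex[symmetric]) (use cl R(5) in auto)
    finally show ?thesis .
  qed
  then have \<sigma>2: "\<sigma> e2 = e1" by (metis \<sigma>_\<sigma> e12(1))
  have sub: "\<exists>J. finsum S e Z \<in> J \<and> (\<forall>x\<in>J. \<forall>r\<in>carrier S. x \<otimes>\<^bsub>S\<^esub> r \<in> J) \<and>
      (\<forall>x\<in>J. \<forall>x'\<in>J. \<sigma> x \<otimes>\<^bsub>S\<^esub> x' = \<zero>\<^bsub>S\<^esub>) \<and> (\<forall>x\<in>J. \<sigma> x = x \<longrightarrow> f x = 0)"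
    if Z: "isotropic_subset \<phi> Y Z" for Z
  proof -
    obtain J where J: "\<forall>z\<in>Z. E z \<subseteq> J" "J \<subseteq> carrier S"
      "\<zero>\<^bsub>S\<^esub> \<in> J" "\<forall>x\<in>J. \<forall>x'\<in>J. x \<oplus>\<^bsub>S\<^esub> x' \<in> J" "\<forall>x\<in>J. \<forall>r\<in>carrier S. x \<otimes>\<^bsub>S\<^esub> r \<in> J"
      "\<forall>x\<in>J. \<forall>x'\<in>J. \<sigma> x \<otimes>\<^bsub>S\<^esub> x' = \<zero>\<^bsub>S\<^esub>" "\<forall>x\<in>J. \<sigma> x = x \<longrightarrow> f x = 0"
      using isotropic[OF Z] by blast
    have ZY: "Z \<subseteq> Y" using Z by (simp add: isotropic_subset_def)
    then have "finite Z" using finite_Y finite_subset by blast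
    then have "finsum S e Z \<in> J" using ZY J(1)
    proof (induction Z rule: finite_induct)
      case (insert z Z)
      then have "e z \<in> J" "e z \<in> carrier S" "e \<in> Z \<rightarrow> carrier S" using e_E by auto
      with insert J(4) show ?case by simp
    qed (use J(3) in simp)
    with J show ?thesis by blast
  qed
  obtain J1 where J1: "e1 \<in> J1" "\<forall>x\<in>J1. \<forall>r\<in>carrier S. x \<otimes>\<^bsub>S\<^esub> r \<in> J1"
    "\<forall>x\<in>J1. \<sigma> x = x \<longrightarrow> f x = 0" using sub[OF R(1)] unfolding e1_def by blast
  obtain J2 where J2: "e2 \<in> J2" "\<forall>x\<in>J2. \<forall>r\<in>carrier S. x \<otimes>\<^bsub>S\<^esub> r \<in> J2"
    "\<forall>x\<in>J2. \<forall>x'\<in>J2. \<sigma> x \<otimes>\<^bsub>S\<^esub> x' = \<zero>\<^bsub>S\<^esub>" "\<forall>x\<in>J2. \<sigma> x = x \<longrightarrow> f x = 0"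
    using sub[OF R(2)] unfolding e2_def by blast
  \<comment> \<open>Isotropy of \<open>J2\<close> gives \<sigma>(e2) e2 = 0, and \<sigma>(e2) is
    e1.\<close>
  have e1e2: "e1 \<otimes>\<^bsub>S\<^esub> e2 = \<zero>\<^bsub>S\<^esub>" using J2(1,3) \<sigma>2 by metis
  have "e1 = e1 \<otimes>\<^bsub>S\<^esub> (e1 \<oplus>\<^bsub>S\<^esub> e2)" by (simp add: sum)
  also have "\<dots> = e1 \<otimes>\<^bsub>S\<^esub> e1" by (simp add: S.r_distr e1e2)
  finally have e11: "e1 \<otimes>\<^bsub>S\<^esub> e1 = e1" by simp
  define P where "P a b = a \<otimes>\<^bsub>S\<^esub> (X \<otimes>\<^bsub>S\<^esub> b)" for a b
  have P [simp]: "P a b \<in> carrier S" if "a \<in> carrier S" "b \<in> carrier S" for a b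
    using that X by (simp add: P_def)
  have \<sigma>P: "\<sigma> (P a b) = P (\<sigma> b) (\<sigma> a)" if "a \<in> carrier S" "b \<in> carrier S" for a b
    using that X by (simp add: P_def \<sigma>_mult S.m_assoc)
  \<comment> \<open>The four blocks are grouped so that each summand is symmetric, as additivity of
    f requires: \<sigma> exchanges the two diagonal blocks and fixes each of the other two.\<close>
  have "X = (e1 \<oplus>\<^bsub>S\<^esub> e2) \<otimes>\<^bsub>S\<^esub> (X \<otimes>\<^bsub>S\<^esub> (e1 \<oplus>\<^bsub>S\<^esub> e2))" using X by (simp add: sum)
  also have "\<dots> = (P e1 e1 \<oplus>\<^bsub>S\<^esub> P e2 e2) \<oplus>\<^bsub>S\<^esub> (P e1 e2 \<oplus>\<^bsub>S\<^esub> P e2 e1)"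
    using X by (simp add: P_def S.l_distr S.r_distr S.a_ac)
  finally have "f X = f ((P e1 e1 \<oplus>\<^bsub>S\<^esub> P e2 e2) \<oplus>\<^bsub>S\<^esub> (P e1 e2 \<oplus>\<^bsub>S\<^esub> P e2 e1))" by simp
  also have "\<dots> = f (P e1 e1 \<oplus>\<^bsub>S\<^esub> P e2 e2) + (f (P e1 e2) + f (P e2 e1))"
    by (simp add: f_add \<sigma>_add \<sigma>P \<sigma>1 \<sigma>2 S.a_comm)
  also have "f (P e1 e2) = 0"
  proof (rule J1(3)[rule_format])
    show "P e1 e2 \<in> J1" unfolding P_def by (rule J1(2)[rule_format, OF J1(1)]) (use X in simp)
    show "\<sigma> (P e1 e2) = P e1 e2" by (simp add: \<sigma>P \<sigma>1 \<sigma>2)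
  qed
  also have "f (P e2 e1) = 0"
  proof (rule J2(4)[rule_format])
    show "P e2 e1 \<in> J2" unfolding P_def by (rule J2(2)[rule_format, OF J2(1)]) (use X in simp)
    show "\<sigma> (P e2 e1) = P e2 e1" by (simp add: \<sigma>P \<sigma>1 \<sigma>2)
  qed
  also have "f (P e1 e1 \<oplus>\<^bsub>S\<^esub> P e2 e2) = T (P e1 e1)"
    using f_trace[of "P e1 e1"] by (simp add: \<sigma>P \<sigma>1)
  also have "T (P e1 e1) = T ((X \<otimes>\<^bsub>S\<^esub> e1) \<otimes>\<^bsub>S\<^esub> e1)"
    using X unfolding P_def by (intro T_mult) auto
  also have "\<dots> = T (e1 \<otimes>\<^bsub>S\<^esub> X)"
    using X T_mult[of X e1] by (simp add: S.m_assoc e11)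
  finally have 1: "f X = T (e1 \<otimes>\<^bsub>S\<^esub> X)" by simp
  \<comment> \<open>It remains to replace e1 by \<open>\<tau> l\<close>. The traces of
    \<open>e y\<close> and \<open>e (\<phi> y)\<close> against the symmetric X agree, and the values
    of l on an orbit add up to 1, so each orbit contributes the trace of one representative.\<close>
  have Te: "T (e (\<phi> y) \<otimes>\<^bsub>S\<^esub> X) = T (e y \<otimes>\<^bsub>S\<^esub> X)" if "y \<in> Y" for y
  proof -
    have "T (e (\<phi> y) \<otimes>\<^bsub>S\<^esub> X) = T (\<sigma> (e (\<phi> y) \<otimes>\<^bsub>S\<^esub> X))" using that X by (simp add: T_\<sigma>)
    also have "\<dots> = T (X \<otimes>\<^bsub>S\<^esub> e y)" using that X by (simp add: \<sigma>_mult \<sigma>_e)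
    also have "\<dots> = T (e y \<otimes>\<^bsub>S\<^esub> X)" using that X by (intro T_mult) auto
    finally show ?thesis .
  qed
  have "\<tau> l \<otimes>\<^bsub>S\<^esub> X = finsum S (\<lambda>y. (\<xi> y l \<odot>\<^bsub>S\<^esub> e y) \<otimes>\<^bsub>S\<^esub> X) Y"
    unfolding \<tau>_expand[OF l(1)] by (rule S.finsum_ldistr[OF finite_Y X(1)]) auto
  then have "T (\<tau> l \<otimes>\<^bsub>S\<^esub> X) = (\<Sum>y\<in>Y. T ((\<xi> y l \<odot>\<^bsub>S\<^esub> e y) \<otimes>\<^bsub>S\<^esub> X))"
    using X by (simp add: T_finsum[OF finite_Y] Pi_def)
  also have "\<dots> = (\<Sum>y\<in>Y. \<xi> y l * T (e y \<otimes>\<^bsub>S\<^esub> X))"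
    by (rule sum.cong) (use X in \<open>auto simp: S.smult_mult_left T_smult\<close>)
  also have "\<dots> = (\<Sum>y\<in>R. \<xi> y l * T (e y \<otimes>\<^bsub>S\<^esub> X)) + (\<Sum>y\<in>\<phi> ` R. \<xi> y l * T (e y \<otimes>\<^bsub>S\<^esub> X))"
    by (subst R(3)) (rule sum.union_disjoint[OF finR finite_imageI[OF finR] R(4)])
  also have "(\<Sum>y\<in>\<phi> ` R. \<xi> y l * T (e y \<otimes>\<^bsub>S\<^esub> X)) = (\<Sum>y\<in>R. \<xi> (\<phi> y) l * T (e (\<phi> y) \<otimes>\<^bsub>S\<^esub> X))"
    by (rule sum.reindex[OF R(5), unfolded o_def])
  also have "(\<Sum>y\<in>R. \<xi> y l * T (e y \<otimes>\<^bsub>S\<^esub> X)) + \<dots> = (\<Sum>y\<in>R. (\<xi> y l + \<xi> (\<phi> y) l) * T (e y \<otimes>\<^bsub>S\<^esub> X))"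
    unfolding sum.distrib[symmetric]
    by (rule sum.cong) (use Te RY in \<open>auto simp: distrib_right\<close>)
  also have "\<dots> = (\<Sum>y\<in>R. T (e y \<otimes>\<^bsub>S\<^esub> X))"
    by (rule sum.cong) (use l(2) RY in auto)
  also have "\<dots> = T (finsum S (\<lambda>y. e y \<otimes>\<^bsub>S\<^esub> X) R)"
    by (rule T_finsum[symmetric, OF finR]) (use X RY in auto)
  also have "finsum S (\<lambda>y. e y \<otimes>\<^bsub>S\<^esub> X) R = e1 \<otimes>\<^bsub>S\<^esub> X"
    unfolding e1_def by (rule S.finsum_ldistr[symmetric, OF finR X(1) cl(1)])
  finally show ?thesis using 1 by simp
qed

end

section \<open>Scalar extension as a base change\<close>

context field_extension_alg
begin

lemma base_change_AS: "base_change \<iota> A AS (\<lambda>a. tensor \<iota> A a 1)"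
proof -
  interpret AS: assoc_alg AS by (rule AS_assoc_alg)
  show ?thesis
  proof (intro base_change.intro base_change_axioms.intro)
    show "field_hom \<iota>" by (rule field_hom_axioms)
    show "assoc_alg A" by (rule A.assoc_alg_axioms)
    show "assoc_alg AS" by (rule AS_assoc_alg)
  qed (simp_all add: tensor_add_left tensor_mult tensor_one_one tensor_smult AS_smult_tensor)
qed

sublocale AS: base_change \<iota> A AS "\<lambda>a. tensor \<iota> A a 1"
  by (rule base_change_AS)

lemma tensor_eq_smult: "a \<in> carrier A \<Longrightarrow> tensor \<iota> A a c = c \<odot>\<^bsub>AS\<^esub> tensor \<iota> A a 1"
  by (simp add: AS_smult_tensor)

lemma AS_lin: "X \<in> carrier AS \<Longrightarrow> X \<in> AS.lin (carrier A)"
proof (induction X rule: AS_induct)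
  case zero
  show ?case by (rule AS.lin_zero)
next
  case (tensor a c)
  show ?case
    unfolding tensor_eq_smult[OF tensor, of c] by (rule AS.lin_single[OF tensor AS.carrier_subsp])
next
  case (diff X Y)
  then have "X \<oplus>\<^bsub>AS\<^esub> (-1) \<odot>\<^bsub>AS\<^esub> Y \<in> AS.lin (carrier A)"
    by (intro AS.lin_add AS.lin_smult AS.carrier_subsp)
  with diff show ?case by (simp add: AS.S.scal_minus AS.S.minus_eq)
qed

text \<open>The images of a basis of A generate over \<open>F\<^sub>s\<close>, which bounds the
  dimension of \<open>A\<^sub>s\<close> from above; that it is not smaller follows from the
  eigenspaces.\<close>

lemma AS_generators:
  assumes "vectorspace.fin_dim class_ring A"
  shows "\<exists>G. finite G \<and> card G \<le> vectorspace.dim class_ring A \<and> G \<subseteq> carrier AS \<and>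
    LinearCombinations.module.span class_ring AS G = carrier AS"
proof -
  interpret VA: vectorspace class_ring A by (rule A.vectorspace_class)
  interpret VS: vectorspace class_ring AS by (rule AS.S.vectorspace_class)
  obtain \<beta> where \<beta>: "finite \<beta>" "VA.basis \<beta>" using VA.finite_basis_exists[OF assms] by blast
  then have \<beta>A: "\<beta> \<subseteq> carrier A" "VA.span \<beta> = carrier A" by (auto simp: VA.basis_def)
  let ?\<tau> = "\<lambda>a. tensor \<iota> A a 1"
  let ?G = "?\<tau> ` \<beta>"
  have GS: "?G \<subseteq> carrier AS" using \<beta>A by auto
  interpret W: submodule class_ring "VS.span ?G" AS by (rule VS.span_is_submodule[OF GS])
  have smultW: "c \<odot>\<^bsub>AS\<^esub> x \<in> VS.span ?G" if "x \<in> VS.span ?G" for c x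
    using W.smult_closed[of c x] that by simp
  have zeroW: "\<zero>\<^bsub>AS\<^esub> \<in> VS.span ?G" by (rule VS.span_zero)
  have addW: "x \<oplus>\<^bsub>AS\<^esub> x' \<in> VS.span ?G" if "x \<in> VS.span ?G" "x' \<in> VS.span ?G" for x x'
    by (rule VS.span_add1[OF GS that])
  have comb: "?\<tau> (finsum A (\<lambda>b. k b \<odot> b) C) \<in> VS.span ?G" if "C \<subseteq> \<beta>" for k C
  proof -
    have "finite C" using that \<beta>(1) finite_subset by blast
    then show ?thesis using that
    proof (induction C rule: finite_induct)
      case empty
      then show ?case using zeroW AS.\<tau>_zero by simp
    next
      case (insert b C)
      then have b: "b \<in> carrier A" "(\<lambda>b. k b \<odot> b) \<in> C \<rightarrow> carrier A" "b \<in> \<beta>" using \<beta>A by auto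
      have "?\<tau> (finsum A (\<lambda>b. k b \<odot> b) (insert b C)) =
          \<iota> (k b) \<odot>\<^bsub>AS\<^esub> ?\<tau> b \<oplus>\<^bsub>AS\<^esub> ?\<tau> (finsum A (\<lambda>b. k b \<odot> b) C)"
        using insert b by (simp add: AS.\<tau>_add AS.\<tau>_smult)
      also have "\<dots> \<in> VS.span ?G"
        using insert b VS.span_mem[OF GS, of "?\<tau> b"] by (intro addW smultW) auto
      finally show ?case .
    qed
  qed
  have \<tau>W: "?\<tau> a \<in> VS.span ?G" if a: "a \<in> carrier A" for a
  proof -
    obtain k where "VA.lincomb k \<beta> = a"
      using VA.finite_in_span[OF \<beta>(1) \<beta>A(1), of a] a \<beta>A(2) by auto
    then show ?thesis using comb[OF subset_refl, of k] by (simp add: VA.lincomb_def)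
  qed
  have "X \<in> VS.span ?G" if X: "X \<in> carrier AS" for X
    using AS_lin[OF X] AS.carrier_subsp
  proof (induction X rule: AS.lin_induct)
    case (step X a c)
    then show ?case by (intro addW smultW \<tau>W)
  qed (rule zeroW)
  then have "VS.span ?G = carrier AS" using VS.span_is_subset2[OF GS] by blast
  moreover have "card ?G \<le> VA.dim"
    using card_image_le[OF \<beta>(1)] VA.dim_basis[OF \<beta>] by simp
  ultimately show ?thesis by (intro exI[of _ ?G] conjI finite_imageI \<beta>(1) GS)
qed

text \<open>An explicit representative of a combination in the free group. It contains no trace of
  the ambient algebra, so for coefficients in L it is the same in
  \<open>L \<otimes> F\<^sub>s\<close> and in \<open>A \<otimes> F\<^sub>s\<close>.\<close>

lemma comb_cls:
  "finite I \<Longrightarrow> a \<in> I \<rightarrow> carrier A \<Longrightarrow>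
    (\<Sum>i\<in>I. frag_of (a i, c i)) \<in> carrier P \<and> AS.comb I a c = cls (\<Sum>i\<in>I. frag_of (a i, c i))"
proof (induction I rule: finite_induct)
  case empty
  then show ?case by (simp add: pair_zero_closed cls_0)
next
  case (insert i I)
  then have a: "a i \<in> carrier A" "a \<in> I \<rightarrow> carrier A" by auto
  then have "AS.comb (insert i I) a c = tensor \<iota> A (a i) (c i) \<oplus>\<^bsub>AS\<^esub> AS.comb I a c"
    using insert tensor_eq_smult[OF a(1), of "c i"] by (simp add: AS.comb_insert)
  with insert a show ?case
    by (simp add: tensor_cls cls_add pair_of_closed pair_add_closed)
qed

lemma cls_eq_zero: "p \<in> carrier P \<Longrightarrow> cls p = \<zero>\<^bsub>AS\<^esub> \<longleftrightarrow> p \<in> T"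
  using cls_eq_iff[of p 0] by (simp add: cls_0 pair_zero_closed)

lemma galois_ext_tensor:
  assumes "\<gamma> \<in> carrier (Gal \<iota>)" "a \<in> carrier A"
  shows "galois_ext \<iota> A \<gamma> (tensor \<iota> A a c) = tensor \<iota> A a (\<gamma> c)"
proof -
  from assms(1) interpret g: field_hom \<gamma> by (simp add: Gal_def)
  show ?thesis
    unfolding galois_ext_def
    by (rule tensor_map_tensor) (use assms in \<open>auto simp: Gal_def g.hom_add g.hom_mult\<close>)
qed

section \<open>The involution and the form on symmetric elements over
  \<open>F\<^sub>s\<close>\<close>

context
  fixes \<sigma> :: "'a \<Rightarrow> 'a"
  assumes \<sigma>: "linear_involution A \<sigma>"
begin

abbreviation "\<Sigma> \<equiv> map_ext \<iota> A \<sigma>"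

lemma \<sigma>_simps:
  "a \<in> carrier A \<Longrightarrow> \<sigma> a \<in> carrier A" "a \<in> carrier A \<Longrightarrow> \<sigma> (\<sigma> a) = a"
  "a \<in> carrier A \<Longrightarrow> b \<in> carrier A \<Longrightarrow> \<sigma> (a \<oplus> b) = \<sigma> a \<oplus> \<sigma> b"
  "a \<in> carrier A \<Longrightarrow> b \<in> carrier A \<Longrightarrow> \<sigma> (a \<otimes> b) = \<sigma> b \<otimes> \<sigma> a"
  "a \<in> carrier A \<Longrightarrow> \<sigma> (k \<odot> a) = k \<odot> \<sigma> a"
  using \<sigma> by (auto simp: linear_involution_def)

lemma \<Sigma>_closed: "X \<in> carrier AS \<Longrightarrow> \<Sigma> X \<in> carrier AS"
  unfolding map_ext_def by (rule tensor_map_closed) (simp_all add: \<sigma>_simps)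

lemma \<Sigma>_add: "X \<in> carrier AS \<Longrightarrow> Z \<in> carrier AS \<Longrightarrow> \<Sigma> (X \<oplus>\<^bsub>AS\<^esub> Z) = \<Sigma> X \<oplus>\<^bsub>AS\<^esub> \<Sigma> Z"
  unfolding map_ext_def by (rule tensor_map_add) (simp_all add: \<sigma>_simps)

lemma \<Sigma>_tensor: "a \<in> carrier A \<Longrightarrow> \<Sigma> (tensor \<iota> A a c) = tensor \<iota> A (\<sigma> a) c"
  unfolding map_ext_def by (rule tensor_map_tensor) (simp_all add: \<sigma>_simps)

lemma \<Sigma>_zero: "\<Sigma> \<zero>\<^bsub>AS\<^esub> = \<zero>\<^bsub>AS\<^esub>"
proof -
  have "\<Sigma> \<zero>\<^bsub>AS\<^esub> \<oplus>\<^bsub>AS\<^esub> \<Sigma> \<zero>\<^bsub>AS\<^esub> = \<Sigma> \<zero>\<^bsub>AS\<^esub>" using \<Sigma>_add[of "\<zero>\<^bsub>AS\<^esub>" "\<zero>\<^bsub>AS\<^esub>"] by simp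
  then show ?thesis using \<Sigma>_closed[of "\<zero>\<^bsub>AS\<^esub>"] by simp
qed

lemma \<Sigma>_step:
  assumes "a \<in> carrier A" "X \<in> carrier AS"
  shows "\<Sigma> (c \<odot>\<^bsub>AS\<^esub> tensor \<iota> A a 1 \<oplus>\<^bsub>AS\<^esub> X) = c \<odot>\<^bsub>AS\<^esub> tensor \<iota> A (\<sigma> a) 1 \<oplus>\<^bsub>AS\<^esub> \<Sigma> X"
  using assms by (simp add: \<Sigma>_add AS_smult_tensor \<Sigma>_tensor \<sigma>_simps)

lemma \<Sigma>_smult:
  assumes "X \<in> carrier AS"
  shows "\<Sigma> (d \<odot>\<^bsub>AS\<^esub> X) = d \<odot>\<^bsub>AS\<^esub> \<Sigma> X"
  using AS_lin[OF assms] AS.carrier_subsp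
proof (induction X rule: AS.lin_induct)
  case (step X a c)
  then show ?case
    by (simp add: \<Sigma>_step \<Sigma>_closed \<sigma>_simps AS.S.scal_r_distr AS.S.scal_scal)
qed (simp add: \<Sigma>_zero)

lemma \<Sigma>_\<Sigma>:
  assumes "X \<in> carrier AS"
  shows "\<Sigma> (\<Sigma> X) = X"
  using AS_lin[OF assms] AS.carrier_subsp
proof (induction X rule: AS.lin_induct)
  case (step X a c)
  then show ?case by (simp add: \<Sigma>_step \<Sigma>_closed \<sigma>_simps)
qed (simp add: \<Sigma>_zero)

lemma \<Sigma>_mult:
  assumes "X \<in> carrier AS" "Z \<in> carrier AS"
  shows "\<Sigma> (X \<otimes>\<^bsub>AS\<^esub> Z) = \<Sigma> Z \<otimes>\<^bsub>AS\<^esub> \<Sigma> X"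
  using AS_lin[OF assms(1)] AS.carrier_subsp
proof (induction X rule: AS.lin_induct)
  case zero
  then show ?case using assms(2) by (simp add: \<Sigma>_zero \<Sigma>_closed)
next
  case (step X a c)
  have single: "\<Sigma> (tensor \<iota> A a 1 \<otimes>\<^bsub>AS\<^esub> Z) = \<Sigma> Z \<otimes>\<^bsub>AS\<^esub> tensor \<iota> A (\<sigma> a) 1"
    using AS_lin[OF assms(2)] AS.carrier_subsp
  proof (induction Z rule: AS.lin_induct)
    case zero
    then show ?case using step by (simp add: \<Sigma>_zero \<sigma>_simps)
  next
    case (step Z b d)
    have "tensor \<iota> A a 1 \<otimes>\<^bsub>AS\<^esub> (d \<odot>\<^bsub>AS\<^esub> tensor \<iota> A b 1 \<oplus>\<^bsub>AS\<^esub> Z) =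
        d \<odot>\<^bsub>AS\<^esub> tensor \<iota> A (a \<otimes> b) 1 \<oplus>\<^bsub>AS\<^esub> tensor \<iota> A a 1 \<otimes>\<^bsub>AS\<^esub> Z"
      using step \<open>a \<in> carrier A\<close> by (simp add: AS.S.r_distr AS.S.smult_mult_right tensor_mult)
    then show ?case using step \<open>a \<in> carrier A\<close>
      by (simp add: \<Sigma>_step \<Sigma>_closed \<sigma>_simps AS.S.l_distr AS.S.smult_mult_left tensor_mult)
  qed
  have "(c \<odot>\<^bsub>AS\<^esub> tensor \<iota> A a 1 \<oplus>\<^bsub>AS\<^esub> X) \<otimes>\<^bsub>AS\<^esub> Z =
      c \<odot>\<^bsub>AS\<^esub> (tensor \<iota> A a 1 \<otimes>\<^bsub>AS\<^esub> Z) \<oplus>\<^bsub>AS\<^esub> X \<otimes>\<^bsub>AS\<^esub> Z"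
    using step assms(2) by (simp add: AS.S.l_distr AS.S.smult_mult_left)
  then show ?case using step assms(2)
    by (simp add: \<Sigma>_add \<Sigma>_smult single \<Sigma>_step \<Sigma>_closed \<sigma>_simps AS.S.r_distr AS.S.smult_mult_right
        \<Sigma>_tensor)
qed

lemma Sym_subsp: "AS.subsp (Sym A \<sigma>)"
  using \<sigma>_simps(5)[of "\<zero>" 0] by (auto simp: AS.subsp_def Sym_def \<sigma>_simps)

text \<open>Write X with coefficients independent over F. If X is symmetric, the combination of the
  differences \<open>a i - \<sigma> (a i)\<close> vanishes, and faithfulness makes every
  \<open>a i\<close> symmetric. No division by 2 occurs.\<close>

lemma Sym_ext:
  assumes faithful: "AS.faithful (carrier A)"
  shows "Sym AS \<Sigma> = AS.lin (Sym A \<sigma>)"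
proof
  show "AS.lin (Sym A \<sigma>) \<subseteq> Sym AS \<Sigma>"
  proof
    fix X assume "X \<in> AS.lin (Sym A \<sigma>)"
    then show "X \<in> Sym AS \<Sigma>" using Sym_subsp
    proof (induction X rule: AS.lin_induct)
      case (step X a c)
      then show ?case by (simp add: Sym_def \<Sigma>_step)
    qed (simp add: Sym_def \<Sigma>_zero)
  qed
  show "Sym AS \<Sigma> \<subseteq> AS.lin (Sym A \<sigma>)"
  proof
    fix X assume X: "X \<in> Sym AS \<Sigma>"
    then have "X \<in> AS.lin (carrier A)" by (simp add: Sym_def AS_lin)
    then obtain I :: "nat set" and a c
      where I: "finite I" "a \<in> I \<rightarrow> carrier A" "AS.indep I c" "X = AS.comb I a c"
      using AS.lin_rep_indep[OF _ AS.carrier_subsp] by blast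
    have \<sigma>a: "(\<lambda>i. \<sigma> (a i)) \<in> I \<rightarrow> carrier A" using I(2) \<sigma>_simps by auto
    have comb: "\<Sigma> (AS.comb J a c) = AS.comb J (\<lambda>i. \<sigma> (a i)) c"
      if "finite J" "a \<in> J \<rightarrow> carrier A" for J
      using that
    proof (induction J rule: finite_induct)
      case (insert i J)
      then have "a i \<in> carrier A" "a \<in> J \<rightarrow> carrier A" by auto
      moreover have "(\<lambda>i. \<sigma> (a i)) \<in> insert i J \<rightarrow> carrier A"
        by (intro Pi_I \<sigma>_simps(1)) (use insert.prems in auto)
      moreover note insert
      ultimately show ?case by (simp add: AS.comb_insert \<Sigma>_step)
    qed (simp add: \<Sigma>_zero)
    define d where "d i = a i \<oplus> (-1) \<odot> \<sigma> (a i)" for i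
    have d: "d \<in> I \<rightarrow> carrier A" using I(2) \<sigma>a unfolding d_def Pi_iff by blast
    have "AS.comb I (\<lambda>i. (-1) \<odot> \<sigma> (a i)) c = (-1) \<odot>\<^bsub>AS\<^esub> X"
      using comb[OF I(1,2)] I(4) X by (simp add: Sym_def AS.comb_smult[OF \<sigma>a] hom_distribs)
    then have "AS.comb I d c = X \<oplus>\<^bsub>AS\<^esub> (-1) \<odot>\<^bsub>AS\<^esub> X"
      unfolding d_def using I \<sigma>a by (subst AS.comb_add) auto
    also have "\<dots> = \<zero>\<^bsub>AS\<^esub>" using X by (simp add: Sym_def AS.S.scal_minus AS.S.r_neg)
    finally have "\<forall>i\<in>I. d i = \<zero>"
      using faithful d I(1,3) unfolding AS.faithful_def by blast
    moreover have "\<sigma> (a i) = a i" if i: "i \<in> I" "d i = \<zero>" for i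
    proof -
      have ai: "a i \<in> carrier A" "\<sigma> (a i) \<in> carrier A" using I(2) \<sigma>a i by auto
      have "a i \<ominus> \<sigma> (a i) = \<zero>" using i(2) ai by (simp add: d_def A.scal_minus A.minus_eq)
      then show ?thesis using ai by simp
    qed
    ultimately have "a \<in> I \<rightarrow> Sym A \<sigma>" using I(2) by (auto simp: Sym_def)
    then show "X \<in> AS.lin (Sym A \<sigma>)"
      unfolding I(4) by (rule AS.comb_lin[OF I(1) _ Sym_subsp])
  qed
qed

text \<open>The definite description needs both halves: existence by extending f from Sym(A) to its
  span, which is all of Sym over \<open>F\<^sub>s\<close>, and uniqueness because a linear form is
  determined on that span and extensionality fixes it elsewhere.\<close>

lemma form_ext:
  assumes faithful: "AS.faithful (carrier A)" and f: "linear_form_on A (Sym A \<sigma>) f"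
  shows "linear_form_on AS (Sym AS \<Sigma>) (form_ext \<iota> A \<sigma> f)"
    and "a \<in> Sym A \<sigma> \<Longrightarrow> form_ext \<iota> A \<sigma> f (tensor \<iota> A a 1) = \<iota> (f a)"
proof -
  let ?V = "Sym A \<sigma>"
  let ?Q = "\<lambda>g. g \<in> extensional (Sym AS \<Sigma>) \<and> linear_form_on AS (Sym AS \<Sigma>) g \<and>
    (\<forall>a\<in>?V. g (tensor \<iota> A a 1) = \<iota> (f a))"
  note lin = Sym_ext[OF faithful]
  have fV: "AS.faithful ?V"
    using faithful by (rule AS.faithful_mono) (auto simp: Sym_def)
  have gV: "AS.semilin ?V (\<lambda>a. \<iota> (f a))"
    using f by (simp add: AS.semilin_def linear_form_on_def hom_distribs)
  obtain h where h: "\<And>X Z. X \<in> AS.lin ?V \<Longrightarrow> Z \<in> AS.lin ?V \<Longrightarrow> h (X \<oplus>\<^bsub>AS\<^esub> Z) = h X + h Z"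
    "\<And>X c. X \<in> AS.lin ?V \<Longrightarrow> h (c \<odot>\<^bsub>AS\<^esub> X) = c * h X"
    "\<And>a. a \<in> ?V \<Longrightarrow> h (tensor \<iota> A a 1) = \<iota> (f a)"
    by (fact AS.semilinear_extension[OF fV Sym_subsp gV])
  have tV: "tensor \<iota> A a 1 \<in> AS.lin ?V" if "a \<in> ?V" for a
    using AS.lin_single[OF that Sym_subsp, of 1] that by (simp add: Sym_def)
  have Q: "?Q (restrict h (AS.lin ?V))"
    unfolding lin linear_form_on_def
    using h tV AS.lin_add[OF _ _ Sym_subsp] AS.lin_smult[OF _ Sym_subsp] by auto
  have unique: "g = g'" if "?Q g" "?Q g'" for g g'
  proof (rule extensionalityI[of _ "Sym AS \<Sigma>"])
    have "g X = g' X" if "X \<in> AS.lin ?V" for X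
      using that Sym_subsp
    proof (induction X rule: AS.lin_induct)
      case zero
      have z: "\<zero>\<^bsub>AS\<^esub> \<in> Sym AS \<Sigma>" by (simp add: Sym_def \<Sigma>_zero)
      then have "g (0 \<odot>\<^bsub>AS\<^esub> \<zero>\<^bsub>AS\<^esub>) = 0 * g \<zero>\<^bsub>AS\<^esub>" "g' (0 \<odot>\<^bsub>AS\<^esub> \<zero>\<^bsub>AS\<^esub>) = 0 * g' \<zero>\<^bsub>AS\<^esub>"
        using \<open>?Q g\<close> \<open>?Q g'\<close> unfolding linear_form_on_def by blast+
      then show ?case by simp
    next
      case (step X a c)
      have m: "c \<odot>\<^bsub>AS\<^esub> tensor \<iota> A a 1 \<in> Sym AS \<Sigma>" "tensor \<iota> A a 1 \<in> Sym AS \<Sigma>" "X \<in> Sym AS \<Sigma>"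
        using step AS.lin_single[OF _ Sym_subsp] tV by (simp_all add: lin)
      have k: "k (c \<odot>\<^bsub>AS\<^esub> tensor \<iota> A a 1 \<oplus>\<^bsub>AS\<^esub> X) = c * \<iota> (f a) + k X" if "?Q k" for k
        using that m step(3) unfolding linear_form_on_def by simp
      show ?case unfolding k[OF \<open>?Q g\<close>] k[OF \<open>?Q g'\<close>] step.IH by (rule refl)
    qed
    then show "g X = g' X" if "X \<in> Sym AS \<Sigma>" for X using that lin by simp
    show "g \<in> extensional (Sym AS \<Sigma>)" "g' \<in> extensional (Sym AS \<Sigma>)" using that by blast+
  qed
  have "?Q (form_ext \<iota> A \<sigma> f)"
    unfolding form_ext_def by (rule theI[of ?Q, OF Q unique[OF _ Q]])
  then show "linear_form_on AS (Sym AS \<Sigma>) (form_ext \<iota> A \<sigma> f)"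
    and "a \<in> Sym A \<sigma> \<Longrightarrow> form_ext \<iota> A \<sigma> f (tensor \<iota> A a 1) = \<iota> (f a)"
    by auto
qed

end

end

section \<open>The stabilizer algebra is etale\<close>

locale tensor_eigenspaces = simple_eigenspaces \<iota> A "scalar_ext \<iota> A" "\<lambda>a. tensor \<iota> A a 1" L Y \<xi> E
  for \<iota> :: "'f::field \<Rightarrow> 's::field"
    and A :: "('f, 'a, 'm) module_scheme"
    and L :: "'a set" and Y :: "'y set" and \<xi> :: "'y \<Rightarrow> 'a \<Rightarrow> 's"
    and E :: "'y \<Rightarrow> ('a \<times> 's \<Rightarrow>\<^sub>0 int) set set"
begin

abbreviation LA where "LA \<equiv> A\<lparr>carrier := L\<rparr>"

sublocale AA: field_extension_alg \<iota> A
  by (intro field_extension_alg.intro field_hom_axioms A.assoc_alg_axioms)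

lemma LA_assoc_alg: "assoc_alg LA"
proof -
  interpret VA: vectorspace class_ring A by (rule A.vectorspace_class)
  have cl: "\<And>x. x \<in> L \<Longrightarrow> x \<in> carrier A" by (rule L_carrier)
  have sub: "\<zero>\<^bsub>A\<^esub> \<in> L" "\<And>x y. x \<in> L \<Longrightarrow> y \<in> L \<Longrightarrow> x \<oplus>\<^bsub>A\<^esub> y \<in> L" "\<And>c x. x \<in> L \<Longrightarrow> c \<odot>\<^bsub>A\<^esub> x \<in> L"
    using L_subsp by (auto simp: subsp_def)
  have "submodule class_ring L A"
    by (rule submodule.intro) (use cl sub in \<open>auto simp: VA.module_axioms\<close>)
  then have "subspace class_ring L A" by (simp add: subspace_def VA.vectorspace_axioms)
  then have vs: "vectorspace class_ring LA" by (rule VA.subspace_is_vs)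
  then have "module class_ring LA" by (simp add: vectorspace_def)
  then have ag: "abelian_group LA" by (rule Module.module.axioms(2))
  have "Group.monoid LA"
    by (rule monoidI) (use cl L_mult L_one in \<open>auto simp: A.m_assoc\<close>)
  then have "ring LA"
    by (intro ringI[OF ag]) (use cl in \<open>auto simp: A.l_distr A.r_distr\<close>)
  then show ?thesis
    by (rule assoc_alg.intro, intro assoc_alg_axioms.intro vs)
      (use cl in \<open>auto simp: A.smult_mult_left A.smult_mult_right\<close>)
qed

section \<open>Comparison of \<open>L \<otimes> F\<^sub>s\<close> with
  \<open>A \<otimes> F\<^sub>s\<close>\<close>

sublocale AL: field_extension_alg \<iota> LA
  by (intro field_extension_alg.intro field_hom_axioms LA_assoc_alg)

text \<open>The relations for L are among those for A, and the elements of the pair ring of L that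
  lie in the ideal of A form an ideal there. This provides the map from
  \<open>L \<otimes> F\<^sub>s\<close> to \<open>A \<otimes> F\<^sub>s\<close>.\<close>

lemma tensor_ideal_subset: "tensor_ideal \<iota> LA \<subseteq> tensor_ideal \<iota> A"
proof -
  let ?J = "{p \<in> carrier AL.P. p \<in> AA.T}"
  have mult: "mult AL.P = mult AA.P" by (simp add: pair_ring_def)
  have carr: "p \<in> carrier AA.P" if "p \<in> carrier AL.P" for p
    using that L_carrier by (auto simp: pair_ring_simps)
  have "ideal ?J AL.P"
  proof (rule AL.pair_ring_idealI)
    fix p q assume "p \<in> ?J" "q \<in> carrier AL.P"
    then show "q \<otimes>\<^bsub>AL.P\<^esub> p \<in> ?J" "p \<otimes>\<^bsub>AL.P\<^esub> q \<in> ?J"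
      using AL.pair_mult_closed carr AA.T.I_l_closed AA.T.I_r_closed by (auto simp: mult)
  qed (auto simp: pair_zero_closed pair_diff_closed AA.T_zero AA.T_diff)
  moreover have "tensor_relations \<iota> LA \<subseteq> tensor_relations \<iota> A"
    by (simp add: tensor_relations_def) (blast intro: L_carrier)
  then have "tensor_relations \<iota> LA \<subseteq> ?J" using AL.relations_closed AA.relations_T by auto
  ultimately show ?thesis using AL.T_minimal by blast
qed

lemma comb_LA_zero:
  assumes "finite I" "a \<in> I \<rightarrow> L" "AL.AS.comb I a c = \<zero>\<^bsub>scalar_ext \<iota> LA\<^esub>"
  shows "comb I a c = \<zero>\<^bsub>scalar_ext \<iota> A\<^esub>"
proof -
  let ?p = "\<Sum>i\<in>I. frag_of (a i, c i)"
  have aA: "a \<in> I \<rightarrow> carrier A" using assms(2) L_carrier by auto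
  have L: "?p \<in> carrier AL.P" "AL.AS.comb I a c = AL.cls ?p"
    using AL.comb_cls[OF assms(1), of a c] assms(2) by auto
  have "AL.cls ?p = \<zero>\<^bsub>scalar_ext \<iota> LA\<^esub>" using L(2) assms(3) by (rule trans[OF sym])
  with AL.cls_eq_zero[OF L(1)] have "?p \<in> AL.T" by blast
  then have "?p \<in> AA.T" using tensor_ideal_subset by blast
  moreover have "?p \<in> carrier AA.P" "comb I a c = AA.cls ?p"
    using AA.comb_cls[OF assms(1) aA, of c] by auto
  ultimately show ?thesis using AA.cls_eq_zero by simp
qed

lemma subsp_LA: "AL.AS.subsp L"
  using L_subsp by (simp add: subsp_def AL.AS.subsp_def)

text \<open>A relation in \<open>L \<otimes> F\<^sub>s\<close> maps to the same relation in
  \<open>A \<otimes> F\<^sub>s\<close>, where A is already known to be faithful.\<close>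

lemma faithful_LA: "AL.AS.faithful L"
  unfolding AL.AS.faithful_def
proof (intro allI impI)
  fix I :: "nat set" and a c
  assume I: "finite I" "a \<in> I \<rightarrow> L" "indep I c" "AL.AS.comb I a c = \<zero>\<^bsub>scalar_ext \<iota> LA\<^esub>"
  have "faithful L" using L_carrier by (intro faithful) auto
  from this[unfolded faithful_def, rule_format, OF I(1-3) comb_LA_zero[OF I(1,2,4)]]
  show "\<forall>i\<in>I. a i = \<zero>\<^bsub>LA\<^esub>" by simp
qed

lemma semilin_LA: "y \<in> Y \<Longrightarrow> AL.AS.semilin L (\<xi> y)"
  using \<xi>_semilin[of y] by (simp add: semilin_def AL.AS.semilin_def)

sublocale CL: characters \<iota> LA "scalar_ext \<iota> LA" "\<lambda>a. tensor \<iota> LA a 1" L Y \<xi>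
  by (intro characters.intro AL.base_change_AS characters_axioms.intro)
    (simp_all add: finite_Y subsp_LA L_mult L_one semilin_LA \<xi>_mult \<xi>_one \<xi>_separate)

text \<open>The image of X in \<open>A\<^sub>s\<close> multiplies each \<open>e y\<close> by the
  value of X at \<open>y\<close>, that is by 0. As the \<open>e y\<close> add up to 1, the image is
  zero, and faithfulness of L in \<open>A\<^sub>s\<close> kills the coefficients of X.\<close>

lemma joint_LA_inj:
  assumes "(X, \<lambda>_. 0) \<in> CL.joint"
  shows "X = \<zero>\<^bsub>scalar_ext \<iota> LA\<^esub>"
proof -
  have "X \<in> AL.AS.lin L" using assms by (rule CL.joint_lin)
  then obtain I :: "nat set" and a c
    where I: "finite I" "a \<in> I \<rightarrow> L" "indep I c" "X = AL.AS.comb I a c"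
    using AL.AS.lin_rep_indep[OF _ subsp_LA] by blast
  have aA: "a \<in> I \<rightarrow> carrier A" using I(2) L_carrier by auto
  \<comment> \<open>The extension \<open>h\<close> of the character at \<open>y\<close> computes
    both the recorded value of X, which is 0, and the value of its representation as a
    combination.\<close>
  have sum: "(\<Sum>i\<in>I. c i * \<xi> y (a i)) = 0" if y: "y \<in> Y" for y
  proof -
    obtain h where h: "\<And>X Z. X \<in> AL.AS.lin L \<Longrightarrow> Z \<in> AL.AS.lin L \<Longrightarrow>
        h (X \<oplus>\<^bsub>scalar_ext \<iota> LA\<^esub> Z) = h X + h Z"
      "\<And>X c. X \<in> AL.AS.lin L \<Longrightarrow> h (c \<odot>\<^bsub>scalar_ext \<iota> LA\<^esub> X) = c * h X"
      "\<And>l. l \<in> L \<Longrightarrow> h (tensor \<iota> LA l 1) = \<xi> y l"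
      by (fact AL.AS.semilinear_extension[OF faithful_LA subsp_LA semilin_LA[OF y]])
    have "h X = 0" by (rule CL.joint_hom[OF assms y h])
    moreover have "h (AL.AS.comb J a c) = (\<Sum>i\<in>J. c i * \<xi> y (a i))" if "finite J" "a \<in> J \<rightarrow> L" for J
      using that
    proof (induction J rule: finite_induct)
      case empty
      show ?case using h(2)[OF AL.AS.lin_zero, of 0] by simp
    next
      case (insert i J)
      then have i: "a i \<in> L" "a \<in> J \<rightarrow> L" "a \<in> insert i J \<rightarrow> L" by auto
      have m: "tensor \<iota> LA (a i) 1 \<in> AL.AS.lin L"
        using AL.AS.lin_single[OF i(1) subsp_LA, of 1] i(1) by simp
      have "h (AL.AS.comb (insert i J) a c) =
          h (c i \<odot>\<^bsub>scalar_ext \<iota> LA\<^esub> tensor \<iota> LA (a i) 1 \<oplus>\<^bsub>scalar_ext \<iota> LA\<^esub> AL.AS.comb J a c)"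
        using insert.hyps i(3) by (simp add: AL.AS.comb_insert)
      also have "\<dots> = c i * \<xi> y (a i) + h (AL.AS.comb J a c)"
        using h(1)[OF AL.AS.lin_smult[OF m subsp_LA] AL.AS.comb_lin[OF insert.hyps(1) i(2) subsp_LA]]
          h(2)[OF m] h(3)[OF i(1)] by simp
      finally show ?case using insert i by simp
    qed
    ultimately show ?thesis using I by simp
  qed
  have cc: "comb I a c \<in> carrier (scalar_ext \<iota> A)" using aA by simp
  have act: "comb I a c \<otimes>\<^bsub>scalar_ext \<iota> A\<^esub> e y = \<zero>\<^bsub>scalar_ext \<iota> A\<^esub>" if y: "y \<in> Y" for y
  proof -
    have "comb I a c \<otimes>\<^bsub>scalar_ext \<iota> A\<^esub> e y = (\<Sum>i\<in>I. c i * \<xi> y (a i)) \<odot>\<^bsub>scalar_ext \<iota> A\<^esub> e y"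
      by (rule comb_act[OF aA]) (use y I(2) E_eigen[OF y e_E[OF y]] in auto)
    with sum[OF y] y show ?thesis by simp
  qed
  have "comb I a c = comb I a c \<otimes>\<^bsub>scalar_ext \<iota> A\<^esub> finsum (scalar_ext \<iota> A) e Y"
    using cc by (simp add: e_sum)
  also have "\<dots> = finsum (scalar_ext \<iota> A) (\<lambda>y. comb I a c \<otimes>\<^bsub>scalar_ext \<iota> A\<^esub> e y) Y"
    by (rule S.finsum_rdistr[OF finite_Y cc]) auto
  also have "\<dots> = \<zero>\<^bsub>scalar_ext \<iota> A\<^esub>"
    by (rule S.add.finprod_one_eqI) (use act in simp)
  finally have "comb I a c = \<zero>\<^bsub>scalar_ext \<iota> A\<^esub>" .
  moreover have "faithful L" using L_carrier by (intro faithful) auto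
  ultimately have "\<forall>i\<in>I. a i = \<zero>\<^bsub>A\<^esub>" using I(1-3) unfolding faithful_def by blast
  then have "AL.AS.comb I a c = \<zero>\<^bsub>scalar_ext \<iota> LA\<^esub>" by (intro AL.AS.comb_zero) simp
  then show ?thesis using I(4) by simp
qed

lemma joint_LA_diff:
  assumes "(X, v) \<in> CL.joint" "(Z, w) \<in> CL.joint" "\<And>y. y \<in> Y \<Longrightarrow> v y = w y"
  shows "X = Z"
proof -
  have "(X \<oplus>\<^bsub>scalar_ext \<iota> LA\<^esub> (-1) \<odot>\<^bsub>scalar_ext \<iota> LA\<^esub> Z, \<lambda>y. v y + (-1) * w y) \<in> CL.joint"
    by (intro CL.joint_add CL.joint_smult assms)
  then have "(X \<oplus>\<^bsub>scalar_ext \<iota> LA\<^esub> (-1) \<odot>\<^bsub>scalar_ext \<iota> LA\<^esub> Z, \<lambda>_. 0) \<in> CL.joint"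
    by (rule CL.joint.ext) (use assms(3) in simp)
  from joint_LA_inj[OF this] show ?thesis
    using CL.joint_closed[OF assms(1)] CL.joint_closed[OF assms(2)]
    by (simp add: AL.AS.S.scal_minus AL.AS.S.minus_eq[symmetric])
qed

text \<open>The values of the characters identify \<open>L \<otimes> F\<^sub>s\<close> with the functions on \<open>Y\<close>.\<close>

lemma LA_split: "alg_iso (scalar_ext \<iota> LA) (split_alg (card Y)) \<noteq> {}"
proof -
  let ?S = "scalar_ext \<iota> LA"
  let ?N = "card Y"
  obtain u where u: "bij_betw u {..<?N} Y"
    using ex_bij_betw_nat_finite[OF finite_Y] by (auto simp: lessThan_atLeast0)
  have uY: "u k \<in> Y" if "k < ?N" for k using u that by (auto simp: bij_betw_def)
  have ex: "\<exists>v. (X, v) \<in> CL.joint" if "X \<in> carrier ?S" for X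
    using CL.lin_joint AL.AS_lin that by simp
  define val where "val X = (SOME v. (X, v) \<in> CL.joint)" for X
  have val: "(X, val X) \<in> CL.joint" if "X \<in> carrier ?S" for X
    unfolding val_def using ex[OF that] by (rule someI_ex)
  \<comment> \<open>The choice made in \<open>val\<close> does not affect the values on Y: every
    character extends to \<open>L \<otimes> F\<^sub>s\<close>, and all recorded values agree with
    the extension.\<close>
  have val_eq: "val X y = v y" if X: "(X, v) \<in> CL.joint" and y: "y \<in> Y" for X v y
  proof -
    obtain h where h: "\<And>X Z. X \<in> AL.AS.lin L \<Longrightarrow> Z \<in> AL.AS.lin L \<Longrightarrow> h (X \<oplus>\<^bsub>?S\<^esub> Z) = h X + h Z"
      "\<And>X c. X \<in> AL.AS.lin L \<Longrightarrow> h (c \<odot>\<^bsub>?S\<^esub> X) = c * h X"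
      "\<And>l. l \<in> L \<Longrightarrow> h (tensor \<iota> LA l 1) = \<xi> y l"
      by (fact AL.AS.semilinear_extension[OF faithful_LA subsp_LA semilin_LA[OF y]])
    have "h X = v y" by (rule CL.joint_hom[OF X y h])
    moreover have "h X = val X y"
      by (rule CL.joint_hom[OF val[OF CL.joint_closed[OF X]] y h])
    ultimately show ?thesis by simp
  qed
  define \<Theta> where "\<Theta> X = (\<lambda>k\<in>{..<?N}. val X (u k))" for X
  have "\<Theta> \<in> Ring.ring_hom ?S (split_alg ?N)"
  proof (rule ring_hom_memI)
    fix X Z assume XZ: "X \<in> carrier ?S" "Z \<in> carrier ?S"
    show "\<Theta> (X \<otimes>\<^bsub>?S\<^esub> Z) = \<Theta> X \<otimes>\<^bsub>split_alg ?N\<^esub> \<Theta> Z"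
      using val_eq[OF CL.joint_mult[OF val val], OF XZ uY] by (auto simp: \<Theta>_def split_alg_def)
    show "\<Theta> (X \<oplus>\<^bsub>?S\<^esub> Z) = \<Theta> X \<oplus>\<^bsub>split_alg ?N\<^esub> \<Theta> Z"
      using val_eq[OF CL.joint_add[OF val val], OF XZ uY] by (auto simp: \<Theta>_def split_alg_def)
  next
    show "\<Theta> \<one>\<^bsub>?S\<^esub> = \<one>\<^bsub>split_alg ?N\<^esub>"
      using val_eq[OF CL.joint_one uY] by (auto simp: \<Theta>_def split_alg_def)
  qed (simp add: \<Theta>_def split_alg_def)
  moreover have "\<Theta> (c \<odot>\<^bsub>?S\<^esub> X) = c \<odot>\<^bsub>split_alg ?N\<^esub> \<Theta> X" if "X \<in> carrier ?S" for c X
    using val_eq[OF CL.joint_smult[OF val[OF that]] uY] by (auto simp: \<Theta>_def split_alg_def)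
  moreover have "inj_on \<Theta> (carrier ?S)"
  proof (rule inj_onI)
    fix X Z assume XZ: "X \<in> carrier ?S" "Z \<in> carrier ?S" "\<Theta> X = \<Theta> Z"
    show "X = Z"
    proof (rule joint_LA_diff[OF val[OF XZ(1)] val[OF XZ(2)]])
      fix y assume "y \<in> Y"
      then obtain k where k: "k < ?N" "y = u k" using u by (auto simp: bij_betw_def)
      then show "val X y = val Z y" using fun_cong[OF XZ(3), of k] by (simp add: \<Theta>_def)
    qed
  qed
  moreover have "\<Theta> ` carrier ?S = carrier (split_alg ?N)"
  proof
    show "\<Theta> ` carrier ?S \<subseteq> carrier (split_alg ?N)" by (auto simp: \<Theta>_def split_alg_def)
    show "carrier (split_alg ?N) \<subseteq> \<Theta> ` carrier ?S"
    proof
      fix w :: "nat \<Rightarrow> 's" assume w: "w \<in> carrier (split_alg ?N)"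
      obtain X where X: "(X, w \<circ> inv_into {..<?N} u) \<in> CL.joint" using CL.joint_surj by blast
      have "\<Theta> X = w"
      proof (rule extensionalityI)
        show "\<Theta> X \<in> extensional {..<?N}" by (simp add: \<Theta>_def)
        show "w \<in> extensional {..<?N}" using w by (simp add: split_alg_def)
        fix k assume k: "k \<in> {..<?N}"
        then show "\<Theta> X k = w k"
          using val_eq[OF X uY[of k]] u by (simp add: \<Theta>_def bij_betw_def)
      qed
      then show "w \<in> \<Theta> ` carrier ?S" using CL.joint_closed[OF X] by blast
    qed
  qed
  ultimately have "\<Theta> \<in> alg_iso ?S (split_alg ?N)"
    by (simp add: alg_iso_def alg_hom_def bij_betw_def)
  then show ?thesis by blast
qed

text \<open>Both products have the same coefficients in the expansion along the idempotents, because
  the characters take values in a commutative field; injectivity of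
  \<open>a \<mapsto> a \<otimes> 1\<close> brings the equality back to A.\<close>

lemma LA_commute:
  assumes "k \<in> L" "l \<in> L"
  shows "k \<otimes>\<^bsub>A\<^esub> l = l \<otimes>\<^bsub>A\<^esub> k"
proof -
  have "tensor \<iota> A (k \<otimes>\<^bsub>A\<^esub> l) 1 = tensor \<iota> A (l \<otimes>\<^bsub>A\<^esub> k) 1"
    unfolding \<tau>_expand[OF L_mult[OF assms]] \<tau>_expand[OF L_mult[OF assms(2,1)]]
    by (rule S.finsum_cong') (use assms in \<open>auto simp: \<xi>_mult mult.commute\<close>)
  then show ?thesis using assms L_carrier by (intro \<tau>_eqD) auto
qed

lemma LA_etale: "etale \<iota> (card Y) LA"
  using LA_split LA_commute LA_assoc_alg by (simp add: etale_def assoc_alg_iff)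

end

section \<open>The embedding\<close>

lemma mat_trace_add:
  "M \<in> carrier_mat d d \<Longrightarrow> N \<in> carrier_mat d d \<Longrightarrow> mat_trace d (M + N) = mat_trace d M + mat_trace d N"
  by (simp add: mat_trace_def sum.distrib)

lemma mat_trace_smult: "M \<in> carrier_mat d d \<Longrightarrow> mat_trace d (c \<cdot>\<^sub>m M) = c * mat_trace d M"
  by (simp add: mat_trace_def sum_distrib_left)

lemma mat_trace_comm:
  fixes M N :: "'s::field mat"
  assumes "M \<in> carrier_mat d d" "N \<in> carrier_mat d d"
  shows "mat_trace d (M * N) = mat_trace d (N * M)"
proof -
  have *: "mat_trace d (M * N) = (\<Sum>i<d. \<Sum>k<d. M $$ (i, k) * N $$ (k, i))"
    if "M \<in> carrier_mat d d" "N \<in> carrier_mat d d" for M N :: "'s mat"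
    unfolding mat_trace_def
    by (rule sum.cong) (use that in \<open>auto simp: scalar_prod_def lessThan_atLeast0\<close>)
  show ?thesis
    unfolding *[OF assms] *[OF assms(2,1)]
    by (subst sum.swap) (simp add: mult.commute)
qed

lemma right_ideal_closed:
  assumes "right_ideal R I"
  shows "I \<subseteq> carrier R" "\<zero>\<^bsub>R\<^esub> \<in> I" "x \<in> I \<Longrightarrow> y \<in> I \<Longrightarrow> x \<oplus>\<^bsub>R\<^esub> y \<in> I"
    "x \<in> I \<Longrightarrow> r \<in> carrier R \<Longrightarrow> x \<otimes>\<^bsub>R\<^esub> r \<in> I"
proof -
  interpret additive_subgroup I R using assms by (simp add: right_ideal_def)
  show "I \<subseteq> carrier R" "\<zero>\<^bsub>R\<^esub> \<in> I" "x \<in> I \<Longrightarrow> y \<in> I \<Longrightarrow> x \<oplus>\<^bsub>R\<^esub> y \<in> I"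
    by (auto intro: a_Hcarr)
  show "x \<in> I \<Longrightarrow> r \<in> carrier R \<Longrightarrow> x \<otimes>\<^bsub>R\<^esub> r \<in> I" using assms by (simp add: right_ideal_def)
qed

lemma SB_span_upper: "I \<in> P \<Longrightarrow> I \<subseteq> SB_span \<iota> n A P"
  by (auto simp: SB_span_def)

theorem proposition3p11:
  fixes \<iota> :: "'f::field \<Rightarrow> 's::field"
    and n :: nat
    and A L :: "('f, 'a, 'm) module_scheme"
    and \<sigma> \<sigma>\<^sub>L :: "'a \<Rightarrow> 'a"
    and f :: "'a \<Rightarrow> 'f"
    and Y :: "'y set"
    and act :: "('s \<Rightarrow> 's) \<Rightarrow> 'y \<Rightarrow> 'y"
    and \<phi> :: "'y \<Rightarrow> 'y"
    and \<epsilon> :: "'y \<Rightarrow> ('a \<times> 's \<Rightarrow>\<^sub>0 int) set set"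
    and \<psi> :: "'y \<Rightarrow> 'a \<Rightarrow> 's"
  assumes "separable_closure \<iota>"
    and "n \<ge> 1"
    and "central_simple (2 * n) A"
    and "quadratic_pair \<iota> n A \<sigma> f"
    and "gamma_set \<iota> Y act"
    and "card Y = 2 * n"
    and "gamma_involution \<iota> Y act \<phi>"
    and "quadric_embedding \<iota> n A \<sigma> f Y act \<phi> \<epsilon>"
    and "L = stabilizer_alg \<iota> A Y \<epsilon>"
    and "gamma_iso \<iota> Y act (XX \<iota> L) (XX_act \<iota> L) \<psi>"
    and "\<forall>y\<in>Y. \<epsilon> y = induced_point \<iota> A L (\<psi> y)"
    and "etale_involution \<iota> L \<sigma>\<^sub>L"
    and "\<forall>y\<in>Y. \<psi> (\<phi> y) = XX_map L \<sigma>\<^sub>L (\<psi> y)"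
  shows "alg_inv_embedding \<iota> n L \<sigma>\<^sub>L A \<sigma> f (\<lambda>l. l)"
proof -
  interpret \<iota>: field_hom \<iota> using assms(1) by (simp add: separable_closure_def)
  have A_alg: "assoc_alg A" using assms(3) by (simp add: central_simple_def assoc_alg_iff)
  interpret FA: field_extension_alg \<iota> A
    by (intro field_extension_alg.intro A_alg \<iota>.field_hom_axioms)
  let ?S = "scalar_ext \<iota> A"
  let ?\<tau> = "\<lambda>a. tensor \<iota> A a 1"
  have \<epsilon>: "general_embedding \<iota> n A Y act \<epsilon>"
    "\<And>Z. isotropic_subset \<phi> Y Z \<Longrightarrow> isotropic_ideal \<iota> A \<sigma> f (SB_span \<iota> n A (\<epsilon> ` Z))"
    using assms(8) by (auto simp: quadric_embedding_def)
  have point: "right_ideal ?S (\<epsilon> y)" "subspace_dim ?S (\<epsilon> y) = card Y" if "y \<in> Y" for y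
    using \<epsilon>(1) that assms(6) by (auto simp: general_embedding_def SB_points_def SB_variety_def)
  note \<epsilon>_closed = right_ideal_closed[OF point(1)]
  \<comment> \<open>A right ideal is closed under scalars because multiplying by \<open>c\<close> is
    right multiplication by \<open>c\<close> times 1.\<close>
  have \<epsilon>_smult: "c \<odot>\<^bsub>?S\<^esub> x \<in> \<epsilon> y" if "y \<in> Y" "x \<in> \<epsilon> y" for c x y
  proof -
    have "x \<in> carrier ?S" using \<epsilon>_closed(1) that by blast
    then have "c \<odot>\<^bsub>?S\<^esub> x = x \<otimes>\<^bsub>?S\<^esub> (c \<odot>\<^bsub>?S\<^esub> \<one>\<^bsub>?S\<^esub>)" by (simp add: FA.AS.S.smult_mult_right)
    then show ?thesis using \<epsilon>_closed(4)[OF that(1,2), of "c \<odot>\<^bsub>?S\<^esub> \<one>\<^bsub>?S\<^esub>"] by simp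
  qed
  define LL where "LL = carrier L"
  have L: "L = A\<lparr>carrier := LL\<rparr>" using assms(9) by (simp add: stabilizer_alg_def LL_def)
  have LL_iff: "a \<in> LL \<longleftrightarrow> a \<in> carrier A \<and> (\<forall>y\<in>Y. \<forall>z\<in>\<epsilon> y. ?\<tau> a \<otimes>\<^bsub>?S\<^esub> z \<in> \<epsilon> y)" for a
  proof -
    \<comment> \<open>Every \<gamma> fixes 1, hence every element of the form
      \<open>a \<otimes> 1\<close>.\<close>
    have "galois_ext \<iota> A \<gamma> (?\<tau> a) = ?\<tau> a" if "\<gamma> \<in> carrier (Gal \<iota>)" "a \<in> carrier A" for \<gamma>
    proof -
      from that(1) interpret g: field_hom \<gamma> by (simp add: Gal_def)
      show ?thesis using FA.galois_ext_tensor[OF that, of 1] by simp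
    qed
    then show ?thesis
      by (auto simp: LL_def assms(9) stabilizer_alg_def stabilizer_ext_def)
  qed
  have LL_carrier: "l \<in> carrier A" if "l \<in> LL" for l using that by (simp add: LL_iff)
  have stab: "?\<tau> l \<otimes>\<^bsub>?S\<^esub> z \<in> \<epsilon> y" "z \<in> carrier ?S" if "l \<in> LL" "y \<in> Y" "z \<in> \<epsilon> y" for l y z
    using that \<epsilon>_closed(1) by (auto simp: LL_iff)
  have LL_zero: "\<zero>\<^bsub>A\<^esub> \<in> LL"
    using \<epsilon>_closed(1,2) FA.AS.\<tau>_zero by (auto simp: LL_iff subset_iff)
  have LL_one: "\<one>\<^bsub>A\<^esub> \<in> LL"
    using \<epsilon>_closed(1) by (auto simp: LL_iff FA.tensor_one_one subset_iff)
  have LL_add: "k \<oplus>\<^bsub>A\<^esub> l \<in> LL" if "k \<in> LL" "l \<in> LL" for k l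
    unfolding LL_iff
  proof (intro conjI ballI)
    show "k \<oplus>\<^bsub>A\<^esub> l \<in> carrier A" using that LL_carrier by simp
    fix y z assume yz: "y \<in> Y" "z \<in> \<epsilon> y"
    have "?\<tau> (k \<oplus>\<^bsub>A\<^esub> l) \<otimes>\<^bsub>?S\<^esub> z = ?\<tau> k \<otimes>\<^bsub>?S\<^esub> z \<oplus>\<^bsub>?S\<^esub> ?\<tau> l \<otimes>\<^bsub>?S\<^esub> z"
      using that LL_carrier stab(2)[OF that(1) yz] by (simp add: FA.AS.\<tau>_add FA.AS.S.l_distr)
    then show "?\<tau> (k \<oplus>\<^bsub>A\<^esub> l) \<otimes>\<^bsub>?S\<^esub> z \<in> \<epsilon> y"
      using \<epsilon>_closed(3)[OF yz(1) stab(1)[OF that(1) yz] stab(1)[OF that(2) yz]] by simp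
  qed
  have LL_mult: "k \<otimes>\<^bsub>A\<^esub> l \<in> LL" if "k \<in> LL" "l \<in> LL" for k l
    unfolding LL_iff
  proof (intro conjI ballI)
    show "k \<otimes>\<^bsub>A\<^esub> l \<in> carrier A" using that LL_carrier by simp
    fix y z assume yz: "y \<in> Y" "z \<in> \<epsilon> y"
    have "?\<tau> (k \<otimes>\<^bsub>A\<^esub> l) \<otimes>\<^bsub>?S\<^esub> z = ?\<tau> k \<otimes>\<^bsub>?S\<^esub> (?\<tau> l \<otimes>\<^bsub>?S\<^esub> z)"
      using that LL_carrier stab(2)[OF that(1) yz] by (simp add: FA.AS.\<tau>_mult FA.AS.S.m_assoc)
    then show "?\<tau> (k \<otimes>\<^bsub>A\<^esub> l) \<otimes>\<^bsub>?S\<^esub> z \<in> \<epsilon> y"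
      using stab(1)[OF that(1) yz(1) stab(1)[OF that(2) yz]] by simp
  qed
  have LL_smult: "c \<odot>\<^bsub>A\<^esub> l \<in> LL" if "l \<in> LL" for c l
    unfolding LL_iff
  proof (intro conjI ballI)
    show "c \<odot>\<^bsub>A\<^esub> l \<in> carrier A" using that LL_carrier by simp
    fix y z assume yz: "y \<in> Y" "z \<in> \<epsilon> y"
    have "?\<tau> (c \<odot>\<^bsub>A\<^esub> l) \<otimes>\<^bsub>?S\<^esub> z = \<iota> c \<odot>\<^bsub>?S\<^esub> (?\<tau> l \<otimes>\<^bsub>?S\<^esub> z)"
      using that LL_carrier stab(2)[OF that yz] by (simp add: FA.AS.\<tau>_smult FA.AS.S.smult_mult_left)
    then show "?\<tau> (c \<odot>\<^bsub>A\<^esub> l) \<otimes>\<^bsub>?S\<^esub> z \<in> \<epsilon> y"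
      using \<epsilon>_smult[OF yz(1) stab(1)[OF that yz]] by simp
  qed
  have \<psi>_bij: "bij_betw \<psi> Y (XX \<iota> L)" using assms(10) by (simp add: gamma_iso_def)
  then have \<psi>: "\<psi> y \<in> alg_hom L (ext_field_alg \<iota>)" "\<psi> y \<in> extensional LL" if "y \<in> Y" for y
    using that by (auto simp: bij_betw_def XX_def LL_def)
  have \<psi>_hom: "\<psi> y (k \<oplus>\<^bsub>A\<^esub> l) = \<psi> y k + \<psi> y l" "\<psi> y (k \<otimes>\<^bsub>A\<^esub> l) = \<psi> y k * \<psi> y l"
    "\<psi> y (c \<odot>\<^bsub>A\<^esub> l) = \<iota> c * \<psi> y l" "\<psi> y \<one>\<^bsub>A\<^esub> = 1"
    if "y \<in> Y" "k \<in> LL" "l \<in> LL" for y k l c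
    using \<psi>(1)[OF that(1)] that(2,3)
    by (auto simp: alg_hom_def Ring.ring_hom_def ext_field_alg_def L)
  have Y_pos: "card Y > 0" using assms(2,6) by simp
  then have Y: "finite Y" "Y \<noteq> {}" by (auto simp: card_gt_0_iff)
  interpret TE: tensor_eigenspaces \<iota> A LL Y \<psi> \<epsilon>
  proof (intro tensor_eigenspaces.intro simple_eigenspaces.intro eigenspaces.intro characters.intro
      FA.base_change_AS characters_axioms.intro eigenspaces_axioms.intro simple_eigenspaces_axioms.intro)
    show "finite Y" "Y \<noteq> {}" by (fact Y)+
    show "FA.AS.subsp LL"
      using LL_carrier LL_zero LL_add LL_smult by (auto simp: FA.AS.subsp_def)
    show "k \<otimes>\<^bsub>A\<^esub> l \<in> LL" if "k \<in> LL" "l \<in> LL" for k l using that by (rule LL_mult)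
    show "\<one>\<^bsub>A\<^esub> \<in> LL" by (fact LL_one)
    show "FA.AS.semilin LL (\<psi> y)" if "y \<in> Y" for y
      using \<psi>_hom(1,3)[OF that] by (auto simp: FA.AS.semilin_def)
    show "\<psi> y (k \<otimes>\<^bsub>A\<^esub> l) = \<psi> y k * \<psi> y l" if "y \<in> Y" "k \<in> LL" "l \<in> LL" for y k l
      by (rule \<psi>_hom(2)[OF that])
    show "\<psi> y \<one>\<^bsub>A\<^esub> = 1" if "y \<in> Y" for y by (rule \<psi>_hom(4)[OF that LL_one LL_one])
    show "\<exists>l\<in>LL. \<psi> y l \<noteq> \<psi> z l" if "y \<in> Y" "z \<in> Y" "y \<noteq> z" for y z
    proof (rule ccontr)
      assume "\<not> (\<exists>l\<in>LL. \<psi> y l \<noteq> \<psi> z l)"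
      then have "\<psi> y = \<psi> z" using \<psi>(2) that(1,2) by (intro extensionalityI[of _ LL]) auto
      then show False using \<psi>_bij that by (auto simp: bij_betw_def inj_on_def)
    qed
    show "\<epsilon> y = {x \<in> carrier ?S. \<forall>l\<in>LL. ?\<tau> l \<otimes>\<^bsub>?S\<^esub> x = \<psi> y l \<odot>\<^bsub>?S\<^esub> x}" if "y \<in> Y" for y
      using assms(11) that by (auto simp: induced_point_def FA.AS_smult LL_def)
    show "vectorspace.dim class_ring (?S\<lparr>carrier := \<epsilon> y\<rparr>) = card Y" if "y \<in> Y" for y
      using point(2)[OF that] by (simp add: subspace_dim_def)
    show "\<exists>G. finite G \<and> card G \<le> card Y * card Y \<and> G \<subseteq> carrier ?S \<and>
        LinearCombinations.module.span class_ring ?S G = carrier ?S"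
      using FA.AS_generators assms(3,6)
      by (simp add: central_simple_def subspace_dim_def power2_eq_square)
    show "X \<in> FA.AS.lin (carrier A)" if "X \<in> carrier ?S" for X using that by (rule FA.AS_lin)
    show "J = {\<zero>\<^bsub>A\<^esub>} \<or> J = carrier A" if "ideal J A" for J
      using assms(3) that by (simp add: central_simple_def)
    show "\<exists>c. z = c \<odot>\<^bsub>A\<^esub> \<one>\<^bsub>A\<^esub>"
      if "z \<in> carrier A" "\<And>x. x \<in> carrier A \<Longrightarrow> z \<otimes>\<^bsub>A\<^esub> x = x \<otimes>\<^bsub>A\<^esub> z" for z
    proof -
      have "z \<in> range (\<lambda>c. c \<odot>\<^bsub>A\<^esub> \<one>\<^bsub>A\<^esub>)" using assms(3) that unfolding central_simple_def by blast
      then show ?thesis by blast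
    qed
  qed
  \<comment> \<open>The splitting chosen inside \<open>Trd\<close>. The representation
    \<open>rmat\<close> on a point shows that splittings exist, so the choice really is an
    isomorphism onto matrices and has the properties of a trace.\<close>
  define \<Phi> where "\<Phi> = (SOME \<Phi>. \<Phi> \<in> alg_iso ?S (module_mat TYPE('s) (2 * n) (2 * n)))"
  have "\<Phi> \<in> alg_iso ?S (module_mat TYPE('s) (2 * n) (2 * n))"
    unfolding \<Phi>_def using TE.rmat_alg_iso assms(6) by (intro someI[of "\<lambda>\<Phi>. \<Phi> \<in> _"]) simp
  then have \<Phi>: "\<Phi> X \<in> carrier_mat (2 * n) (2 * n)" "\<Phi> (X \<oplus>\<^bsub>?S\<^esub> Z) = \<Phi> X + \<Phi> Z"
    "\<Phi> (X \<otimes>\<^bsub>?S\<^esub> Z) = \<Phi> X * \<Phi> Z" "\<Phi> (c \<odot>\<^bsub>?S\<^esub> X) = c \<cdot>\<^sub>m \<Phi> X"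
    if "X \<in> carrier ?S" "Z \<in> carrier ?S" for X Z c
    using that by (auto simp: alg_iso_def alg_hom_def Ring.ring_hom_def module_mat_simps)
  define T where "T X = mat_trace (2 * n) (\<Phi> X)" for X
  have Trd: "Trd \<iota> (2 * n) A a = T (?\<tau> a)" for a by (simp add: Trd_def T_def \<Phi>_def)
  have T_add: "T (X \<oplus>\<^bsub>?S\<^esub> Z) = T X + T Z" and T_mult: "T (X \<otimes>\<^bsub>?S\<^esub> Z) = T (Z \<otimes>\<^bsub>?S\<^esub> X)"
    if "X \<in> carrier ?S" "Z \<in> carrier ?S" for X Z
    using \<Phi>[OF that] \<Phi>[OF that(2,1)]
    by (simp_all add: T_def mat_trace_add mat_trace_comm[of "\<Phi> X" _ "\<Phi> Z"])
  have T_smult: "T (c \<odot>\<^bsub>?S\<^esub> X) = c * T X" if "X \<in> carrier ?S" for c X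
    using \<Phi>[OF that that] by (simp add: T_def mat_trace_smult)
  have T_zero: "T \<zero>\<^bsub>?S\<^esub> = 0" using T_smult[of "\<zero>\<^bsub>?S\<^esub>" 0] by simp
  have \<sigma>: "linear_involution A \<sigma>" and f: "linear_form_on A (Sym A \<sigma>) f"
    and f_tr: "\<And>a. a \<in> carrier A \<Longrightarrow> \<iota> (f (a \<oplus>\<^bsub>A\<^esub> \<sigma> a)) = T (?\<tau> a)"
    using assms(4) by (auto simp: quadratic_pair_def Trd)
  note \<sigma>_simps = FA.\<sigma>_simps[OF \<sigma>]
  let ?\<Sigma> = "map_ext \<iota> A \<sigma>"
  let ?f = "form_ext \<iota> A \<sigma> f"
  have faithful: "FA.AS.faithful (carrier A)" by (rule TE.faithful) simp
  note f_lin = FA.form_ext(1)[OF \<sigma> faithful f] and f_val = FA.form_ext(2)[OF \<sigma> faithful f]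
  have f_add: "?f (X \<oplus>\<^bsub>?S\<^esub> Z) = ?f X + ?f Z"
    if "X \<in> carrier ?S" "?\<Sigma> X = X" "Z \<in> carrier ?S" "?\<Sigma> Z = Z" for X Z
    using f_lin that by (simp add: linear_form_on_def Sym_def)
  have f_smult: "?f (c \<odot>\<^bsub>?S\<^esub> X) = c * ?f X" if "X \<in> carrier ?S" "?\<Sigma> X = X" for c X
    using f_lin that by (simp add: linear_form_on_def Sym_def)
  note \<Sigma>_simps = FA.\<Sigma>_closed[OF \<sigma>] FA.\<Sigma>_add[OF \<sigma>] FA.\<Sigma>_smult[OF \<sigma>] FA.\<Sigma>_\<Sigma>[OF \<sigma>]
    FA.\<Sigma>_zero[OF \<sigma>] FA.\<Sigma>_tensor[OF \<sigma>]
  \<comment> \<open>On A, the trace of \<open>a\<close> is the value of f at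
    \<open>a + \<sigma> a\<close>, which is symmetric in \<open>a\<close> and
    \<open>\<sigma> a\<close>; linearity carries the invariance over to
    \<open>A\<^sub>s\<close>.\<close>
  have T_\<Sigma>: "T (?\<Sigma> X) = T X" if "X \<in> carrier ?S" for X
    using FA.AS_lin[OF that] FA.AS.carrier_subsp
  proof (induction X rule: FA.AS.lin_induct)
    case (step X a c)
    have "T (?\<tau> (\<sigma> a)) = T (?\<tau> a)"
      using f_tr[of a] f_tr[of "\<sigma> a"] step(4) by (simp add: \<sigma>_simps FA.A.a_comm)
    then show ?case
      using step by (simp add: \<Sigma>_simps \<sigma>_simps T_add T_smult)
  qed (simp add: \<Sigma>_simps)
  \<comment> \<open>The identity is known on A and both sides are additive and homogeneous. Before f
    is split, each pure tensor has to be joined with its image under the involution, since f is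
    linear on symmetric elements only.\<close>
  have f_trace: "?f (X \<oplus>\<^bsub>?S\<^esub> ?\<Sigma> X) = T X" if "X \<in> carrier ?S" for X
    using FA.AS_lin[OF that] FA.AS.carrier_subsp
  proof (induction X rule: FA.AS.lin_induct)
    case zero
    show ?case using f_smult[of "\<zero>\<^bsub>?S\<^esub>" 0] by (simp add: \<Sigma>_simps T_zero)
  next
    case (step X a c)
    let ?X = "X \<oplus>\<^bsub>?S\<^esub> ?\<Sigma> X" and ?a = "a \<oplus>\<^bsub>A\<^esub> \<sigma> a"
    have cl: "?X \<in> carrier ?S" "?a \<in> carrier A" "\<sigma> a \<in> carrier A" "?\<Sigma> X \<in> carrier ?S"
      using step by (auto simp: \<Sigma>_simps \<sigma>_simps)
    have sym: "?\<Sigma> ?X = ?X" "\<sigma> ?a = ?a"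
      using step cl by (simp_all add: \<Sigma>_simps \<sigma>_simps FA.AS.S.a_comm FA.A.a_comm)
    have sym': "?\<Sigma> (?\<tau> ?a) = ?\<tau> ?a" using FA.\<Sigma>_tensor[OF \<sigma> cl(2), of 1] sym by simp
    have "(c \<odot>\<^bsub>?S\<^esub> ?\<tau> a \<oplus>\<^bsub>?S\<^esub> X) \<oplus>\<^bsub>?S\<^esub> ?\<Sigma> (c \<odot>\<^bsub>?S\<^esub> ?\<tau> a \<oplus>\<^bsub>?S\<^esub> X) = c \<odot>\<^bsub>?S\<^esub> ?\<tau> ?a \<oplus>\<^bsub>?S\<^esub> ?X"
      using step cl by (simp add: \<Sigma>_simps FA.AS.\<tau>_add FA.AS.S.scal_r_distr FA.AS.S.a_ac)
    also have "?f \<dots> = c * ?f (?\<tau> ?a) + ?f ?X"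
      using cl sym sym' by (simp add: f_add f_smult \<Sigma>_simps)
    also have "?f (?\<tau> ?a) = T (?\<tau> a)"
      using f_val[of ?a] f_tr[OF step(4)] cl sym by (simp add: Sym_def)
    finally show ?case using step by (simp add: T_add T_smult)
  qed
  have \<phi>: "\<phi> y \<in> Y" "\<phi> (\<phi> y) = y" "\<phi> y \<noteq> y" if "y \<in> Y" for y
    using assms(7) that by (auto simp: gamma_involution_def)
  interpret QE: quadric_eigenspaces \<iota> A ?S ?\<tau> LL Y \<psi> \<epsilon> ?\<Sigma> T ?f \<phi>
  proof (intro quadric_eigenspaces.intro TE.eigenspaces_axioms quadric_eigenspaces_axioms.intro)
    fix R assume R: "isotropic_subset \<phi> Y R"
    \<comment> \<open>The required ideal is the linear variety spanned by the points of R, which the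
      embedding of quadrics makes isotropic.\<close>
    let ?J = "SB_span \<iota> n A (\<epsilon> ` R)"
    have J: "right_ideal ?S ?J" "\<forall>x\<in>?J. \<forall>x'\<in>?J. ?\<Sigma> x \<otimes>\<^bsub>?S\<^esub> x' = \<zero>\<^bsub>?S\<^esub>"
      "?f ` (?J \<inter> Sym ?S ?\<Sigma>) = {0}"
      using \<epsilon>(2)[OF R] by (auto simp: isotropic_ideal_def)
    note Jc = right_ideal_closed[OF J(1)]
    have f0: "?f x = 0" if "x \<in> ?J" "?\<Sigma> x = x" for x
    proof -
      have "x \<in> ?J \<inter> Sym ?S ?\<Sigma>" using that Jc(1) by (auto simp: Sym_def)
      then have "?f x \<in> {0}" unfolding J(3)[symmetric] by (rule imageI)
      then show ?thesis by simp
    qed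
    show "\<exists>J. (\<forall>z\<in>R. \<epsilon> z \<subseteq> J) \<and> J \<subseteq> carrier ?S \<and> \<zero>\<^bsub>?S\<^esub> \<in> J \<and>
        (\<forall>x\<in>J. \<forall>x'\<in>J. x \<oplus>\<^bsub>?S\<^esub> x' \<in> J) \<and> (\<forall>x\<in>J. \<forall>r\<in>carrier ?S. x \<otimes>\<^bsub>?S\<^esub> r \<in> J) \<and>
        (\<forall>x\<in>J. \<forall>x'\<in>J. ?\<Sigma> x \<otimes>\<^bsub>?S\<^esub> x' = \<zero>\<^bsub>?S\<^esub>) \<and> (\<forall>x\<in>J. ?\<Sigma> x = x \<longrightarrow> ?f x = 0)"
      by (intro exI[of _ ?J] conjI ballI impI)
        (simp_all only: SB_span_upper[OF imageI] Jc J(2)[rule_format] f0)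
  qed (fact \<Sigma>_simps FA.\<Sigma>_mult[OF \<sigma>] T_add T_smult T_mult T_\<Sigma> f_add f_trace \<phi>)+
  have \<sigma>L: "\<sigma>\<^sub>L l \<in> LL" if "l \<in> LL" for l
    using assms(12) that
    by (auto simp: etale_involution_def alg_iso_def bij_betw_def LL_def)
  have \<psi>_\<phi>: "\<psi> (\<phi> y) l = \<psi> y (\<sigma>\<^sub>L l)" if "y \<in> Y" "l \<in> LL" for y l
    using assms(13) that by (simp add: XX_map_def compose_def LL_def)
  have \<sigma>_eq: "\<sigma>\<^sub>L l = \<sigma> l" if l: "l \<in> LL" for l
  proof (rule TE.\<tau>_eqD)
    have "?\<Sigma> (?\<tau> l) = ?\<tau> (\<sigma>\<^sub>L l)" by (rule QE.\<sigma>_\<tau>[OF \<sigma>L[OF l] l \<psi>_\<phi>[OF _ l]])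
    then show "?\<tau> (\<sigma>\<^sub>L l) = ?\<tau> (\<sigma> l)" using FA.\<Sigma>_tensor[OF \<sigma> LL_carrier[OF l], of 1] by simp
  qed (use l \<sigma>L LL_carrier \<sigma>_simps in auto)
  have trace: "\<iota> (f x) = Trd \<iota> (2 * n) A (l \<otimes>\<^bsub>A\<^esub> x)"
    if x: "x \<in> Sym A \<sigma>" and l: "l \<in> LL" and sum: "l \<oplus>\<^bsub>A\<^esub> \<sigma>\<^sub>L l = \<one>\<^bsub>A\<^esub>" for x l
  proof -
    have xA: "x \<in> carrier A" "\<sigma> x = x" using x by (auto simp: Sym_def)
    \<comment> \<open>Apply the character \<open>\<psi> y\<close> to the equation
      \<open>l + \<sigma>\<^sub>L l = 1\<close>; its value at \<open>\<sigma>\<^sub>L l\<close> is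
      that of the character at \<open>\<phi> y\<close> at \<open>l\<close>.\<close>
    have "\<psi> y l + \<psi> (\<phi> y) l = 1" if y: "y \<in> Y" for y
      using \<psi>_hom(1)[OF y l \<sigma>L[OF l]] \<psi>_hom(4)[OF y LL_one LL_one] \<psi>_\<phi>[OF y l] sum by simp
    moreover have "?\<Sigma> (?\<tau> x) = ?\<tau> x" using FA.\<Sigma>_tensor[OF \<sigma> xA(1), of 1] xA(2) by simp
    ultimately have "?f (?\<tau> x) = T (?\<tau> l \<otimes>\<^bsub>?S\<^esub> ?\<tau> x)"
      using QE.f_eq_T[OF l] xA by simp
    then show ?thesis using f_val[OF x] xA LL_carrier[OF l] by (simp add: Trd FA.AS.\<tau>_mult)
  qed
  have "etale \<iota> (2 * n) L" using TE.LA_etale assms(6) by (simp add: L)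
  moreover have "(\<lambda>l. l) \<in> alg_hom L A"
    using LL_carrier by (simp add: alg_hom_def Ring.ring_hom_def L)
  ultimately show ?thesis
    using assms(12) \<sigma>_eq trace
    by (simp add: alg_inv_embedding_def) (simp add: L)
qed

end
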